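(* For each $n\ge1$ let $(\Pi_n,X_n)$ be a Nash equilibrium of the reduced game $\overline{G}_n(\mu)$, let $(p^n_q)_{q=1,\dots,n}$ be the corresponding price process (pure strategy of player 2), and set $Z^n_t:=p^n_{\lfloor nt\rfloor}$ for $t\in\,]0,1]$. Let $\nu$ be the unique probability measure on $\mathbb{R}$ with $T_{\overline\lambda_\infty}(\nu)=\overline\lambda_\infty$, where $\overline\lambda_\infty=\mathcal{N}(0,1)$, and write $\Psi_\nu:=\Psi_{\nu,\overline\lambda_\infty}$. Let $B$ be a standard Brownian motion on a probability space $(\tilde\Omega,\mathcal{A},\tilde P)$, let $Z_t:=E_{\tilde P}[\Psi_\nu'(B_1)\mid B_t]$, $\tilde Y:=H'(\Psi_\nu'(B_1)B_1-\Psi_\nu(B_1))$, and $\tilde{y}:=\dfrac{1}{E_{\tilde{P}}[1/\tilde{Y}]\;\tilde{Y}}>0$. Then, as $n\to\infty$, the price process $(Z^n_t)_{t\in]0,1]}$ under the probability $\Pi_n$ converges in finite dimensional distribution to the process $Z$ when $\tilde\Omega$ is endowed with the probability $\tilde y\cdot\tilde P$ (the probability with density $\tilde y$ with respect to $\tilde P$).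
   Context: Standing assumptions. (A1) $\mu$ is a probability measure on $[0,1]$, absolutely continuous with respect to Lebesgue measure, with strictly positive $C^1$ density $f_\mu$ on $[0,1]$. (A2) $H:\mathbb{R}\to\mathbb{R}$ is strictly increasing, strictly convex and $C^2$, $H'$ is Lipschitz-continuous, and there are constants $\epsilon,K>0$ with $\epsilon<H'(x)<K$ for all $x\in\mathbb{R}$. Game. $\Omega_n=\{-1,+1\}^n$, $\omega=(u_1,\dots,u_n)$; $S_n(\omega)=\frac{1}{\sqrt n}\sum_{q=1}^n u_q$. In the reduced game $\overline{G}_n(\mu)$, a strategy of player 1 is a probability $\Pi$ on pairs $(\omega,L)\in\Omega_n\times\mathbb{R}$ whose marginal on $L$ is $\mu$. A strategy of player 2 is a sequence $(p_1,\dots,p_n)$ with $p_q:\{-1,+1\}^{q-1}\to\mathbb{R}$, identified with the function $X(\omega)=\frac{1}{\sqrt n}\sum_{q=1}^n u_q\,p_q(u_1,\dots,u_{q-1})$, which determines $(p_q)$ uniquely; $\mathbb{X}_n$ is the set of such functions. Payoffs: $g_1(\Pi,X)=E_\Pi[LS_n-X]$ (maximized by player 1), $g_2(\Pi,X)=E_\Pi[H(LS_n-X)]$ (minimized by player 2). A Nash equilibrium is a pair $(\Pi,X)$ such that $\Pi$ maximizes $g_1(\cdot,X)$ and $X$ minimizes $g_2(\Pi,\cdot)$. "Under $\Pi_n$" means that $(u_1,\dots,u_n,L)\sim\Pi_n$ (historical law). For $t<1/n$ the value $Z^n_t$ is irrelevant (take e.g. $p^n_0:=p^n_1$). Operator $T_\lambda$.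 $F_\mu,F_\nu$ denote cumulative distribution functions, $F^{-1}(y)=\inf\{x\mid F(x)>y\}$ their right inverses, with $F_\mu^{-1}(1)=1$. For a probability $\nu$ on $\mathbb{R}$: $\phi_\nu(\ell)=F_\nu^{-1}(F_\mu(\ell))$, $\gamma_\nu(s)=F_\mu^{-1}(F_\nu(s))$, $\Gamma_\nu(s)=\int_0^s\gamma_\nu(t)\,dt$; $\overline\Pi_\nu$ is the law of $(L,\phi_\nu(L))$ when $L\sim\mu$. For a probability $\lambda$ on $\mathbb{R}$ with finite first moment, $\Psi_{\nu,\lambda}(s)=\Gamma_\nu(s)-E_\lambda[\Gamma_\nu]$. With $(L,S)\sim\overline\Pi_\nu$, let $Y_{\nu,\lambda}=E_{\overline\Pi_\nu}[H'(LS-\Psi_{\nu,\lambda}(S))\mid S]$ (a function of $S$), $\alpha_{\nu,\lambda}=1/E_\nu[Y_{\nu,\lambda}]$, and let $T_\lambda(\nu)$ be the probability measure with density $\alpha_{\nu,\lambda}Y_{\nu,\lambda}$ with respect to $\nu$. There is a unique $\nu$ with $T_{\overline\lambda_\infty}(\nu)=\overline\lambda_\infty$, and for it $\Psi_{\nu,\overline\lambda_\infty}$ is $C^2$. Convergence in finite dimensional distribution of $Z^n$ to $Z$: for every finite set $J$ of times in $]0,1]$, the random vectors $(Z^n_t)_{t\in J}$ converge in law to $(Z_t)_{t\in J}$. *)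

theory Defs
  imports "HOL-Probability.Probability"
begin

section \<open>Assumptions on the prior and on the second player's utility\<close>

definition admissible_prior :: "real measure \<Rightarrow> bool" where
  "admissible_prior \<mu> \<longleftrightarrow> prob_space \<mu> \<and>
     (\<exists>f f'. (\<forall>x\<in>{0..1}. 0 < f x \<and> (f has_real_derivative f' x) (at x within {0..1})) \<and>
        continuous_on {0..1} f' \<and>
        \<mu> = density lborel (\<lambda>x. ennreal (f x * indicator {0..1} x)))"

definition strictly_convex :: "(real \<Rightarrow> real) \<Rightarrow> bool" where
  "strictly_convex f \<longleftrightarrow>
     (\<forall>x y t. x \<noteq> y \<longrightarrow> 0 < t \<longrightarrow> t < 1 \<longrightarrow>
        f ((1 - t) * x + t * y) < (1 - t) * f x + t * f y)"

definition admissible_utility :: "(real \<Rightarrow> real) \<Rightarrow> bool" where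
  "admissible_utility H \<longleftrightarrow>
     strict_mono H \<and> strictly_convex H \<and>
     H C1_differentiable_on UNIV \<and> deriv H C1_differentiable_on UNIV \<and>
     (\<exists>C. C-lipschitz_on UNIV (deriv H)) \<and>
     (\<exists>\<epsilon>>0. \<exists>K>0. \<forall>x. \<epsilon> < deriv H x \<and> deriv H x < K)"


section \<open>The reduced game\<close>

definition Omega :: "nat \<Rightarrow> (nat \<Rightarrow> real) set" where
  "Omega n = {1..n} \<rightarrow>\<^sub>E {-1, 1}"

definition S_sum :: "nat \<Rightarrow> (nat \<Rightarrow> real) \<Rightarrow> real" where
  "S_sum n \<omega> = (\<Sum>q = 1..n. \<omega> q) / sqrt (real n)"

definition strategies1 :: "real measure \<Rightarrow> nat \<Rightarrow> ((nat \<Rightarrow> real) \<times> real) measure set" where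
  "strategies1 \<mu> n = {\<pi>. prob_space \<pi> \<and>
     sets \<pi> = sets (count_space (Omega n) \<Otimes>\<^sub>M borel) \<and> distr \<pi> borel snd = \<mu>}"

text \<open>
  A price process is a family \<open>p\<close> where \<open>p q\<close> is applied to the history
  \<open>(u\<^sub>1, \<dots>, u\<^sub>q\<^sub>-\<^sub>1)\<close>, i.e. to the restriction of \<open>\<omega>\<close> to \<open>{1..<q}\<close>; the values of
  \<open>p q\<close> at other arguments play no role.
\<close>

definition price :: "(nat \<Rightarrow> (nat \<Rightarrow> real) \<Rightarrow> real) \<Rightarrow> nat \<Rightarrow> (nat \<Rightarrow> real) \<Rightarrow> real" where
  "price p q \<omega> = p q (restrict \<omega> {1..<q})"

definition represents ::
  "nat \<Rightarrow> (nat \<Rightarrow> (nat \<Rightarrow> real) \<Rightarrow> real) \<Rightarrow> ((nat \<Rightarrow> real) \<Rightarrow> real) \<Rightarrow> bool" where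
  "represents n p X \<longleftrightarrow>
     (\<forall>\<omega>\<in>Omega n. X \<omega> = (\<Sum>q = 1..n. \<omega> q * price p q \<omega>) / sqrt (real n))"

definition strategies2 :: "nat \<Rightarrow> ((nat \<Rightarrow> real) \<Rightarrow> real) set" where
  "strategies2 n = {X. \<exists>p. represents n p X}"

definition payoff1 ::
  "nat \<Rightarrow> ((nat \<Rightarrow> real) \<times> real) measure \<Rightarrow> ((nat \<Rightarrow> real) \<Rightarrow> real) \<Rightarrow> real" where
  "payoff1 n \<pi> X = (\<integral>z. snd z * S_sum n (fst z) - X (fst z) \<partial>\<pi>)"

definition payoff2 ::
  "(real \<Rightarrow> real) \<Rightarrow> nat \<Rightarrow> ((nat \<Rightarrow> real) \<times> real) measure \<Rightarrow> ((nat \<Rightarrow> real) \<Rightarrow> real) \<Rightarrow> real" where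
  "payoff2 H n \<pi> X = (\<integral>z. H (snd z * S_sum n (fst z) - X (fst z)) \<partial>\<pi>)"

definition nash_equilibrium ::
  "real measure \<Rightarrow> (real \<Rightarrow> real) \<Rightarrow> nat \<Rightarrow>
     ((nat \<Rightarrow> real) \<times> real) measure \<Rightarrow> ((nat \<Rightarrow> real) \<Rightarrow> real) \<Rightarrow> bool" where
  "nash_equilibrium \<mu> H n \<pi> X \<longleftrightarrow>
     \<pi> \<in> strategies1 \<mu> n \<and> X \<in> strategies2 n \<and>
     (\<forall>\<pi>'\<in>strategies1 \<mu> n. payoff1 n \<pi>' X \<le> payoff1 n \<pi> X) \<and>
     (\<forall>X'\<in>strategies2 n. payoff2 H n \<pi> X \<le> payoff2 H n \<pi> X')"

text \<open>
  For \<open>t < 1 / n\<close> the index is \<open>0\<close> and the value is an arbitrary constant.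
\<close>

definition price_at ::
  "nat \<Rightarrow> (nat \<Rightarrow> (nat \<Rightarrow> real) \<Rightarrow> real) \<Rightarrow> real \<Rightarrow> (nat \<Rightarrow> real) \<Rightarrow> real" where
  "price_at n p t \<omega> = price p (nat \<lfloor>real n * t\<rfloor>) \<omega>"


section \<open>The operator \<open>T_op\<close>\<close>

definition cond_exp_given :: "'a measure \<Rightarrow> ('a \<Rightarrow> real) \<Rightarrow> ('a \<Rightarrow> real) \<Rightarrow> 'a \<Rightarrow> real" where
  "cond_exp_given M V f = real_cond_exp M (vimage_algebra (space M) V borel) f"

text \<open>
  \<open>Inf\<close> on the reals is only meaningful for nonempty sets that are bounded below.  In
  \<open>phi\<close> the argument of \<open>right_inverse (cdf \<nu>)\<close> lies in \<open>{0<..<1}\<close> for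
  \<open>\<mu>\<close>-almost every \<open>l\<close>; the exceptional values do not affect \<open>Pi_bar\<close>.
\<close>

definition right_inverse :: "(real \<Rightarrow> real) \<Rightarrow> real \<Rightarrow> real" where
  "right_inverse F y = Inf {x. y < F x}"

definition prior_inverse :: "real measure \<Rightarrow> real \<Rightarrow> real" where
  "prior_inverse \<mu> y = (if y = 1 then 1 else right_inverse (cdf \<mu>) y)"

definition phi :: "real measure \<Rightarrow> real measure \<Rightarrow> real \<Rightarrow> real" where
  "phi \<mu> \<nu> l = right_inverse (cdf \<nu>) (cdf \<mu> l)"

definition gam :: "real measure \<Rightarrow> real measure \<Rightarrow> real \<Rightarrow> real" where
  "gam \<mu> \<nu> s = prior_inverse \<mu> (cdf \<nu> s)"

definition Gam :: "real measure \<Rightarrow> real measure \<Rightarrow> real \<Rightarrow> real" where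
  "Gam \<mu> \<nu> s = (LBINT t=0..ereal s. gam \<mu> \<nu> t)"

definition Pi_bar :: "real measure \<Rightarrow> real measure \<Rightarrow> (real \<times> real) measure" where
  "Pi_bar \<mu> \<nu> = distr \<mu> borel (\<lambda>l. (l, phi \<mu> \<nu> l))"

definition Psi :: "real measure \<Rightarrow> real measure \<Rightarrow> real measure \<Rightarrow> real \<Rightarrow> real" where
  "Psi \<mu> \<rho> \<nu> s = Gam \<mu> \<nu> s - (\<integral>x. Gam \<mu> \<nu> x \<partial>\<rho>)"

text \<open>
  A random variable on the plane that is measurable with respect to the sigma-algebra generated
  by the second coordinate depends on that coordinate alone (see \<open>cond_exp_given_snd\<close> below), so
  evaluating it at \<open>(0, s)\<close> yields it as a function of \<open>s\<close>.
\<close>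

definition Y_cond ::
  "real measure \<Rightarrow> (real \<Rightarrow> real) \<Rightarrow> real measure \<Rightarrow> real measure \<Rightarrow> real \<Rightarrow> real" where
  "Y_cond \<mu> H \<rho> \<nu> s =
     cond_exp_given (Pi_bar \<mu> \<nu>) snd (\<lambda>(l, s'). deriv H (l * s' - Psi \<mu> \<rho> \<nu> s')) (0, s)"

lemma cond_exp_given_snd:
  fixes M :: "(real \<times> real) measure"
  assumes "space M = UNIV"
  shows "cond_exp_given M snd f (l, s) = cond_exp_given M snd f (0, s)"
proof -
  let ?N = "vimage_algebra (UNIV :: (real \<times> real) set) snd (borel :: real measure)"
  let ?g = "cond_exp_given M snd f"
  have "?g \<in> borel_measurable ?N"
    by (simp add: cond_exp_given_def assms borel_measurable_cond_exp)
  then have "?g -` {?g (0, s)} \<inter> space ?N \<in> sets ?N"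
    by (rule measurable_sets) simp
  then obtain A where "?g -` {?g (0, s)} = snd -` A"
    by (auto simp: sets_vimage_algebra2)
  then show ?thesis
    by (metis snd_conv vimage_eq singletonI singletonD)
qed

definition T_op ::
  "real measure \<Rightarrow> (real \<Rightarrow> real) \<Rightarrow> real measure \<Rightarrow> real measure \<Rightarrow> real measure" where
  "T_op \<mu> H \<rho> \<nu> =
     density \<nu> (\<lambda>s. ennreal (1 / (\<integral>x. Y_cond \<mu> H \<rho> \<nu> x \<partial>\<nu>) * Y_cond \<mu> H \<rho> \<nu> s))"


section \<open>Brownian motion\<close>

text \<open>
  Only the time interval \<open>[0, 1]\<close> is used; the restriction to it of a Brownian motion
  indexed by \<open>[0, \<infinity>)\<close> satisfies this definition.
\<close>

locale standard_brownian_motion = prob_space M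
  for M :: "'a measure" +
  fixes B :: "real \<Rightarrow> 'a \<Rightarrow> real"
  assumes random_variable: "\<And>t. t \<in> {0..1} \<Longrightarrow> B t \<in> borel_measurable M"
    and start: "AE \<omega> in M. B 0 \<omega> = 0"
    and indep_increments: "\<And>(k::nat) (t::nat \<Rightarrow> real). mono_on {..k} t \<Longrightarrow> t ` {..k} \<subseteq> {0..1} \<Longrightarrow>
        indep_vars (\<lambda>_. borel) (\<lambda>i \<omega>. B (t (Suc i)) \<omega> - B (t i) \<omega>) {..<k}"
    and normal_increments: "\<And>s t. 0 \<le> s \<Longrightarrow> s < t \<Longrightarrow> t \<le> 1 \<Longrightarrow>
        distributed M lborel (\<lambda>\<omega>. B t \<omega> - B s \<omega>) (normal_density 0 (sqrt (t - s)))"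
    and continuous_paths: "AE \<omega> in M. continuous_on {0..1} (\<lambda>t. B t \<omega>)"


section \<open>Convergence in finite dimensional distribution\<close>

definition law_on :: "'t set \<Rightarrow> 'a measure \<Rightarrow> ('t \<Rightarrow> 'a \<Rightarrow> real) \<Rightarrow> ('t \<Rightarrow> real) measure" where
  "law_on J M Z = distr M (Pi\<^sub>M J (\<lambda>_. borel)) (\<lambda>\<omega>. \<lambda>t\<in>J. Z t \<omega>)"

definition weak_conv_on ::
  "'t set \<Rightarrow> (nat \<Rightarrow> ('t \<Rightarrow> real) measure) \<Rightarrow> ('t \<Rightarrow> real) measure \<Rightarrow> bool" where
  "weak_conv_on J Q R \<longleftrightarrow>
     (\<forall>g :: ('t \<Rightarrow> real) \<Rightarrow> real.
        continuous_map (powertop_real J) euclideanreal g \<longrightarrow> bounded (g ` (J \<rightarrow>\<^sub>E UNIV)) \<longrightarrow>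
        (\<lambda>n. \<integral>x. g x \<partial>Q n) \<longlonglongrightarrow> (\<integral>x. g x \<partial>R))"

definition fdd_convergence ::
  "'t set \<Rightarrow> (nat \<Rightarrow> 'a measure) \<Rightarrow> (nat \<Rightarrow> 't \<Rightarrow> 'a \<Rightarrow> real) \<Rightarrow>
     'b measure \<Rightarrow> ('t \<Rightarrow> 'b \<Rightarrow> real) \<Rightarrow> bool" where
  "fdd_convergence I M Z N W \<longleftrightarrow>
     (\<forall>J. finite J \<longrightarrow> J \<subseteq> I \<longrightarrow>
        weak_conv_on J (\<lambda>n. law_on J (M n) (Z n)) (law_on J N W))"


section \<open>The limit process\<close>

definition limit_price ::
  "'a measure \<Rightarrow> (real \<Rightarrow> 'a \<Rightarrow> real) \<Rightarrow> (real \<Rightarrow> real) \<Rightarrow> real \<Rightarrow> 'a \<Rightarrow> real" where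
  "limit_price P B \<psi> t = cond_exp_given P (B t) (\<lambda>\<omega>. deriv \<psi> (B 1 \<omega>))"

definition Y_tilde ::
  "(real \<Rightarrow> 'a \<Rightarrow> real) \<Rightarrow> (real \<Rightarrow> real) \<Rightarrow> (real \<Rightarrow> real) \<Rightarrow> 'a \<Rightarrow> real" where
  "Y_tilde B H \<psi> \<omega> = deriv H (deriv \<psi> (B 1 \<omega>) * B 1 \<omega> - \<psi> (B 1 \<omega>))"

definition y_tilde ::
  "'a measure \<Rightarrow> (real \<Rightarrow> 'a \<Rightarrow> real) \<Rightarrow> (real \<Rightarrow> real) \<Rightarrow> (real \<Rightarrow> real) \<Rightarrow> 'a \<Rightarrow> real" where
  "y_tilde P B H \<psi> \<omega> =
     1 / ((\<integral>\<omega>'. 1 / Y_tilde B H \<psi> \<omega>' \<partial>P) * Y_tilde B H \<psi> \<omega>)"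

end

theory Submission
  imports Defs "HOL-Real_Asymp.Real_Asymp"
begin

text \<open>
  \<^bold>\<open>The finite game.\<close> The first player maximises the mean of \<open>L * S - X\<close>, so almost surely the
  path played maximises this over all paths.  Every path has positive probability, which forces
  \<open>X = F (S)\<close> for a convex potential \<open>F\<close> of which \<open>L\<close> is a subgradient at \<open>S\<close>.  The functions
  \<open>X\<close> available to the second player are exactly those of mean zero under the uniform law on the
  cube, so the first order condition says that the equilibrium law of the path, reweighted by the
  marginal utility \<open>H' (L * S - F (S))\<close>, is a constant \<open>c\<close> times the uniform law
  (\<open>nash_equilibrium_potential\<close>).

  \<^bold>\<open>The limit.\<close> The equation \<open>T \<nu> = N\<close> is the same first order condition with the Gaussian law \<open>N\<close>
  in place of the law of the uniform walk (\<open>limit_first_order\<close>), and \<open>\<phi> L\<close>, with law \<open>\<nu>\<close>, is a best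
  reply of the first player to \<open>\<psi>\<close> (\<open>phi_subgradient\<close>).

  \<^bold>\<open>Comparison.\<close> Confront \<open>F\<^sub>n\<close> with the coupling of the limit and \<open>\<psi>\<close> with the equilibrium law of
  the finite game.  The optimality of both players in both games closes a cycle of inequalities,
  up to the means \<open>E \<psi> (S\<^sub>n)\<close> and \<open>E F\<^sub>n (N)\<close>, which tend to zero by the central limit theorem
  because all potentials are 1-Lipschitz.  What is squeezed to zero is the mean excess of \<open>H\<close> over its
  tangents; since \<open>H\<close> is strictly convex and \<open>\<nu>\<close> charges every interval, \<open>F\<^sub>n\<close> tends to \<open>\<psi>\<close>
  pointwise (\<open>potentials_converge\<close>).

  \<^bold>\<open>Prices and historical law.\<close> Convex functions that converge to a differentiable one have
  converging slopes.  A price is the mean, over the remaining steps, of a centred slope of \<open>F\<^sub>n\<close>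
  (\<open>price_eq_mean_slope\<close>), hence a function of the current sum that converges, even along
  convergent arguments, to \<open>x \<mapsto> E (\<psi>' (x + B\<^sub>1 - B\<^sub>t))\<close>.  Since \<open>L\<close> lies between two slopes of \<open>F\<^sub>n\<close> at
  the terminal sum \<open>s\<close>, the marginal utility is close to \<open>H' (\<psi>' (s) * s - \<psi> (s))\<close>, so the
  equilibrium law has asymptotically a density proportional to the inverse of this with respect to
  the uniform law (\<open>equilibrium_law_approx\<close>).  Everything is thereby reduced to expectations of
  functions of finitely many increments of the uniform walk, and these converge to the
  corresponding Brownian expectations (\<open>joint_price_expectation_tendsto\<close>).
\<close>

section \<open>Continuous convergence along weakly convergent laws\<close>

text \<open>Convergence along arbitrary convergent arguments is the mode in which slopes and prices converge;
  it is what is needed to pass to the limit in \<open>\<integral> f\<^sub>n d\<mu>\<^sub>n\<close> when both \<open>f\<^sub>n\<close> and the laws \<open>\<mu>\<^sub>n\<close> vary.\<close>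

definition continuously_converges ::
  "(nat \<Rightarrow> 'a::topological_space \<Rightarrow> 'b::topological_space) \<Rightarrow> ('a \<Rightarrow> 'b) \<Rightarrow> bool" where
  "continuously_converges f g \<longleftrightarrow>
     (\<forall>x l. x \<longlonglongrightarrow> l \<longrightarrow> (\<lambda>n. f n (x n)) \<longlonglongrightarrow> g l)"

lemma continuously_convergesD:
  "continuously_converges f g \<Longrightarrow> x \<longlonglongrightarrow> l \<Longrightarrow> (\<lambda>n. f n (x n)) \<longlonglongrightarrow> g l"
  by (simp add: continuously_converges_def)

lemma continuously_converges_pointwise:
  "continuously_converges f g \<Longrightarrow> (\<lambda>n. f n x) \<longlonglongrightarrow> g x"
  by (rule continuously_convergesD) auto

lemma continuously_converges_measurable:
  fixes g :: "'a::topological_space \<Rightarrow> real"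
  assumes "continuously_converges f g" "\<And>n. f n \<in> borel_measurable borel"
  shows "g \<in> borel_measurable borel"
  by (rule borel_measurable_LIMSEQ_real[of borel f])
     (auto intro: continuously_converges_pointwise assms)

text \<open>Skorohod's representation turns weak convergence into pointwise convergence of the arguments,
  after which dominated convergence applies.\<close>

lemma weak_conv_integral_continuously_converges:
  fixes \<mu> :: "nat \<Rightarrow> real measure" and f :: "nat \<Rightarrow> real \<Rightarrow> real"
  assumes \<mu>: "\<And>n. real_distribution (\<mu> n)" and M: "real_distribution M"
    and w: "weak_conv_m \<mu> M"
    and meas: "\<And>n. f n \<in> borel_measurable borel" and bnd: "\<And>n x. \<bar>f n x\<bar> \<le> C"
    and lim: "continuously_converges f g"
  shows "(\<lambda>n. integral\<^sup>L (\<mu> n) (f n)) \<longlonglongrightarrow> integral\<^sup>L M g"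
proof -
  note [measurable] = meas continuously_converges_measurable[OF lim meas]
  from Skorohod[OF \<mu> M w] obtain \<Omega> :: "real measure" and Y Y' where
    \<Omega>: "prob_space \<Omega>" and Y: "\<And>n. Y n \<in> measurable \<Omega> borel"
    and dY: "\<And>n. distr \<Omega> borel (Y n) = \<mu> n"
    and Y': "Y' \<in> measurable \<Omega> lborel" and dY': "distr \<Omega> borel Y' = M"
    and conv: "\<And>x. x \<in> space \<Omega> \<Longrightarrow> (\<lambda>n. Y n x) \<longlonglongrightarrow> Y' x"
    by blast
  interpret prob_space \<Omega> by fact
  have [measurable]: "Y' \<in> borel_measurable \<Omega>" using Y' by simp
  note [measurable] = Y
  have "(\<lambda>n. \<integral>x. f n (Y n x) \<partial>\<Omega>) \<longlonglongrightarrow> (\<integral>x. g (Y' x) \<partial>\<Omega>)"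
  proof (rule integral_dominated_convergence[where w = "\<lambda>_. C"])
    show "AE x in \<Omega>. (\<lambda>n. f n (Y n x)) \<longlonglongrightarrow> g (Y' x)"
      by (auto intro!: AE_I2 continuously_convergesD[OF lim] conv)
  qed (auto simp: bnd)
  moreover have "(\<integral>x. f n (Y n x) \<partial>\<Omega>) = integral\<^sup>L (\<mu> n) (f n)" for n
    by (subst dY[symmetric], subst integral_distr) auto
  moreover have "(\<integral>x. g (Y' x) \<partial>\<Omega>) = integral\<^sup>L M g"
    by (subst dY'[symmetric], subst integral_distr) auto
  ultimately show ?thesis by simp
qed

text \<open>Integrating out one coordinate at a time preserves continuous convergence, so the
  one-dimensional case suffices.\<close>

lemma PiM_integral_continuously_converges:
  fixes \<mu> :: "nat \<Rightarrow> 'i \<Rightarrow> real measure" and f :: "nat \<Rightarrow> ('i \<Rightarrow> real) \<Rightarrow> real"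
  assumes "finite I"
    and \<mu>: "\<And>n i. real_distribution (\<mu> n i)" and M: "\<And>i. real_distribution (M i)"
    and w: "\<And>i. i \<in> I \<Longrightarrow> weak_conv_m (\<lambda>n. \<mu> n i) (M i)"
    and meas: "\<And>n. f n \<in> borel_measurable (Pi\<^sub>M I (\<lambda>_. borel))"
    and bnd: "\<And>n x. \<bar>f n x\<bar> \<le> C"
    and lim: "\<And>x l. (\<And>n. x n \<in> extensional I) \<Longrightarrow> l \<in> extensional I \<Longrightarrow>
               (\<And>i. i \<in> I \<Longrightarrow> (\<lambda>n. x n i) \<longlonglongrightarrow> l i) \<Longrightarrow> (\<lambda>n. f n (x n)) \<longlonglongrightarrow> g l"
  shows "(\<lambda>n. integral\<^sup>L (Pi\<^sub>M I (\<mu> n)) (f n)) \<longlonglongrightarrow> integral\<^sup>L (Pi\<^sub>M I M) g"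
  using assms(1) w meas bnd lim
proof (induction I arbitrary: f g rule: finite_induct)
  case empty
  have "(\<lambda>n. f n (\<lambda>_. undefined)) \<longlonglongrightarrow> g (\<lambda>_. undefined)"
    by (rule empty(4)) (auto simp: extensional_def)
  then show ?case by (simp add: PiM_empty lebesgue_integral_count_space_finite)
next
  case (insert i I)
  interpret \<mu>: real_distribution "\<mu> n j" for n j by (rule \<mu>)
  interpret M: real_distribution "M j" for j by (rule M)
  interpret \<mu>P: product_prob_space "\<mu> n" for n ..
  interpret MP: product_prob_space M ..
  interpret \<mu>F: prob_space "Pi\<^sub>M J (\<mu> n)" for n J by (rule prob_space_PiM) unfold_locales
  interpret MF: prob_space "Pi\<^sub>M J M" for J by (rule prob_space_PiM) unfold_locales
  have smu: "sets (Pi\<^sub>M J (\<mu> n)) = sets (Pi\<^sub>M J (\<lambda>_. borel))" for n J by (intro sets_PiM_cong) auto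
  have sM: "sets (Pi\<^sub>M J M) = sets (Pi\<^sub>M J (\<lambda>_. borel))" for J by (intro sets_PiM_cong) auto
  note [measurable_cong] = smu sM
  note [measurable] = insert.prems(2)
  have gm: "g \<in> borel_measurable (Pi\<^sub>M (insert i I) (\<lambda>_. borel))"
    by (rule borel_measurable_LIMSEQ_real[where u = f])
       (auto intro!: insert.prems(4) simp: space_PiM PiE_def)
  note [measurable] = gm
  have gb: "\<bar>g x\<bar> \<le> C" if "x \<in> extensional (insert i I)" for x
    by (rule LIMSEQ_le_const2[OF tendsto_rabs[OF insert.prems(4)[of "\<lambda>_. x" x]]])
       (auto simp: that insert.prems(3))
  have upd: "(\<lambda>y. x(i := y)) \<in> measurable borel (Pi\<^sub>M (insert i I) (\<lambda>_. borel))"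
    if "x \<in> extensional I" for x :: "'i \<Rightarrow> real"
    by (rule measurable_fun_upd[where J = I]) (use that in \<open>auto simp: space_PiM PiE_def\<close>)
  have fu: "(\<lambda>y. f n (x(i := y))) \<in> borel_measurable borel" if "x \<in> extensional I" for x n
    using measurable_compose[OF upd[OF that] insert.prems(2)] .
  let ?f = "\<lambda>n x. if x \<in> extensional I then \<integral>y. f n (x(i := y)) \<partial>\<mu> n i else 0"
  let ?g = "\<lambda>x. \<integral>y. g (x(i := y)) \<partial>M i"
  have "(\<lambda>n. integral\<^sup>L (Pi\<^sub>M I (\<mu> n)) (?f n)) \<longlonglongrightarrow> integral\<^sup>L (Pi\<^sub>M I M) ?g"
  proof (rule insert.IH)
    show "weak_conv_m (\<lambda>n. \<mu> n j) (M j)" if "j \<in> I" for j using insert.prems(1) that by simp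
    show "?f n \<in> borel_measurable (Pi\<^sub>M I (\<lambda>_. borel))" for n
    proof -
      have "(\<lambda>x. \<integral>y. f n (x(i := y)) \<partial>\<mu> n i) \<in> borel_measurable (Pi\<^sub>M I (\<lambda>_. borel))"
        by measurable
      then show ?thesis
        by (rule measurable_cong[THEN iffD1, rotated]) (auto simp: space_PiM PiE_def)
    qed
    have C0: "0 \<le> C" using insert.prems(3)[of 0 undefined] by linarith
    have "\<bar>\<integral>y. f n (x(i := y)) \<partial>\<mu> n i\<bar> \<le> C" if "x \<in> extensional I" for n x
    proof -
      have "\<bar>\<integral>y. f n (x(i := y)) \<partial>\<mu> n i\<bar> \<le> (\<integral>y. \<bar>f n (x(i := y))\<bar> \<partial>\<mu> n i)"
        by (rule integral_abs_bound)
      also have "\<dots> \<le> (\<integral>y. C \<partial>\<mu> n i)"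
        using fu[OF that]
        by (intro integral_mono \<mu>.integrable_const_bound[where B = C])
           (auto simp: insert.prems(3) C0)
      finally show ?thesis using \<mu>.prob_space by simp
    qed
    then show "\<bar>?f n x\<bar> \<le> C" for n x using C0 by auto
    show "(\<lambda>n. ?f n (x n)) \<longlonglongrightarrow> ?g l"
      if x: "\<And>n. x n \<in> extensional I" and l: "l \<in> extensional I"
        and c: "\<And>j. j \<in> I \<Longrightarrow> (\<lambda>n. x n j) \<longlonglongrightarrow> l j" for x l
    proof -
      have "(\<lambda>n. integral\<^sup>L (\<mu> n i) (\<lambda>y. f n ((x n)(i := y)))) \<longlonglongrightarrow>
              integral\<^sup>L (M i) (\<lambda>y. g (l(i := y)))"
      proof (rule weak_conv_integral_continuously_converges[OF \<mu> M])
        show "weak_conv_m (\<lambda>n. \<mu> n i) (M i)" using insert.prems(1) by simp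
        show "(\<lambda>y. f n ((x n)(i := y))) \<in> borel_measurable borel" for n using fu[OF x] .
        show "\<bar>f n ((x n)(i := y))\<bar> \<le> C" for n y by (rule insert.prems(3))
        show "continuously_converges (\<lambda>n y. f n ((x n)(i := y))) (\<lambda>y. g (l(i := y)))"
          unfolding continuously_converges_def
        proof (intro allI impI insert.prems(4))
          fix y :: "nat \<Rightarrow> real" and z :: real and j assume "y \<longlonglongrightarrow> z" "j \<in> insert i I"
          then show "(\<lambda>n. ((x n)(i := y n)) j) \<longlonglongrightarrow> (l(i := z)) j" using c by auto
        qed (use x l in \<open>auto simp: extensional_def\<close>)
      qed
      then show ?thesis using x by simp
    qed
  qed
  moreover have "integral\<^sup>L (Pi\<^sub>M (insert i I) (\<mu> n)) (f n) = integral\<^sup>L (Pi\<^sub>M I (\<mu> n)) (?f n)" for n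
  proof -
    have "integral\<^sup>L (Pi\<^sub>M (insert i I) (\<mu> n)) (f n) =
        (\<integral>x. (\<integral>y. f n (x(i := y)) \<partial>\<mu> n i) \<partial>Pi\<^sub>M I (\<mu> n))"
      by (rule \<mu>P.product_integral_insert[OF insert(1,2)])
         (auto intro!: \<mu>F.integrable_const_bound[where B = C] simp: insert.prems(3))
    also have "\<dots> = integral\<^sup>L (Pi\<^sub>M I (\<mu> n)) (?f n)"
      by (rule Bochner_Integration.integral_cong) (auto simp: space_PiM PiE_def)
    finally show ?thesis .
  qed
  moreover have "integral\<^sup>L (Pi\<^sub>M (insert i I) M) g = integral\<^sup>L (Pi\<^sub>M I M) ?g"
    by (rule MP.product_integral_insert[OF insert(1,2)])
       (auto intro!: MF.integrable_const_bound[where B = C] AE_I2 gb simp: space_PiM PiE_def)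
  ultimately show ?case by simp
qed

section \<open>The uniform law on the cube\<close>

lemma finite_Omega [simp]: "finite (Omega n)"
  by (simp add: Omega_def finite_PiE)

lemma Omega_nonempty [simp]: "Omega n \<noteq> {}"
  by (auto simp: Omega_def PiE_eq_empty_iff)

definition cube :: "nat \<Rightarrow> (nat \<Rightarrow> real) pmf" where
  "cube n = pmf_of_set (Omega n)"

abbreviation cube_mean :: "nat \<Rightarrow> ((nat \<Rightarrow> real) \<Rightarrow> real) \<Rightarrow> real" where
  "cube_mean n \<equiv> measure_pmf.expectation (cube n)"

abbreviation cube_law :: "nat \<Rightarrow> ((nat \<Rightarrow> real) \<Rightarrow> real) \<Rightarrow> real measure" where
  "cube_law n \<equiv> distr (measure_pmf (cube n)) borel"

lemma set_cube [simp]: "set_pmf (cube n) = Omega n"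
  by (simp add: cube_def)

lemma cube_integrable [simp]: "integrable (measure_pmf (cube n)) (f :: _ \<Rightarrow> real)"
  by (rule integrable_measure_pmf_finite) simp

lemma cube_expectation:
  "cube_mean n f = (\<Sum>w\<in>Omega n. f w) / real (card (Omega n))"
  by (simp add: cube_def integral_pmf_of_set)

lemma cube_expectation_cong:
  assumes "\<And>w. w \<in> Omega n \<Longrightarrow> f w = (g w :: real)"
  shows "cube_mean n f = cube_mean n g"
  by (simp add: cube_expectation assms)

lemma cube_eq_Pi_pmf: "cube n = Pi_pmf {1..n} undefined (\<lambda>_. pmf_of_set {-1, 1})"
proof -
  have "Omega n = PiE_dflt {1..n} undefined (\<lambda>_. {-1, 1})"
    by (auto simp: Omega_def PiE_dflt_def PiE_def Pi_def extensional_def)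
  then show ?thesis by (simp add: cube_def Pi_pmf_of_set)
qed

lemma cube_indep_coordinates:
  "prob_space.indep_vars (measure_pmf (cube n)) (\<lambda>_. borel) (\<lambda>i w. w i) {1..n}"
proof -
  have "prob_space.indep_vars (measure_pmf (cube n)) (\<lambda>_. count_space UNIV) (\<lambda>i w. w i) {1..n}"
    unfolding cube_eq_Pi_pmf by (rule indep_vars_Pi_pmf) simp
  from prob_space.indep_vars_compose2[OF measure_pmf.prob_space_axioms this, of "\<lambda>_ x. x" "\<lambda>_. borel"] show ?thesis by simp
qed

definition block_sum :: "nat \<Rightarrow> nat set \<Rightarrow> (nat \<Rightarrow> real) \<Rightarrow> real" where
  "block_sum n K w = (\<Sum>q\<in>K. w q) / sqrt (real n)"

lemma cube_indep_block_sums: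
  assumes K: "\<And>j. j \<in> L \<Longrightarrow> K j \<subseteq> {1..n}" and d: "disjoint_family_on K L"
  shows "prob_space.indep_vars (measure_pmf (cube n)) (\<lambda>_. borel) (\<lambda>j. block_sum n (K j)) L"
proof -
  from prob_space.indep_vars_restrict[OF measure_pmf.prob_space_axioms cube_indep_coordinates K d]
  have "prob_space.indep_vars (measure_pmf (cube n)) (\<lambda>_. borel)
      (\<lambda>j w. (\<lambda>x. (\<Sum>q\<in>K j. x q) / sqrt (real n)) (restrict (\<lambda>i. w i) (K j))) L"
    by (rule prob_space.indep_vars_compose2[OF measure_pmf.prob_space_axioms]) measurable
  then show ?thesis by (simp add: block_sum_def[abs_def])
qed

lemma cube_char_coordinate:
  assumes "q \<in> {1..n}"
  shows "char (cube_law n (\<lambda>w. w q / r)) t = cos (t / r)"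
proof -
  have "map_pmf (\<lambda>w. w q) (cube n) = pmf_of_set {-1, 1}"
    unfolding cube_eq_Pi_pmf using assms by (subst Pi_pmf_component) auto
  then have "distr (measure_pmf (pmf_of_set {-1, 1})) borel (\<lambda>x. x / r) =
      distr (distr (measure_pmf (cube n)) (count_space UNIV) (\<lambda>w. w q)) borel (\<lambda>x. x / r)"
    by (simp flip: map_pmf_rep_eq)
  also have "\<dots> = cube_law n (\<lambda>w. w q / r)"
    by (subst distr_distr) (auto simp: comp_def)
  finally have "cube_law n (\<lambda>w. w q / r) =
      distr (measure_pmf (pmf_of_set {-1, 1})) borel (\<lambda>x. x / r)" ..
  then have "char (cube_law n (\<lambda>w. w q / r)) t =
      (\<integral>x. iexp (t * (x / r)) \<partial>measure_pmf (pmf_of_set {-1, 1}))"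
    by (simp add: char_def integral_distr)
  also have "\<dots> = (iexp (- (t / r)) + iexp (t / r)) / 2"
    by (subst integral_measure_pmf[of "{-1, 1}"]) (auto simp: scaleR_conv_of_real field_simps)
  also have "\<dots> = cos (t / r)"
    by (simp add: cos_exp_eq cos_of_real [symmetric] add.commute)
  finally show ?thesis .
qed

text \<open>A uniform sign has characteristic function \<open>cos\<close>, so the characteristic function of a block sum
  depends only on the size of the block.\<close>

lemma cube_char_block_sum:
  assumes "K \<subseteq> {1..n}"
  shows "char (cube_law n (block_sum n K)) t =
    complex_of_real (cos (t / sqrt n) ^ card K)"
proof -
  have "prob_space.indep_vars (measure_pmf (cube n)) (\<lambda>_. borel) (\<lambda>i w. w i / sqrt n) K"
    using prob_space.indep_vars_compose2[OF measure_pmf.prob_space_axioms prob_space.indep_vars_subset[OF measure_pmf.prob_space_axioms cube_indep_coordinates assms],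
      of "\<lambda>_ x. x / sqrt n" "\<lambda>_. borel"] by simp
  from prob_space.char_distr_sum[OF measure_pmf.prob_space_axioms this, of t]
  have "char (cube_law n (block_sum n K)) t =
    (\<Prod>i\<in>K. char (cube_law n (\<lambda>w. w i / sqrt n)) t)"
    by (simp add: block_sum_def[abs_def] sum_divide_distrib)
  also have "\<dots> = (\<Prod>i\<in>K. complex_of_real (cos (t / sqrt n)))"
    using assms by (intro prod.cong refl cube_char_coordinate) auto
  finally show ?thesis by simp
qed

section \<open>Central limit theorem for block sums\<close>

text \<open>The centred normal law of variance \<open>v\<close>, written as an image so that \<open>v = 0\<close> gives the point mass
  at zero; blocks of asymptotically vanishing length and the time \<open>t = 1\<close> then need no separate treatment.\<close>

definition gauss :: "real \<Rightarrow> real measure" where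
  "gauss v = distr std_normal_distribution borel (\<lambda>z. sqrt v * z)"

lemma real_distribution_gauss: "real_distribution (gauss v)"
proof -
  interpret real_distribution std_normal_distribution by (rule real_dist_normal_dist)
  show ?thesis unfolding gauss_def
    by (intro real_distribution.intro real_distribution_axioms.intro prob_space_distr) auto
qed

lemma char_gauss:
  assumes "0 \<le> v"
  shows "char (gauss v) t = exp (- v * t\<^sup>2 / 2)"
proof -
  have "char (gauss v) t = char std_normal_distribution (t * sqrt v)"
    by (simp add: gauss_def char_def integral_distr mult.assoc)
  also have "\<dots> = exp (- v * t\<^sup>2 / 2)"
    using assms by (simp add: char_std_normal_distribution power_mult_distrib mult.commute)
  finally show ?thesis .
qed

lemma gauss_1: "gauss 1 = std_normal_distribution"
  by (simp add: gauss_def distr_id2)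

lemma tendsto_cos_power:
  fixes m :: "nat \<Rightarrow> nat"
  assumes "(\<lambda>n. m n / n) \<longlonglongrightarrow> v"
  shows "(\<lambda>n. cos (t / sqrt n) ^ m n) \<longlonglongrightarrow> exp (- v * t\<^sup>2 / 2)"
proof -
  have "(\<lambda>n. real n * ln (cos (t / sqrt (real n)))) \<longlonglongrightarrow> - (t * t) / 2"
    by real_asymp
  from tendsto_exp[OF tendsto_mult[OF assms this]]
  have l: "(\<lambda>n. exp (m n / n * (n * ln (cos (t / sqrt n))))) \<longlonglongrightarrow> exp (- v * t\<^sup>2 / 2)"
    by (simp add: power2_eq_square)
  have "(\<lambda>n. cos (t / sqrt (real n))) \<longlonglongrightarrow> 1" by real_asymp
  then have "\<forall>\<^sub>F n in sequentially. cos (t / sqrt (real n)) > 0"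
    by (rule order_tendstoD) simp
  then have "\<forall>\<^sub>F n in sequentially.
      exp (m n / n * (n * ln (cos (t / sqrt n)))) = cos (t / sqrt n) ^ m n"
    using eventually_gt_at_top[of 0]
    by eventually_elim (simp add: exp_of_nat_mult)
  from tendsto_cong[OF this] l show ?thesis by simp
qed

lemma real_distribution_cube: "real_distribution (cube_law n f)"
  by (intro real_distribution.intro real_distribution_axioms.intro measure_pmf.prob_space_distr) auto

lemma block_sum_central_limit:
  assumes K: "\<And>n. K n \<subseteq> {1..n}" and v: "(\<lambda>n. card (K n) / n) \<longlonglongrightarrow> v"
  shows "weak_conv_m (\<lambda>n. cube_law n (block_sum n (K n))) (gauss v)"
proof (rule levy_continuity)
  have "0 \<le> v" by (rule LIMSEQ_le_const[OF v]) auto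
  then show "(\<lambda>n. char (cube_law n (block_sum n (K n))) t) \<longlonglongrightarrow> char (gauss v) t" for t
    unfolding cube_char_block_sum[OF K] char_gauss[OF \<open>0 \<le> v\<close>]
    by (intro tendsto_of_real tendsto_cos_power v)
qed (rule real_distribution_cube real_distribution_gauss)+

lemma S_sum_eq_block_sum: "S_sum n = block_sum n {1..n}"
  by (simp add: fun_eq_iff S_sum_def block_sum_def)

lemma Omega_flip: "w \<in> Omega n \<Longrightarrow> q \<in> {1..n} \<Longrightarrow> fun_upd w q (- w q) \<in> Omega n"
  by (auto simp: Omega_def PiE_def Pi_def extensional_def)

lemma cube_expectation_flip:
  assumes "q \<in> {1..n}"
  shows "cube_mean n (\<lambda>w. f (fun_upd w q (- w q)) :: real) =
    cube_mean n f"
proof -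
  have "(\<Sum>w\<in>Omega n. f (fun_upd w q (- w q))) = (\<Sum>w\<in>Omega n. f w)"
    by (rule sum.reindex_bij_witness[of _ "\<lambda>w. fun_upd w q (- w q)" "\<lambda>w. fun_upd w q (- w q)"])
       (use assms in \<open>auto intro: Omega_flip\<close>)
  then show ?thesis by (simp add: cube_expectation)
qed

lemma Omega_square: "w \<in> Omega n \<Longrightarrow> q \<in> {1..n} \<Longrightarrow> w q * w q = 1"
  by (auto simp: Omega_def PiE_def Pi_def)

lemma cube_coordinates_orthogonal:
  assumes "p \<in> {1..n}" "q \<in> {1..n}"
  shows "cube_mean n (\<lambda>w. w p * w q) = (if p = q then 1 else 0)"
proof (cases "p = q")
  case True
  then show ?thesis
    using assms by (simp add: cube_expectation Omega_square)
next
  case False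
  then have "cube_mean n (\<lambda>w. w p * w q) =
      cube_mean n (\<lambda>w. - (w p * w q))"
    using cube_expectation_flip[OF assms(2), of "\<lambda>w. w p * w q"] by simp
  then show ?thesis using False by simp
qed

lemma cube_second_moment:
  assumes "n \<ge> 1"
  shows "cube_mean n (\<lambda>w. (S_sum n w)\<^sup>2) = 1"
proof -
  have "cube_mean n (\<lambda>w. (S_sum n w)\<^sup>2) =
      (\<Sum>p=1..n. \<Sum>q=1..n. cube_mean n (\<lambda>w. w p * w q)) / n"
    by (simp add: S_sum_def power_divide power2_eq_square[of "sum _ _"] sum_product)
  also have "\<dots> = (\<Sum>p=1..n. \<Sum>q=1..n. if p = q then 1 else 0) / n"
    by (intro arg_cong2[where f = "(/)"] sum.cong refl cube_coordinates_orthogonal) auto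
  also have "\<dots> = 1" using assms by simp
  finally show ?thesis .
qed

lemma normal_integrable_id: "integrable std_normal_distribution (\<lambda>x. x)"
  using integrable_std_normal_distribution_moment[of 1] by simp

lemma normal_integrable_lipschitz:
  fixes h :: "real \<Rightarrow> real"
  assumes "\<And>x y. \<bar>h x - h y\<bar> \<le> \<bar>x - y\<bar>"
  shows "h \<in> borel_measurable borel" and "integrable std_normal_distribution h"
proof -
  interpret N: real_distribution std_normal_distribution by (rule real_dist_normal_dist)
  have "1-lipschitz_on UNIV h"
    using assms by (auto simp: lipschitz_on_def dist_real_def)
  then have "continuous_on UNIV h"
    by (rule lipschitz_on_continuous_on)
  then show m[measurable]: "h \<in> borel_measurable borel"
    by (rule borel_measurable_continuous_onI)
  show "integrable std_normal_distribution h"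
  proof (rule Bochner_Integration.integrable_bound)
    show "integrable std_normal_distribution (\<lambda>x. \<bar>h 0\<bar> + \<bar>x\<bar>)"
      using normal_integrable_id by simp
    show "AE x in std_normal_distribution. norm (h x) \<le> norm (\<bar>h 0\<bar> + \<bar>x\<bar>)"
    proof (rule AE_I2)
      fix x show "norm (h x) \<le> norm (\<bar>h 0\<bar> + \<bar>x\<bar>)" using assms[of x 0] by auto
    qed
  qed simp
qed

lemma S_sum_central_limit:
  "weak_conv_m (\<lambda>n. cube_law n (S_sum n)) std_normal_distribution"
proof -
  have "(\<lambda>n. real (card {1..n}) / real n) \<longlonglongrightarrow> 1"
    by (rule tendsto_eventually) (auto intro: eventually_sequentiallyI[of 1])
  from block_sum_central_limit[OF order_refl this] show ?thesis
    by (simp add: gauss_1 S_sum_eq_block_sum)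
qed

text \<open>The sums and their normal limit all have second moment one, so in a Skorohod representation their
  distance tends to zero in mean.  Hence the comparison holds uniformly over 1-Lipschitz functions, and the
  function may vary with \<open>n\<close>.\<close>

lemma cube_normal_lipschitz:
  fixes h :: "nat \<Rightarrow> real \<Rightarrow> real"
  assumes lip: "\<And>n x y. \<bar>h n x - h n y\<bar> \<le> \<bar>x - y\<bar>"
  shows "(\<lambda>n. cube_mean n (\<lambda>w. h n (S_sum n w)) -
    integral\<^sup>L std_normal_distribution (h n)) \<longlonglongrightarrow> 0"
proof -
  let ?\<mu> = "\<lambda>n. cube_law n (S_sum n)"
  from Skorohod[OF real_distribution_cube real_dist_normal_dist S_sum_central_limit]
  obtain \<Omega> :: "real measure" and Y Y' where
    \<Omega>: "prob_space \<Omega>" and Y[measurable]: "\<And>n. Y n \<in> measurable \<Omega> borel"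
    and dY: "\<And>n. distr \<Omega> borel (Y n) = ?\<mu> n"
    and Y': "Y' \<in> measurable \<Omega> lborel" and dY': "distr \<Omega> borel Y' = std_normal_distribution"
    and conv: "\<And>x. x \<in> space \<Omega> \<Longrightarrow> (\<lambda>n. Y n x) \<longlonglongrightarrow> Y' x"
    by blast
  interpret prob_space \<Omega> by fact
  have [measurable]: "Y' \<in> borel_measurable \<Omega>" using Y' by simp
  have Yint: "integrable \<Omega> (\<lambda>x. f (Y n x))" "expectation (\<lambda>x. f (Y n x)) =
      cube_mean n (\<lambda>w. f (S_sum n w))"
    if [measurable]: "f \<in> borel_measurable borel" for f :: "real \<Rightarrow> real" and n
  proof -
    have "integrable (?\<mu> n) f" by (subst integrable_distr_eq) auto
    then show "integrable \<Omega> (\<lambda>x. f (Y n x))"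
      unfolding dY[symmetric] by (subst (asm) integrable_distr_eq) auto
    have "expectation (\<lambda>x. f (Y n x)) = integral\<^sup>L (?\<mu> n) f"
      unfolding dY[symmetric] by (subst integral_distr) auto
    then show "expectation (\<lambda>x. f (Y n x)) =
      cube_mean n (\<lambda>w. f (S_sum n w))" by (subst (asm) integral_distr) auto
  qed
  have Y'int: "integrable \<Omega> (\<lambda>x. f (Y' x))" "expectation (\<lambda>x. f (Y' x)) =
      integral\<^sup>L std_normal_distribution f"
    if [measurable]: "f \<in> borel_measurable borel" and i: "integrable std_normal_distribution f"
    for f :: "real \<Rightarrow> real"
  proof -
    show "integrable \<Omega> (\<lambda>x. f (Y' x))"
      using i unfolding dY'[symmetric] by (subst (asm) integrable_distr_eq) auto
    show "expectation (\<lambda>x. f (Y' x)) = integral\<^sup>L std_normal_distribution f"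
      unfolding dY'[symmetric] by (subst integral_distr) auto
  qed
  have sq: "integrable \<Omega> (\<lambda>x. (Y n x)\<^sup>2)" "integrable \<Omega> (\<lambda>x. (Y' x)\<^sup>2)" for n
    using Yint(1)[of "\<lambda>x. x\<^sup>2"] Y'int(1)[of "\<lambda>x. x\<^sup>2"] integrable_std_normal_distribution_moment[of 2]
    by auto
  have E': "expectation (\<lambda>x. (Y' x)\<^sup>2) = 1"
    using Y'int(2)[of "\<lambda>x. x\<^sup>2"] integrable_std_normal_distribution_moment[of 2]
      std_normal_distribution_even_moments(1)[of 1] by (simp add: fact_numeral)
  have E: "expectation (\<lambda>x. (Y n x)\<^sup>2) = 1" if "n \<ge> 1" for n
    using Yint(2)[of "\<lambda>x. x\<^sup>2"] cube_second_moment[OF that] by simp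
  have dbound: "(a - b)\<^sup>2 \<le> 2 * a\<^sup>2 + 2 * b\<^sup>2" for a b :: real
    using zero_le_power2[of "a + b"] by (simp add: power2_eq_square algebra_simps)
  have dint: "integrable \<Omega> (\<lambda>x. (Y n x - Y' x)\<^sup>2)" for n
    by (rule Bochner_Integration.integrable_bound[of _ "\<lambda>x. 2 * (Y n x)\<^sup>2 + 2 * (Y' x)\<^sup>2"])
       (use sq dbound in auto)
  have d4: "expectation (\<lambda>x. (Y n x - Y' x)\<^sup>2) \<le> 4" if "n \<ge> 1" for n
  proof -
    have "expectation (\<lambda>x. (Y n x - Y' x)\<^sup>2) \<le> expectation (\<lambda>x. 2 * (Y n x)\<^sup>2 + 2 * (Y' x)\<^sup>2)"
      by (intro integral_mono dint Bochner_Integration.integrable_add integrable_mult_right sq dbound)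
    also have "\<dots> = 4" using sq E[OF that] E' by simp
    finally show ?thesis .
  qed
  have d1: "integrable \<Omega> (\<lambda>x. \<bar>Y n x - Y' x\<bar>)" for n
    by (intro integrable_abs Bochner_Integration.integrable_diff Yint(1)[of "\<lambda>x. x"]
          Y'int(1)[of "\<lambda>x. x"] normal_integrable_id) simp_all
  have L1: "(\<lambda>n. expectation (\<lambda>x. \<bar>Y n x - Y' x\<bar>)) \<longlonglongrightarrow> 0"
  proof (rule LIMSEQ_I)
    fix e :: real assume "0 < e"
    \<comment> \<open>Truncation level: the second moment of the difference is at most 4, so the tail contributes at
      most \<open>4 / R = e / 2\<close>.\<close>
    define R where "R = 8 / e"
    have "R > 0" using \<open>0 < e\<close> by (simp add: R_def)
    have "(\<lambda>n. expectation (\<lambda>x. min \<bar>Y n x - Y' x\<bar> R)) \<longlonglongrightarrow> expectation (\<lambda>x. min \<bar>0\<bar> R)"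
    proof (rule integral_dominated_convergence[where w = "\<lambda>_. R"])
      show "AE x in \<Omega>. (\<lambda>n. min \<bar>Y n x - Y' x\<bar> R) \<longlonglongrightarrow> min \<bar>0\<bar> R"
        using conv by (intro AE_I2 tendsto_intros) (simp add: LIM_zero_iff)
    qed (use \<open>R > 0\<close> in auto)
    then have "(\<lambda>n. expectation (\<lambda>x. min \<bar>Y n x - Y' x\<bar> R)) \<longlonglongrightarrow> 0"
      using \<open>R > 0\<close> by simp
    then have "\<forall>\<^sub>F n in sequentially. expectation (\<lambda>x. min \<bar>Y n x - Y' x\<bar> R) < e / 2"
      by (rule order_tendstoD) (use \<open>0 < e\<close> in simp)
    then have "\<forall>\<^sub>F n in sequentially. norm (expectation (\<lambda>x. \<bar>Y n x - Y' x\<bar>) - 0) < e"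
      using eventually_ge_at_top[of 1]
    proof eventually_elim
      fix n :: nat assume n: "expectation (\<lambda>x. min \<bar>Y n x - Y' x\<bar> R) < e / 2" "1 \<le> n"
      have mi: "integrable \<Omega> (\<lambda>x. min \<bar>Y n x - Y' x\<bar> R)"
        using \<open>R > 0\<close> by (intro integrable_const_bound[where B = R]) auto
      have "expectation (\<lambda>x. \<bar>Y n x - Y' x\<bar>) \<le>
          expectation (\<lambda>x. min \<bar>Y n x - Y' x\<bar> R + (Y n x - Y' x)\<^sup>2 / R)"
      proof (intro integral_mono d1 Bochner_Integration.integrable_add mi)
        show "integrable \<Omega> (\<lambda>x. (Y n x - Y' x)\<^sup>2 / R)" using dint by simp
        fix x
        have "\<bar>d\<bar> \<le> min \<bar>d\<bar> R + d\<^sup>2 / R" for d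
        proof (cases "\<bar>d\<bar> \<le> R")
          case False
          then have "\<bar>d\<bar> * R \<le> \<bar>d\<bar> * \<bar>d\<bar>" by (intro mult_left_mono) auto
          then have "\<bar>d\<bar> \<le> d\<^sup>2 / R" using \<open>R > 0\<close> by (simp add: field_simps power2_eq_square)
          then show ?thesis using \<open>R > 0\<close> by simp
        qed (use \<open>R > 0\<close> in auto)
        then show "\<bar>Y n x - Y' x\<bar> \<le> min \<bar>Y n x - Y' x\<bar> R + (Y n x - Y' x)\<^sup>2 / R" .
      qed
      also have "\<dots> = expectation (\<lambda>x. min \<bar>Y n x - Y' x\<bar> R) + expectation (\<lambda>x. (Y n x - Y' x)\<^sup>2) / R"
        using mi dint by simp
      also have "\<dots> \<le> expectation (\<lambda>x. min \<bar>Y n x - Y' x\<bar> R) + 4 / R"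
        using d4[OF n(2)] \<open>R > 0\<close> by (simp add: divide_right_mono)
      also have "\<dots> < e" using n(1) \<open>0 < e\<close> by (simp add: R_def)
      finally show "norm (expectation (\<lambda>x. \<bar>Y n x - Y' x\<bar>) - 0) < e" by simp
    qed
    then show "\<exists>no. \<forall>n\<ge>no. norm (expectation (\<lambda>x. \<bar>Y n x - Y' x\<bar>) - 0) < e"
      by (simp add: eventually_sequentially)
  qed
  have "norm (cube_mean n (\<lambda>w. h n (S_sum n w)) - integral\<^sup>L std_normal_distribution (h n))
      \<le> expectation (\<lambda>x. \<bar>Y n x - Y' x\<bar>)" for n
  proof -
    note hm = normal_integrable_lipschitz[of "h n", OF lip]
    note i = Yint[OF hm(1), of n] Y'int[OF hm]
    have "cube_mean n (\<lambda>w. h n (S_sum n w)) - integral\<^sup>L std_normal_distribution (h n) =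
        expectation (\<lambda>x. h n (Y n x) - h n (Y' x))"
      using i by simp
    also have "norm \<dots> \<le> expectation (\<lambda>x. \<bar>h n (Y n x) - h n (Y' x)\<bar>)"
      using integral_abs_bound by simp
    also have "\<dots> \<le> expectation (\<lambda>x. \<bar>Y n x - Y' x\<bar>)"
      using i d1 lip by (intro integral_mono) auto
    finally show ?thesis .
  qed
  then show ?thesis
    by (rule Lim_null_comparison[OF always_eventually[OF allI] L1])
qed

section \<open>Slopes of convex functions\<close>

lemma convex_chord_slope_mono:
  fixes F :: "real \<Rightarrow> real"
  assumes F: "convex_on UNIV F" and "a < b" "c < d" "a \<le> c" "b \<le> d"
  shows "(F b - F a) / (b - a) \<le> (F d - F c) / (d - c)"
proof -
  have "(F b - F a) / (b - a) \<le> (F d - F a) / (d - a)"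
  proof (cases "b = d")
    case False
    with convex_on_slope_le[OF F, of a d b] assms show ?thesis
      by (simp add: field_simps)
  qed simp
  also have "\<dots> \<le> (F d - F c) / (d - c)"
  proof (cases "a = c")
    case False
    with convex_on_slope_le[OF F, of a d c] assms show ?thesis
      by (simp add: field_simps)
  qed simp
  finally show ?thesis .
qed

text \<open>A chord of a convex function is squeezed between chords of fixed length on either side of it;
  these converge to chords of \<open>\<psi>\<close>, whose slopes are close to \<open>\<gamma> l\<close> by the mean value theorem.\<close>

lemma convex_slopes_converge:
  fixes F :: "nat \<Rightarrow> real \<Rightarrow> real"
  assumes F: "\<And>n. convex_on UNIV (F n)" and lim: "\<And>x. (\<lambda>n. F n x) \<longlonglongrightarrow> \<psi> x"
    and der: "\<And>x. (\<psi> has_real_derivative \<gamma> x) (at x)" and cont: "isCont \<gamma> l"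
    and x: "x \<longlonglongrightarrow> l" and h: "h \<longlonglongrightarrow> 0" "\<And>n. h n > 0"
  shows "(\<lambda>n. (F n (x n + h n) - F n (x n)) / h n) \<longlonglongrightarrow> \<gamma> l"
proof (rule LIMSEQ_I)
  fix e :: real assume "0 < e"
  with cont obtain \<delta>' where \<delta>': "\<delta>' > 0" "\<And>y. \<bar>y - l\<bar> < \<delta>' \<Longrightarrow> \<bar>\<gamma> y - \<gamma> l\<bar> < e"
    unfolding continuous_at_eps_delta dist_real_def by metis
  define \<delta> where "\<delta> = \<delta>' / 3"
  have "\<delta> > 0" using \<delta>' by (simp add: \<delta>_def)
  have chord: "\<bar>(\<psi> (y + \<delta>) - \<psi> y) / \<delta> - \<gamma> l\<bar> < e" if "\<bar>y - l\<bar> \<le> 2 * \<delta>" "\<bar>y + \<delta> - l\<bar> \<le> 2 * \<delta>" for y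
  proof -
    obtain z where z: "y < z" "z < y + \<delta>" "\<psi> (y + \<delta>) - \<psi> y = (y + \<delta> - y) * \<gamma> z"
      using MVT2[of y "y + \<delta>" \<psi> \<gamma>] der \<open>\<delta> > 0\<close> by auto
    then have "\<bar>z - l\<bar> < \<delta>'" using that \<open>\<delta> > 0\<close> unfolding \<delta>_def by linarith
    then show ?thesis using z \<delta>'(2)[of z] \<open>\<delta> > 0\<close> by simp
  qed
  have lim2: "(\<lambda>n. (F n (y + \<delta>) - F n y) / \<delta>) \<longlonglongrightarrow> (\<psi> (y + \<delta>) - \<psi> y) / \<delta>" for y
    using \<open>\<delta> > 0\<close> by (intro tendsto_intros lim) auto
  have up: "\<forall>\<^sub>F n in sequentially. (F n (l + \<delta> + \<delta>) - F n (l + \<delta>)) / \<delta> < \<gamma> l + e"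
    using chord[of "l + \<delta>"] \<open>\<delta> > 0\<close> by (intro order_tendstoD(2)[OF lim2]) auto
  have lo: "\<forall>\<^sub>F n in sequentially. \<gamma> l - e < (F n (l - 2 * \<delta> + \<delta>) - F n (l - 2 * \<delta>)) / \<delta>"
    using chord[of "l - 2 * \<delta>"] \<open>\<delta> > 0\<close> by (intro order_tendstoD(1)[OF lim2]) auto
  have xh: "(\<lambda>n. x n + h n) \<longlonglongrightarrow> l" using tendsto_add[OF x h(1)] by simp
  have "\<forall>\<^sub>F n in sequentially. l - \<delta> < x n" "\<forall>\<^sub>F n in sequentially. x n + h n < l + \<delta>"
    using order_tendstoD(1)[OF x, of "l - \<delta>"] order_tendstoD(2)[OF xh, of "l + \<delta>"] \<open>\<delta> > 0\<close>
    by auto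
  with up lo have "\<forall>\<^sub>F n in sequentially. norm ((F n (x n + h n) - F n (x n)) / h n - \<gamma> l) < e"
  proof eventually_elim
    fix n
    assume u: "(F n (l + \<delta> + \<delta>) - F n (l + \<delta>)) / \<delta> < \<gamma> l + e"
      and l: "\<gamma> l - e < (F n (l - 2 * \<delta> + \<delta>) - F n (l - 2 * \<delta>)) / \<delta>"
      and b: "l - \<delta> < x n" "x n + h n < l + \<delta>"
    have "(F n (x n + h n) - F n (x n)) / (x n + h n - x n) \<le>
        (F n (l + \<delta> + \<delta>) - F n (l + \<delta>)) / (l + \<delta> + \<delta> - (l + \<delta>))"
      by (rule convex_chord_slope_mono[OF F]) (use b h(2)[of n] \<open>\<delta> > 0\<close> in auto)
    moreover have "(F n (l - 2 * \<delta> + \<delta>) - F n (l - 2 * \<delta>)) / (l - 2 * \<delta> + \<delta> - (l - 2 * \<delta>)) \<le>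
        (F n (x n + h n) - F n (x n)) / (x n + h n - x n)"
      by (rule convex_chord_slope_mono[OF F]) (use b h(2)[of n] \<open>\<delta> > 0\<close> in auto)
    ultimately show "norm ((F n (x n + h n) - F n (x n)) / h n - \<gamma> l) < e"
      using u l by auto
  qed
  then show "\<exists>no. \<forall>n\<ge>no. norm ((F n (x n + h n) - F n (x n)) / h n - \<gamma> l) < e"
    by (simp add: eventually_sequentially)
qed

lemma lipschitz_pointwise_imp_continuously_converges:
  fixes F :: "nat \<Rightarrow> real \<Rightarrow> real"
  assumes lip: "\<And>n x y. \<bar>F n x - F n y\<bar> \<le> \<bar>x - y\<bar>" and lim: "\<And>x. (\<lambda>n. F n x) \<longlonglongrightarrow> \<psi> x"
  shows "continuously_converges F \<psi>"
  unfolding continuously_converges_def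
proof (intro allI impI)
  fix x l assume "x \<longlonglongrightarrow> (l :: real)"
  then have "(\<lambda>n. \<bar>x n - l\<bar>) \<longlonglongrightarrow> 0"
    using tendsto_rabs_zero LIM_zero by blast
  then have "(\<lambda>n. F n (x n) - F n l) \<longlonglongrightarrow> 0"
    by (rule Lim_null_comparison[rotated]) (use lip in simp)
  from tendsto_add[OF this lim[of l]] show "(\<lambda>n. F n (x n)) \<longlonglongrightarrow> \<psi> l" by simp
qed

section \<open>Utility functions with slopes bounded away from zero and infinity\<close>

text \<open>The strict tangent inequality is the form in which strict convexity is used throughout.\<close>

locale utility =
  fixes H H' :: "real \<Rightarrow> real" and \<epsilon> K C :: real
  assumes deriv: "\<And>x. (H has_real_derivative H' x) (at x)"
    and eps_pos: "0 < \<epsilon>" and lower: "\<And>x. \<epsilon> \<le> H' x" and upper: "\<And>x. H' x \<le> K"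
    and C_nonneg: "0 \<le> C" and deriv_lipschitz: "\<And>x y. \<bar>H' x - H' y\<bar> \<le> C * \<bar>x - y\<bar>"
    and above_tangent: "\<And>x y. x \<noteq> y \<Longrightarrow> H x + H' x * (y - x) < H y"
begin

lemma deriv_pos: "0 < H' x"
  using eps_pos lower[of x] by linarith

lemma K_pos: "0 < K"
  using deriv_pos[of 0] upper[of 0] by linarith

lemma above_tangent_le: "H x + H' x * (y - x) \<le> H y"
  using above_tangent[of x y] by (cases "x = y") auto

lemma continuous_H: "continuous_on S H"
  using deriv by (meson DERIV_isCont continuous_at_imp_continuous_on)

lemma continuous_H': "continuous_on S H'"
proof -
  have "C-lipschitz_on UNIV H'"
    using deriv_lipschitz C_nonneg by (auto simp: lipschitz_on_def dist_real_def)
  then show ?thesis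
    by (meson lipschitz_on_continuous_on continuous_on_subset subset_UNIV)
qed

lemma measurable_H [measurable]: "H \<in> borel_measurable borel"
  and measurable_H' [measurable]: "H' \<in> borel_measurable borel"
  by (auto intro: borel_measurable_continuous_onI continuous_H continuous_H')

lemma H_lipschitz: "\<bar>H x - H y\<bar> \<le> K * \<bar>x - y\<bar>"
proof (rule linorder_wlog[of "\<lambda>x y. \<bar>H x - H y\<bar> \<le> K * \<bar>x - y\<bar>"])
  fix x y :: real assume "x \<le> y"
  show "\<bar>H x - H y\<bar> \<le> K * \<bar>x - y\<bar>"
  proof (cases "x = y")
    case False
    then obtain z where "H y - H x = (y - x) * H' z"
      using MVT2[of x y H H'] deriv \<open>x \<le> y\<close> by auto
    moreover have "0 \<le> (y - x) * H' z" "(y - x) * H' z \<le> (y - x) * K"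
      using \<open>x \<le> y\<close> upper[of z] deriv_pos[of z] by (auto intro: mult_left_mono)
    ultimately show ?thesis using \<open>x \<le> y\<close> by (simp add: mult.commute)
  qed simp
qed (simp add: abs_minus_commute)

lemma H_mono: "x \<le> y \<Longrightarrow> H x \<le> H y"
  using above_tangent_le[of x y] deriv_pos[of x]
  by (smt (verit) mult_nonneg_nonneg)

lemma H_taylor: "H (x + y) \<le> H x + H' x * y + C * y\<^sup>2"
proof -
  have "H (x + y) + H' (x + y) * (- y) \<le> H x"
    using above_tangent_le[of "x + y" x] by simp
  moreover have "(H' (x + y) - H' x) * y \<le> C * y\<^sup>2"
  proof -
    have "(H' (x + y) - H' x) * y \<le> \<bar>H' (x + y) - H' x\<bar> * \<bar>y\<bar>"
      by (metis abs_ge_self abs_mult)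
    also have "\<dots> \<le> (C * \<bar>y\<bar>) * \<bar>y\<bar>"
      using deriv_lipschitz[of "x + y" x] by (intro mult_right_mono) auto
    finally show ?thesis by (simp add: power2_eq_square mult.assoc)
  qed
  ultimately show ?thesis by (simp add: algebra_simps)
qed

end

lemma admissible_utility_imp_utility:
  assumes "admissible_utility H"
  obtains \<epsilon> K C where "utility H (deriv H) \<epsilon> K C"
proof -
  from assms obtain \<epsilon> K C where eK: "0 < \<epsilon>" "\<And>x. \<epsilon> < deriv H x \<and> deriv H x < K"
    and C: "C-lipschitz_on UNIV (deriv H)" and conv: "strictly_convex H"
    and "H C1_differentiable_on UNIV"
    unfolding admissible_utility_def by blast
  then have der: "(H has_real_derivative deriv H x) (at x)" for x
    unfolding C1_differentiable_on_def
    by (metis DERIV_imp_deriv UNIV_I has_real_derivative_iff_has_vector_derivative)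
  have cvx: "convex_on UNIV H"
  proof (rule convex_onI)
    fix t x y :: real assume "0 < t" "t < 1"
    then show "H ((1 - t) *\<^sub>R x + t *\<^sub>R y) \<le> (1 - t) * H x + t * H y"
      using conv[unfolded strictly_convex_def, rule_format, of x y t]
      by (cases "x = y") (auto simp: less_imp_le simp flip: distrib_right)
  qed simp
  have le: "H x + deriv H x * (y - x) \<le> H y" for x y
    using convex_on_imp_above_tangent[OF cvx, of x y "deriv H x"] der[of x] by (auto simp: algebra_simps)
  have "H x + deriv H x * (y - x) < H y" if "x \<noteq> y" for x y
  proof -
    have "H x + deriv H x * (((1 - 1 / 2) * x + 1 / 2 * y) - x) \<le> H ((1 - 1 / 2) * x + 1 / 2 * y)"
      by (rule le)
    also have "\<dots> < (1 - 1 / 2) * H x + 1 / 2 * H y"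
      by (rule conv[unfolded strictly_convex_def, rule_format]) (use that in auto)
    finally show ?thesis by (simp add: algebra_simps)
  qed
  moreover have "0 \<le> C" using C by (rule lipschitz_on_nonneg)
  ultimately have "utility H (deriv H) \<epsilon> K C"
    using eK C der by unfold_locales (auto simp: less_imp_le lipschitz_on_def dist_real_def)
  then show ?thesis by (rule that)
qed

section \<open>Predictable representation on the cube\<close>

text \<open>Averaging a function of \<open>splice_at q w w'\<close> over \<open>w'\<close> is its conditional expectation given the
  steps before time \<open>q\<close>.\<close>

definition splice_at :: "nat \<Rightarrow> (nat \<Rightarrow> real) \<Rightarrow> (nat \<Rightarrow> real) \<Rightarrow> nat \<Rightarrow> real" where
  "splice_at q w w' = (\<lambda>i. if i < q then w i else w' i)"

lemma splice_at_Omega: "w \<in> Omega n \<Longrightarrow> w' \<in> Omega n \<Longrightarrow> splice_at q w w' \<in> Omega n"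
  by (auto simp: Omega_def splice_at_def PiE_def Pi_def extensional_def)

lemma Omega_values: "w \<in> Omega n \<Longrightarrow> q \<in> {1..n} \<Longrightarrow> w q = 1 \<or> w q = -1"
  by (auto simp: Omega_def PiE_def Pi_def)

lemma Omega_extensional: "w \<in> Omega n \<Longrightarrow> i \<notin> {1..n} \<Longrightarrow> w i = undefined"
  by (auto simp: Omega_def PiE_def extensional_def)

lemma cube_expectation_odd:
  assumes q: "q \<in> {1..n}" and inv: "\<And>w. w \<in> Omega n \<Longrightarrow> f (fun_upd w q (- w q)) = (f w :: real)"
  shows "cube_mean n (\<lambda>w. w q * f w) = 0"
proof -
  have "cube_mean n (\<lambda>w. w q * f w) =
      cube_mean n (\<lambda>w. - (w q * f w))"
    using cube_expectation_flip[OF q, of "\<lambda>w. w q * f w"]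
    by (subst (asm) cube_expectation_cong[of n _ "\<lambda>w. - (w q * f w)"]) (auto simp: inv)
  then show ?thesis by simp
qed

text \<open>Revealing the sign \<open>w q\<close> changes the conditional expectation by an odd function of that sign.
  This is the increment of a martingale transform, and its coefficient is the price.\<close>

lemma splice_step:
  assumes w: "w \<in> Omega n" and q: "q \<in> {1..n}"
  shows "cube_mean n (\<lambda>w'. f (splice_at (Suc q) w w')) -
    cube_mean n (\<lambda>w'. f (splice_at q w w')) =
    w q * cube_mean n (\<lambda>w'. w' q * (f (splice_at q w w') :: real))"
    (is "?E (\<lambda>w'. f (?s1 w')) - ?E (\<lambda>w'. f (?s w')) = _")
proof -
  let ?r = "\<lambda>w'. fun_upd w' q (- w' q)"
  have "2 * ?E (\<lambda>w'. f (?s1 w')) - 2 * ?E (\<lambda>w'. f (?s w')) =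
      ?E (\<lambda>w'. 2 * f (?s1 w')) - (?E (\<lambda>w'. f (?s w')) + ?E (\<lambda>w'. f (?s (?r w'))))"
    using cube_expectation_flip[OF q, of "\<lambda>w'. f (?s w')"] by simp
  also have "\<dots> = ?E (\<lambda>w'. 2 * f (?s1 w') - (f (?s w') + f (?s (?r w'))))"
    by simp
  also have "\<dots> = ?E (\<lambda>w'. w q * (w' q * f (?s w') + ?r w' q * f (?s (?r w'))))"
  proof (rule cube_expectation_cong)
    fix w' assume w': "w' \<in> Omega n"
    have "?s1 w' = ?s (fun_upd w' q (w q))"
      by (auto simp: splice_at_def fun_eq_iff)
    moreover have "w q = w' q \<or> w q = - w' q" "w q * w q = 1" 
      using Omega_values[OF w q] Omega_values[OF w' q] by auto
    moreover have sq: "w' q * (w' q * a) = a" for a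
      using Omega_square[OF w' q] by (simp add: mult.assoc[symmetric])
    ultimately show "2 * f (?s1 w') - (f (?s w') + f (?s (?r w'))) =
        w q * (w' q * f (?s w') + ?r w' q * f (?s (?r w')))"
      by (auto simp: algebra_simps sq)
  qed
  also have "\<dots> = w q * (?E (\<lambda>w'. w' q * f (?s w')) + ?E (\<lambda>w'. ?r w' q * f (?s (?r w'))))"
    by simp
  also have "?E (\<lambda>w'. ?r w' q * f (?s (?r w'))) = ?E (\<lambda>w'. w' q * f (?s w'))"
    by (rule cube_expectation_flip[OF q, of "\<lambda>w'. w' q * f (?s w')"])
  finally show ?thesis by (simp add: algebra_simps)
qed

text \<open>Summing the increments of the conditional expectations represents any function of mean zero as a
  martingale transform of the walk.\<close>

lemma centered_imp_strategy2:
  assumes "n \<ge> 1" and f: "cube_mean n f = 0"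
  shows "f \<in> strategies2 n"
proof -
  define p where "p q h = sqrt n * cube_mean n (\<lambda>w'. w' q * f (splice_at q h w'))"
    for q :: nat and h
  have "f w = (\<Sum>q = 1..n. w q * price p q w) / sqrt n" if w: "w \<in> Omega n" for w
  proof -
    let ?A = "\<lambda>q. cube_mean n (\<lambda>w'. f (splice_at q w w'))"
    have p: "price p q w = p q w" if "q \<in> {1..n}" for q
      unfolding price_def p_def
    proof (rule arg_cong2[where f = "(*)", OF refl cube_expectation_cong])
      fix w' assume "w' \<in> Omega n"
      have "splice_at q (restrict w {1..<q}) w' = splice_at q w w'"
        using Omega_extensional[OF w, of 0]
        by (auto simp: splice_at_def fun_eq_iff Suc_le_eq)
      then show "w' q * f (splice_at q (restrict w {1..<q}) w') = w' q * f (splice_at q w w')" by simp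
    qed
    have "f w = ?A (Suc n)"
    proof -
      have "splice_at (Suc n) w w' = w" if "w' \<in> Omega n" for w'
        using Omega_extensional[OF w] Omega_extensional[OF that] by (auto simp: splice_at_def fun_eq_iff)
      then have "?A (Suc n) = cube_mean n (\<lambda>w'. f w)"
        by (intro cube_expectation_cong) simp
      then show ?thesis by simp
    qed
    moreover have "?A 1 = 0"
    proof -
      have "splice_at 1 w w' = w'" if "w' \<in> Omega n" for w'
        using Omega_extensional[OF w, of 0] Omega_extensional[OF that, of 0]
        by (auto simp: splice_at_def fun_eq_iff)
      then have "?A 1 = cube_mean n f"
        by (intro cube_expectation_cong) simp
      then show ?thesis using f by simp
    qed
    moreover have "?A (Suc n) - ?A 1 = (\<Sum>q = 1..n. ?A (Suc q) - ?A q)"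
      using sum_Suc_diff[of 1 n ?A] \<open>n \<ge> 1\<close> by simp
    moreover have "\<dots> = (\<Sum>q = 1..n. w q * price p q w / sqrt n)"
      using \<open>n \<ge> 1\<close> by (intro sum.cong refl) (auto simp: splice_step[OF w] p p_def)
    ultimately show ?thesis by (simp add: sum_divide_distrib)
  qed
  then show ?thesis unfolding strategies2_def represents_def by blast
qed

lemma price_flip_invariant: "q \<le> r \<Longrightarrow> price p q (fun_upd w r v) = price p q w"
proof -
  assume "q \<le> r"
  then have "restrict (fun_upd w r v) {1..<q} = restrict w {1..<q}"
    by (auto simp: restrict_def fun_eq_iff)
  then show ?thesis by (simp add: price_def)
qed

lemma represents_imp_centered:
  assumes "represents n p f"
  shows "cube_mean n f = 0"
proof -
  have "cube_mean n f =
      cube_mean n (\<lambda>w. (\<Sum>q = 1..n. w q * price p q w) / sqrt n)"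
    using assms by (intro cube_expectation_cong) (simp add: represents_def)
  also have "\<dots> = (\<Sum>q = 1..n. cube_mean n (\<lambda>w. w q * price p q w)) / sqrt n"
    by simp
  also have "\<dots> = 0"
    using cube_expectation_odd[of _ n "price p _"] by (simp add: price_flip_invariant)
  finally show ?thesis .
qed

text \<open>Of the terms of \<open>X\<close>, only the one with index \<open>q\<close> survives multiplication by the sign \<open>w' q\<close> and averaging:
  in every other term, flipping one of the two signs reverses the summand.\<close>

lemma represents_imp_price_eq:
  assumes rep: "represents n p f" and w: "w \<in> Omega n" and q: "q \<in> {1..n}"
  shows "price p q w =
    sqrt n * cube_mean n (\<lambda>w'. w' q * f (splice_at q w w'))"
proof -
  let ?E = "cube_mean n" and ?s = "\<lambda>w'. splice_at q w w'"
  have "?E (\<lambda>w'. w' q * f (?s w')) =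
      ?E (\<lambda>w'. (\<Sum>r = 1..n. w' q * (?s w' r * price p r (?s w'))) / sqrt n)"
    using rep splice_at_Omega[OF w]
    by (intro cube_expectation_cong) (simp add: represents_def sum_distrib_left)
  also have "\<dots> = (\<Sum>r = 1..n. ?E (\<lambda>w'. w' q * (?s w' r * price p r (?s w')))) / sqrt n"
    by simp
  also have "(\<Sum>r = 1..n. ?E (\<lambda>w'. w' q * (?s w' r * price p r (?s w')))) =
      (\<Sum>r = 1..n. if r = q then price p q w else 0)"
  proof (rule sum.cong[OF refl])
    fix r assume r: "r \<in> {1..n}"
    have flip: "splice_at q w (fun_upd w' a (- w' a)) =
        (if a < q then splice_at q w w' else fun_upd (splice_at q w w') a (- w' a))" for w' a
      by (auto simp: splice_at_def fun_eq_iff)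
    consider "r < q" | "r = q" | "r > q" by linarith
    then show "?E (\<lambda>w'. w' q * (?s w' r * price p r (?s w'))) = (if r = q then price p q w else 0)"
    proof cases
      case 1
      then have "?s (fun_upd w' q (- w' q)) r * price p r (?s (fun_upd w' q (- w' q))) =
          ?s w' r * price p r (?s w')" for w'
        unfolding flip by (simp add: price_flip_invariant splice_at_def)
      with cube_expectation_odd[OF q, of "\<lambda>w'. ?s w' r * price p r (?s w')"] 1
      show ?thesis by simp
    next
      case 2
      have "price p q (?s w') = price p q w" for w'
      proof -
        have "restrict (?s w') {1..<q} = restrict w {1..<q}"
          by (auto simp: splice_at_def restrict_def fun_eq_iff)
        then show ?thesis by (simp add: price_def)
      qed
      then have "?E (\<lambda>w'. w' q * (?s w' r * price p r (?s w'))) = ?E (\<lambda>w'. price p q w)"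
        using Omega_square[OF _ q] 2
        by (intro cube_expectation_cong) (simp add: splice_at_def mult.assoc[symmetric])
      with 2 show ?thesis by simp
    next
      case 3
      let ?f = "\<lambda>w'. w' q * price p r (?s w')"
      have "?f (fun_upd w' r (- w' r)) = ?f w'" for w'
        using 3 unfolding flip by (simp add: price_flip_invariant)
      with cube_expectation_odd[OF r, of ?f] have "?E (\<lambda>w'. w' r * ?f w') = 0" by simp
      moreover have "(\<lambda>w'. w' q * (?s w' r * price p r (?s w'))) = (\<lambda>w'. w' r * ?f w')"
        using 3 by (auto simp: splice_at_def fun_eq_iff)
      ultimately show ?thesis using 3 by simp
    qed
  qed
  also have "\<dots> = price p q w" using q by simp
  finally show ?thesis using q by simp
qed

section \<open>Equilibria of the finite game\<close>

lemma strategies1_measurable: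
  assumes "\<pi> \<in> strategies1 \<mu> n" and "\<And>w. w \<in> Omega n \<Longrightarrow> g w \<in> measurable borel N"
  shows "(\<lambda>z. g (fst z) (snd z)) \<in> measurable \<pi> N"
proof -
  have s: "sets \<pi> = sets (count_space (Omega n) \<Otimes>\<^sub>M (borel :: real measure))"
    using assms(1) by (simp add: strategies1_def)
  show ?thesis
    unfolding measurable_cong_sets[OF s refl]
    by (rule measurable_pair_measure_countable1) (use assms(2) in \<open>auto intro: countable_finite\<close>)
qed

lemma strategies1_space:
  assumes "\<pi> \<in> strategies1 \<mu> n"
  shows "space \<pi> = Omega n \<times> UNIV"
proof -
  have "sets \<pi> = sets (count_space (Omega n) \<Otimes>\<^sub>M (borel :: real measure))"
    using assms(1) by (simp add: strategies1_def)
  from sets_eq_imp_space_eq[OF this] show ?thesis by (simp add: space_pair_measure)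
qed

lemma strategies1_measurable_snd: "\<pi> \<in> strategies1 \<mu> n \<Longrightarrow> snd \<in> measurable \<pi> borel"
  using strategies1_measurable[of \<pi> \<mu> n "\<lambda>_ l. l" borel] by simp

lemma strategies1_AE_snd:
  assumes \<pi>: "\<pi> \<in> strategies1 \<mu> n" and "AE l in \<mu>. P l"
  shows "AE z in \<pi>. P (snd z)"
proof -
  have "distr \<pi> borel snd = \<mu>" using \<pi> by (simp add: strategies1_def)
  then have "AE l in distr \<pi> borel snd. P l" by (rule ssubst) (rule assms(2))
  then show ?thesis by (rule AE_distrD[OF strategies1_measurable_snd[OF \<pi>]])
qed

lemma strategies1_integral_snd:
  assumes \<pi>: "\<pi> \<in> strategies1 \<mu> n" and "f \<in> borel_measurable borel"
  shows "(\<integral>z. f (snd z) \<partial>\<pi>) = integral\<^sup>L \<mu> (f :: real \<Rightarrow> real)"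
    and "integrable \<pi> (\<lambda>z. f (snd z)) \<longleftrightarrow> integrable \<mu> f"
proof -
  have \<mu>: "distr \<pi> borel snd = \<mu>" using \<pi> by (simp add: strategies1_def)
  show "(\<integral>z. f (snd z) \<partial>\<pi>) = integral\<^sup>L \<mu> f"
    using strategies1_measurable_snd[OF \<pi>] assms(2) by (subst \<mu>[symmetric], subst integral_distr) auto
  show "integrable \<pi> (\<lambda>z. f (snd z)) \<longleftrightarrow> integrable \<mu> f"
    using strategies1_measurable_snd[OF \<pi>] assms(2)
    by (subst \<mu>[symmetric], subst integrable_distr_eq) auto
qed

lemma strategies1_integrable:
  fixes g :: "(nat \<Rightarrow> real) \<Rightarrow> real \<Rightarrow> real"
  assumes \<pi>: "\<pi> \<in> strategies1 \<mu> n" and \<mu>: "AE l in \<mu>. 0 \<le> l \<and> l \<le> 1"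
    and g: "\<And>w. w \<in> Omega n \<Longrightarrow> continuous_on UNIV (g w)"
  shows "integrable \<pi> (\<lambda>z. g (fst z) (snd z))"
proof -
  interpret prob_space \<pi> using \<pi> by (simp add: strategies1_def)
  have "\<exists>B. \<forall>l\<in>{0..1}. \<bar>g w l\<bar> \<le> B" if "w \<in> Omega n" for w
  proof -
    have "compact (g w ` {0..1})"
      using g[OF that] by (intro compact_continuous_image) (auto intro: continuous_on_subset)
    then show ?thesis by (auto dest!: compact_imp_bounded simp: bounded_iff)
  qed
  then obtain B where B: "\<And>w l. w \<in> Omega n \<Longrightarrow> l \<in> {0..1} \<Longrightarrow> \<bar>g w l\<bar> \<le> B w" by metis
  show ?thesis
  proof (rule integrable_const_bound)
    show "AE z in \<pi>. norm (g (fst z) (snd z)) \<le> (\<Sum>w\<in>Omega n. \<bar>B w\<bar>)"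
      using strategies1_AE_snd[OF \<pi> \<mu>] AE_space
    proof eventually_elim
      fix z assume z: "0 \<le> snd z \<and> snd z \<le> 1" "z \<in> space \<pi>"
      then have w: "fst z \<in> Omega n" by (auto simp: strategies1_space[OF \<pi>])
      have "norm (g (fst z) (snd z)) \<le> \<bar>B (fst z)\<bar>" using B[OF w, of "snd z"] z by auto
      also have "\<dots> \<le> (\<Sum>w\<in>Omega n. \<bar>B w\<bar>)" by (rule member_le_sum) (use w in auto)
      finally show "norm (g (fst z) (snd z)) \<le> (\<Sum>w\<in>Omega n. \<bar>B w\<bar>)" .
    qed
    show "(\<lambda>z. g (fst z) (snd z)) \<in> borel_measurable \<pi>"
      by (rule strategies1_measurable[OF \<pi>]) (intro borel_measurable_continuous_onI g)
  qed
qed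

text \<open>If some path \<open>w'\<close> were strictly better than a path \<open>w\<close> on a set of positive probability, playing
  \<open>w'\<close> instead of \<open>w\<close> there would preserve the marginal on \<open>L\<close> and raise the payoff.\<close>

lemma best_response1_support:
  assumes \<pi>: "\<pi> \<in> strategies1 \<mu> n" and \<mu>: "AE l in \<mu>. 0 \<le> l \<and> l \<le> 1"
    and best: "\<forall>\<pi>'\<in>strategies1 \<mu> n. payoff1 n \<pi>' X \<le> payoff1 n \<pi> X"
  shows "AE z in \<pi>. \<forall>w'\<in>Omega n. snd z * S_sum n w' - X w' \<le> snd z * S_sum n (fst z) - X (fst z)"
proof -
  interpret prob_space \<pi> using \<pi> by (simp add: strategies1_def)
  have s: "sets \<pi> = sets (count_space (Omega n) \<Otimes>\<^sub>M (borel :: real measure))"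
    and snd\<mu>: "distr \<pi> borel snd = \<mu>"
    using \<pi> by (auto simp: strategies1_def)
  let ?v = "\<lambda>w l. l * S_sum n w - X w"
  have "AE z in \<pi>. w = fst z \<longrightarrow> ?v w' (snd z) \<le> ?v w (snd z)"
    if w: "w \<in> Omega n" "w' \<in> Omega n" for w w'
  proof -
    define r where "r \<eta> l = (if \<eta> = w \<and> ?v w l < ?v w' l then w' else \<eta>)" for \<eta> l
    define gain where "gain \<eta> l = (if \<eta> = w then max 0 (?v w' l - ?v w l) else 0)" for \<eta> l
    define f where "f = (\<lambda>z. (r (fst z) (snd z), snd z))"
    have fm: "f \<in> measurable \<pi> \<pi>"
      unfolding measurable_cong_sets[OF refl s] f_def
    proof (intro measurable_Pair strategies1_measurable_snd[OF \<pi>] strategies1_measurable[OF \<pi>])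
      fix \<eta> assume "\<eta> \<in> Omega n"
      then show "r \<eta> \<in> measurable borel (count_space (Omega n))"
        unfolding r_def using w by (cases "\<eta> = w") simp_all
    qed
    define \<pi>' where "\<pi>' = distr \<pi> \<pi> f"
    have "snd \<circ> f = snd" by (auto simp: f_def)
    then have "distr \<pi>' borel snd = \<mu>"
      unfolding \<pi>'_def using fm strategies1_measurable_snd[OF \<pi>] snd\<mu> by (subst distr_distr) auto
    then have "\<pi>' \<in> strategies1 \<mu> n"
      using fm s by (simp add: strategies1_def \<pi>'_def prob_space_distr)
    then have "payoff1 n \<pi>' X \<le> payoff1 n \<pi> X" using best by blast
    moreover have "payoff1 n \<pi>' X = (\<integral>z. ?v (r (fst z) (snd z)) (snd z) \<partial>\<pi>)"
    proof -
      have "(\<lambda>z. ?v (fst z) (snd z)) \<in> borel_measurable \<pi>"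
        by (rule strategies1_measurable[OF \<pi>]) measurable
      then show ?thesis
        unfolding payoff1_def \<pi>'_def using fm by (subst integral_distr) (auto simp: f_def)
    qed
    moreover have "\<dots> = (\<integral>z. ?v (fst z) (snd z) + gain (fst z) (snd z) \<partial>\<pi>)"
      by (intro Bochner_Integration.integral_cong refl) (auto simp: r_def gain_def)
    moreover have int: "integrable \<pi> (\<lambda>z. gain (fst z) (snd z))"
    proof (rule strategies1_integrable[OF \<pi> \<mu>])
      fix \<eta> show "continuous_on UNIV (gain \<eta>)"
        unfolding gain_def by (cases "\<eta> = w") (auto intro!: continuous_intros)
    qed
    moreover have "integrable \<pi> (\<lambda>z. ?v (fst z) (snd z))"
      by (rule strategies1_integrable[OF \<pi> \<mu>]) (auto intro!: continuous_intros)
    ultimately have "(\<integral>z. gain (fst z) (snd z) \<partial>\<pi>) \<le> 0"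
      by (simp add: payoff1_def)
    moreover have "0 \<le> (\<integral>z. gain (fst z) (snd z) \<partial>\<pi>)"
      by (rule integral_nonneg_AE) (auto simp: gain_def)
    ultimately have "(\<integral>z. gain (fst z) (snd z) \<partial>\<pi>) = 0" by linarith
    moreover have "AE z in \<pi>. 0 \<le> gain (fst z) (snd z)" by (simp add: gain_def)
    ultimately have "AE z in \<pi>. gain (fst z) (snd z) = 0"
      using integral_nonneg_eq_0_iff_AE[OF int] by blast
    then show ?thesis by eventually_elim (auto simp: gain_def max_def split: if_splits)
  qed
  then have "AE z in \<pi>. \<forall>w\<in>Omega n. \<forall>w'\<in>Omega n. w = fst z \<longrightarrow> ?v w' (snd z) \<le> ?v w (snd z)"
    by (intro AE_finite_allI) auto
  then show ?thesis
    using AE_space by eventually_elim (auto simp: strategies1_space[OF \<pi>])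
qed

context utility
begin

text \<open>Along the line \<open>X - t h\<close> the payoff exceeds its value at \<open>X\<close> by at most \<open>t D + Q t\<^sup>2\<close>, where \<open>D\<close> is
  the integral below.  Minimality forbids this from being negative for small \<open>t\<close>, so \<open>D\<close> vanishes.\<close>

lemma best_response2_first_order:
  assumes \<pi>: "\<pi> \<in> strategies1 \<mu> n" and \<mu>: "AE l in \<mu>. 0 \<le> l \<and> l \<le> 1" and n: "n \<ge> 1"
    and X: "X \<in> strategies2 n"
    and best: "\<forall>X'\<in>strategies2 n. payoff2 H n \<pi> X \<le> payoff2 H n \<pi> X'"
    and h: "cube_mean n h = 0"
  shows "(\<integral>z. H' (snd z * S_sum n (fst z) - X (fst z)) * h (fst z) \<partial>\<pi>) = 0"
proof -
  let ?a = "\<lambda>w l. l * S_sum n w - X w"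
  define D where "D = (\<integral>z. H' (?a (fst z) (snd z)) * h (fst z) \<partial>\<pi>)"
  define Q where "Q = C * (\<integral>z. (h (fst z))\<^sup>2 \<partial>\<pi>)"
  have X0: "cube_mean n X = 0"
    using X represents_imp_centered by (auto simp: strategies2_def)
  have int: "integrable \<pi> (\<lambda>z. g (fst z) (snd z))"
    if "\<And>w. continuous_on UNIV (g w)" for g :: "_ \<Rightarrow> _ \<Rightarrow> real"
    using strategies1_integrable[OF \<pi> \<mu> that] .
  have cH: "continuous_on UNIV (\<lambda>l. H (u l))" "continuous_on UNIV (\<lambda>l. H' (u l))"
    if "continuous_on UNIV u" for u :: "real \<Rightarrow> real"
    using that continuous_on_compose2[OF continuous_H[of UNIV]] continuous_on_compose2[OF continuous_H'[of UNIV]]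
    by auto
  have key: "0 \<le> t * D + Q * t\<^sup>2" for t
  proof -
    have i1: "integrable \<pi> (\<lambda>z. H (?a (fst z) (snd z)))"
      by (rule int[of "\<lambda>w l. H (?a w l)"]) (intro cH continuous_intros)
    have i2: "integrable \<pi> (\<lambda>z. H (?a (fst z) (snd z) + t * h (fst z)))"
      by (rule int[of "\<lambda>w l. H (?a w l + t * h w)"]) (intro cH continuous_intros)
    have i3: "integrable \<pi> (\<lambda>z. H' (?a (fst z) (snd z)) * h (fst z))"
      by (rule int[of "\<lambda>w l. H' (?a w l) * h w"]) (intro cH continuous_intros)
    have i4: "integrable \<pi> (\<lambda>z. (h (fst z))\<^sup>2)"
      by (rule int[of "\<lambda>w l. (h w)\<^sup>2"]) (intro continuous_intros)
    have "(\<lambda>w. X w - t * h w) \<in> strategies2 n"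
      by (rule centered_imp_strategy2[OF n]) (simp add: X0 h)
    then have "(\<integral>z. H (?a (fst z) (snd z)) \<partial>\<pi>) \<le> (\<integral>z. H (?a (fst z) (snd z) + t * h (fst z)) \<partial>\<pi>)"
      using best unfolding payoff2_def by (fastforce simp: algebra_simps)
    also have "\<dots> \<le> (\<integral>z. H (?a (fst z) (snd z)) +
        (t * (H' (?a (fst z) (snd z)) * h (fst z)) + C * t\<^sup>2 * (h (fst z))\<^sup>2) \<partial>\<pi>)"
    proof (intro integral_mono Bochner_Integration.integrable_add integrable_mult_right i1 i2 i3 i4)
      fix z
      show "H (?a (fst z) (snd z) + t * h (fst z)) \<le> H (?a (fst z) (snd z)) +
        (t * (H' (?a (fst z) (snd z)) * h (fst z)) + C * t\<^sup>2 * (h (fst z))\<^sup>2)"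
        using H_taylor[of "?a (fst z) (snd z)" "t * h (fst z)"] by (simp add: power_mult_distrib mult_ac)
    qed
    also have "\<dots> = (\<integral>z. H (?a (fst z) (snd z)) \<partial>\<pi>) + (t * D + Q * t\<^sup>2)"
      using i1 i3 i4 by (simp add: D_def Q_def)
    finally show ?thesis by simp
  qed
  have "0 \<le> Q" using C_nonneg by (auto simp: Q_def intro!: mult_nonneg_nonneg integral_nonneg_AE)
  show ?thesis
  proof (rule ccontr)
    assume "\<not> ?thesis"
    then have D: "D \<noteq> 0" by (simp add: D_def)
    \<comment> \<open>a step against the gradient, short enough for the quadratic term to stay smaller\<close>
    define r where "r = 1 / (2 * Q + 1)"
    have r: "0 < r" "Q * r < 1" using \<open>0 \<le> Q\<close> by (auto simp: r_def field_simps)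
    have "0 \<le> - (r * D) * D + Q * (- (r * D))\<^sup>2" by (rule key)
    also have "\<dots> = - (r * D\<^sup>2 * (1 - Q * r))"
      by (simp add: power2_eq_square algebra_simps)
    also have "\<dots> < 0" using r D by simp
    finally show False by simp
  qed
qed

lemma best_response2_first_order_const:
  assumes \<pi>: "\<pi> \<in> strategies1 \<mu> n" and \<mu>: "AE l in \<mu>. 0 \<le> l \<and> l \<le> 1" and n: "n \<ge> 1"
    and X: "X \<in> strategies2 n"
    and best: "\<forall>X'\<in>strategies2 n. payoff2 H n \<pi> X \<le> payoff2 H n \<pi> X'"
  shows "\<exists>c\<ge>\<epsilon>. \<forall>h. (\<integral>z. H' (snd z * S_sum n (fst z) - X (fst z)) * h (fst z) \<partial>\<pi>) =
      c * cube_mean n h"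
proof (intro exI conjI allI)
  interpret \<pi>: prob_space \<pi> using \<pi> by (simp add: strategies1_def)
  let ?G = "\<lambda>z. H' (snd z * S_sum n (fst z) - X (fst z))"
  let ?c = "\<integral>z. ?G z \<partial>\<pi>"
  have int: "integrable \<pi> (\<lambda>z. ?G z * h (fst z))" for h
    by (rule strategies1_integrable[OF \<pi> \<mu>, of "\<lambda>w l. H' (l * S_sum n w - X w) * h w"])
       (intro continuous_intros continuous_on_compose2[OF continuous_H'[of UNIV]], auto)
  show "\<epsilon> \<le> ?c"
    using int[of "\<lambda>_. 1"] \<pi>.prob_space lower by (intro \<pi>.integral_ge_const) auto
  fix h :: "(nat \<Rightarrow> real) \<Rightarrow> real"
  let ?m = "cube_mean n h"
  have "0 = (\<integral>z. ?G z * (h (fst z) - ?m) \<partial>\<pi>)"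
    by (rule best_response2_first_order[OF assms, symmetric]) simp
  also have "\<dots> = (\<integral>z. ?G z * h (fst z) \<partial>\<pi>) - ?c * ?m"
    using int[of h] int[of "\<lambda>_. ?m"] by (simp add: right_diff_distrib)
  finally show "(\<integral>z. ?G z * h (fst z) \<partial>\<pi>) = ?c * ?m" by simp
qed

text \<open>What the asymptotic analysis uses of an equilibrium: both players' optimality as first order
  conditions on a potential, subgradients for the first and the multiplier \<open>c\<close> for the second.\<close>

definition potential_equilibrium ::
  "nat \<Rightarrow> ((nat \<Rightarrow> real) \<times> real) measure \<Rightarrow> (real \<Rightarrow> real) \<Rightarrow> real \<Rightarrow> bool" where
  "potential_equilibrium n \<pi> F c \<longleftrightarrow>
     convex_on UNIV F \<and> (\<forall>x y. \<bar>F x - F y\<bar> \<le> \<bar>x - y\<bar>) \<and>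
     cube_mean n (\<lambda>w. F (S_sum n w)) = 0 \<and>
     (AE z in \<pi>. \<forall>x. snd z * x - F x \<le> snd z * S_sum n (fst z) - F (S_sum n (fst z))) \<and>
     \<epsilon> \<le> c \<and>
     (\<forall>h. (\<integral>z. H' (snd z * S_sum n (fst z) - F (S_sum n (fst z))) * h (fst z) \<partial>\<pi>) =
        c * cube_mean n h)"

text \<open>The potential is the upper envelope of the lines \<open>x \<mapsto> l * x - M l\<close> with slopes \<open>l\<close> in the unit
  interval, where \<open>M l\<close> is the best payoff of the first player at \<open>l\<close>.  It lies below \<open>X\<close> on the
  values of \<open>S\<close> by definition of \<open>M\<close>.  It touches \<open>X\<close> at each of them because every path has positive
  probability and is therefore optimal for some \<open>l\<close>.\<close>

lemma nash_equilibrium_potential: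
  assumes nash: "nash_equilibrium \<mu> H n \<pi> X" and \<mu>: "AE l in \<mu>. 0 \<le> l \<and> l \<le> 1" and n: "n \<ge> 1"
  shows "\<exists>F c. potential_equilibrium n \<pi> F c \<and> (\<forall>w\<in>Omega n. X w = F (S_sum n w))"
proof -
  from nash have \<pi>: "\<pi> \<in> strategies1 \<mu> n" and X: "X \<in> strategies2 n"
    and best1: "\<forall>\<pi>'\<in>strategies1 \<mu> n. payoff1 n \<pi>' X \<le> payoff1 n \<pi> X"
    and best2: "\<forall>X'\<in>strategies2 n. payoff2 H n \<pi> X \<le> payoff2 H n \<pi> X'"
    by (auto simp: nash_equilibrium_def)
  obtain c where c: "\<epsilon> \<le> c" "\<And>h. (\<integral>z. H' (snd z * S_sum n (fst z) - X (fst z)) * h (fst z) \<partial>\<pi>) =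
      c * cube_mean n h"
    using best_response2_first_order_const[OF \<pi> \<mu> n X best2] by blast
  define M where "M l = Max ((\<lambda>w. l * S_sum n w - X w) ` Omega n)" for l
  have M_ge: "l * S_sum n w - X w \<le> M l" if "w \<in> Omega n" for w l
    unfolding M_def by (rule Max_ge) (use that in auto)
  have supp: "AE z in \<pi>. M (snd z) = snd z * S_sum n (fst z) - X (fst z)"
    using best_response1_support[OF \<pi> \<mu> best1] AE_space
  proof eventually_elim
    fix z assume "\<forall>w'\<in>Omega n. snd z * S_sum n w' - X w' \<le> snd z * S_sum n (fst z) - X (fst z)"
      and "z \<in> space \<pi>"
    then show "M (snd z) = snd z * S_sum n (fst z) - X (fst z)"
      unfolding M_def by (intro Max_eqI) (auto simp: strategies1_space[OF \<pi>])
  qed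
  define F where "F x = (SUP l\<in>{0..1}. l * x - M l)" for x
  have bdd: "bdd_above ((\<lambda>l. l * x - M l) ` {0..1})" for x
  proof -
    obtain w where w: "w \<in> Omega n" using Omega_nonempty by blast
    have "l * x - M l \<le> \<bar>x - S_sum n w\<bar> + X w" if "l \<in> {0..1}" for l
    proof -
      have "l * x - M l \<le> l * (x - S_sum n w) + X w"
        using M_ge[OF w, of l] by (simp add: algebra_simps)
      moreover have "l * (x - S_sum n w) \<le> \<bar>x - S_sum n w\<bar>"
        using that by (smt (verit) atLeastAtMost_iff mult_left_le_one_le mult_nonneg_nonpos abs_ge_zero abs_ge_self)
      ultimately show ?thesis by linarith
    qed
    then show ?thesis by (rule bdd_aboveI2)
  qed
  have F_ge: "l * x - M l \<le> F x" if "l \<in> {0..1}" for l x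
    unfolding F_def by (rule cSUP_upper[OF that bdd])
  have F_le: "F x \<le> b" if "\<And>l. l \<in> {0..1} \<Longrightarrow> l * x - M l \<le> b" for x b
    unfolding F_def by (rule cSUP_least) (use that in auto)
  have convex: "convex_on UNIV F"
  proof (rule convex_onI)
    fix t x y :: real assume t: "0 < t" "t < 1"
    show "F ((1 - t) *\<^sub>R x + t *\<^sub>R y) \<le> (1 - t) * F x + t * F y"
    proof (rule F_le)
      fix l :: real assume l: "l \<in> {0..1}"
      have "l * ((1 - t) *\<^sub>R x + t *\<^sub>R y) - M l = (1 - t) * (l * x - M l) + t * (l * y - M l)"
        by (simp add: algebra_simps)
      also have "\<dots> \<le> (1 - t) * F x + t * F y"
        using F_ge[OF l] t by (intro add_mono mult_left_mono) auto
      finally show "l * ((1 - t) *\<^sub>R x + t *\<^sub>R y) - M l \<le> (1 - t) * F x + t * F y" .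
    qed
  qed simp
  have F_step: "F x \<le> F y + \<bar>x - y\<bar>" for x y
  proof (rule F_le)
    fix l :: real assume l: "l \<in> {0..1}"
    have "l * (x - y) \<le> \<bar>x - y\<bar>"
      using l by (smt (verit) atLeastAtMost_iff mult_left_le_one_le mult_nonneg_nonpos abs_ge_zero abs_ge_self)
    then show "l * x - M l \<le> F y + \<bar>x - y\<bar>"
      using F_ge[OF l, of y] by (simp add: algebra_simps)
  qed
  have lip: "\<bar>F x - F y\<bar> \<le> \<bar>x - y\<bar>" for x y
    using F_step[of x y] F_step[of y x] by linarith
  have XF: "X w = F (S_sum n w)" if w: "w \<in> Omega n" for w
  proof (rule antisym)
    show "F (S_sum n w) \<le> X w" using M_ge[OF w] by (intro F_le) (simp add: algebra_simps)
    \<comment> \<open>a path of probability zero would contradict the first order condition\<close>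
    have "\<not> (AE z in \<pi>. fst z \<noteq> w)"
    proof
      assume "AE z in \<pi>. fst z \<noteq> w"
      then have "(\<integral>z. H' (snd z * S_sum n (fst z) - X (fst z)) * (if fst z = w then 1 else 0) \<partial>\<pi>) = (\<integral>z. 0 \<partial>\<pi>)"
        by (intro integral_cong_AE) (auto intro!: strategies1_measurable[OF \<pi>,
            where g = "\<lambda>\<eta> l. H' (l * S_sum n \<eta> - X \<eta>) * (if \<eta> = w then 1 else 0)"])
      then have "c * cube_mean n (\<lambda>\<eta>. if \<eta> = w then 1 else 0) = 0"
        using c(2)[of "\<lambda>\<eta>. if \<eta> = w then 1 else 0"] by simp
      moreover have "cube_mean n (\<lambda>\<eta>. if \<eta> = w then 1 else 0) > (0::real)"
        using w by (auto simp: cube_expectation card_gt_0_iff)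
      ultimately show False using c(1) eps_pos by auto
    qed
    moreover have "AE z in \<pi>. fst z \<noteq> w"
      if "\<And>l. l \<in> {0..1} \<Longrightarrow> M l \<noteq> l * S_sum n w - X w"
      using supp strategies1_AE_snd[OF \<pi> \<mu>] by eventually_elim (use that in auto)
    ultimately obtain l where "l \<in> {0..1}" "M l = l * S_sum n w - X w" by blast
    then show "X w \<le> F (S_sum n w)" using F_ge[of l "S_sum n w"] by simp
  qed
  show ?thesis
    unfolding potential_equilibrium_def
  proof (intro exI[of _ F] exI[of _ c] conjI allI ballI convex lip XF c(1))
    have "cube_mean n (\<lambda>w. F (S_sum n w)) = cube_mean n X"
      by (rule cube_expectation_cong) (simp add: XF)
    also have "\<dots> = 0"
      using X represents_imp_centered by (auto simp: strategies2_def)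
    finally show "cube_mean n (\<lambda>w. F (S_sum n w)) = 0" .
    show "AE z in \<pi>. \<forall>x. snd z * x - F x \<le> snd z * S_sum n (fst z) - F (S_sum n (fst z))"
      using supp strategies1_AE_snd[OF \<pi> \<mu>] AE_space
    proof eventually_elim
      fix z assume z: "M (snd z) = snd z * S_sum n (fst z) - X (fst z)" "0 \<le> snd z \<and> snd z \<le> 1"
        "z \<in> space \<pi>"
      then have "X (fst z) = F (S_sum n (fst z))" by (intro XF) (auto simp: strategies1_space[OF \<pi>])
      moreover have "snd z * x - M (snd z) \<le> F x" for x using F_ge z(2) by simp
      ultimately show "\<forall>x. snd z * x - F x \<le> snd z * S_sum n (fst z) - F (S_sum n (fst z))"
        using z(1) by (auto simp: algebra_simps)
    qed
    show "(\<integral>z. H' (snd z * S_sum n (fst z) - F (S_sum n (fst z))) * h (fst z) \<partial>\<pi>) =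
      c * cube_mean n h" for h
      unfolding c(2)[symmetric]
      by (intro Bochner_Integration.integral_cong refl) (auto simp: strategies1_space[OF \<pi>] XF)
  qed
qed

end

section \<open>The prior\<close>

locale prior =
  fixes \<mu> :: "real measure"
  assumes admissible: "admissible_prior \<mu>"
begin

sublocale real_distribution \<mu>
proof (intro real_distribution.intro real_distribution_axioms.intro)
  show "prob_space \<mu>" using admissible by (simp add: admissible_prior_def)
  show "sets \<mu> = sets borel" using admissible by (auto simp: admissible_prior_def)
qed

lemma density_form:
  obtains f where "f \<in> borel_measurable borel" "\<And>x. x \<in> {0..1} \<Longrightarrow> 0 < f x" "\<And>x. x \<notin> {0..1} \<Longrightarrow> f x = 0"
    "\<mu> = density lborel (\<lambda>x. ennreal (f x))"
proof -
  from admissible obtain f f' where f: "\<And>x. x \<in> {0..1} \<Longrightarrow> 0 < f x"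
      "\<And>x. x \<in> {0..1} \<Longrightarrow> (f has_real_derivative f' x) (at x within {0..1})"
    and \<mu>: "\<mu> = density lborel (\<lambda>x. ennreal (f x * indicator {0..1} x))"
    unfolding admissible_prior_def by blast
  have "continuous_on {0..1} f"
    using f(2) by (meson DERIV_continuous continuous_on_eq_continuous_within)
  then have "(\<lambda>x. indicator {0..1} x *\<^sub>R f x) \<in> borel_measurable borel"
    by (rule borel_measurable_continuous_on_indicator[rotated]) simp
  then have "(\<lambda>x. f x * indicator {0..1} x) \<in> borel_measurable borel"
    by (simp add: mult.commute)
  then show ?thesis
    by (rule that[OF _ _ _ \<mu>]) (auto simp: f(1))
qed

lemma AE_unit_interval: "AE l in \<mu>. 0 \<le> l \<and> l \<le> 1"
proof -
  obtain f where f: "f \<in> borel_measurable borel" "\<And>x. x \<notin> {0..1} \<Longrightarrow> f x = 0"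
      "\<mu> = density lborel (\<lambda>x. ennreal (f x))"
    by (rule density_form) blast
  have "AE x in lborel. 0 < ennreal (f x) \<longrightarrow> 0 \<le> x \<and> x \<le> 1"
    using f(2) by (intro AE_I2) (metis atLeastAtMost_iff ennreal_0 less_irrefl)
  then show ?thesis
    unfolding f(3) by (subst AE_density) (use f(1) in auto)
qed

lemma null_singleton: "measure \<mu> {x} = 0"
proof -
  obtain f where f: "f \<in> borel_measurable borel" "\<mu> = density lborel (\<lambda>x. ennreal (f x))"
    by (rule density_form) blast
  have "AE y in lborel. y \<noteq> x" by (rule AE_lborel_singleton)
  then have "AE y in \<mu>. y \<noteq> x"
    unfolding f(2) by (subst AE_density) (use f(1) in \<open>auto elim: eventually_mono\<close>)
  then show ?thesis
    by (subst (asm) AE_iff_measurable[of "{x}"]) (auto simp: measure_def)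
qed

lemma AE_interior: "AE l in \<mu>. 0 < l \<and> l < 1"
proof -
  have "AE l in \<mu>. l \<noteq> x" for x
    by (subst AE_iff_measurable[of "{x}"]) (auto simp: emeasure_eq_measure null_singleton)
  from this[of 0] this[of 1] AE_unit_interval show ?thesis
    by eventually_elim auto
qed

lemma interval_pos:
  assumes "0 \<le> a" "a < b" "b \<le> 1"
  shows "0 < measure \<mu> {a<..b}"
proof (rule ccontr)
  obtain f where f: "f \<in> borel_measurable borel" "\<And>x. x \<in> {0..1} \<Longrightarrow> 0 < f x"
      "\<mu> = density lborel (\<lambda>x. ennreal (f x))"
    by (rule density_form) blast
  assume "\<not> 0 < measure \<mu> {a<..b}"
  then have "measure \<mu> {a<..b} = 0" using measure_nonneg[of \<mu> "{a<..b}"] by linarith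
  then have "AE x in \<mu>. x \<notin> {a<..b}"
    by (subst AE_iff_measurable[of "{a<..b}"]) (auto simp: emeasure_eq_measure)
  then have "AE x in lborel. 0 < ennreal (f x) \<longrightarrow> x \<notin> {a<..b}"
    unfolding f(3) by (subst (asm) AE_density) (use f(1) in auto)
  then have "AE x in lborel. x \<notin> {a<..b}"
    using assms f(2) by (auto elim!: eventually_mono)
  then have "emeasure lborel {a<..b} = 0"
    by (subst (asm) AE_iff_measurable[of "{a<..b}"]) auto
  then show False using \<open>a < b\<close> by simp
qed

lemma cdf_strict: "0 \<le> a \<Longrightarrow> a < b \<Longrightarrow> b \<le> 1 \<Longrightarrow> cdf \<mu> a < cdf \<mu> b"
  using cdf_diff_eq[of a b] interval_pos[of a b] by linarith

lemma cdf_0: "x \<le> 0 \<Longrightarrow> cdf \<mu> x = 0"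
proof -
  assume "x \<le> 0"
  have "AE l in \<mu>. l \<notin> {..x}" using AE_interior by eventually_elim (use \<open>x \<le> 0\<close> in auto)
  then show ?thesis
    by (subst (asm) AE_iff_measurable[of "{..x}"]) (auto simp: measure_def cdf_def)
qed

lemma cdf_1: "1 \<le> x \<Longrightarrow> cdf \<mu> x = 1"
proof -
  assume "1 \<le> x"
  have "AE l in \<mu>. l \<in> {..x}" using AE_interior by eventually_elim (use \<open>1 \<le> x\<close> in auto)
  then show ?thesis
    unfolding cdf_def by (subst prob_eq_1) auto
qed

lemma continuous_cdf: "continuous_on S (cdf \<mu>)"
  by (intro continuous_at_imp_continuous_on ballI) (simp add: isCont_cdf null_singleton)

lemma cdf_less_iff: "0 \<le> a \<Longrightarrow> a \<le> 1 \<Longrightarrow> cdf \<mu> a < cdf \<mu> x \<longleftrightarrow> a < x \<and> a < 1"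
proof -
  assume a: "0 \<le> a" "a \<le> 1"
  show ?thesis
  proof (cases "a < x \<and> a < 1")
    case True
    then have "cdf \<mu> a < cdf \<mu> (min x 1)" using a by (intro cdf_strict) auto
    also have "\<dots> \<le> cdf \<mu> x" by (rule cdf_nondecreasing) simp
    finally show ?thesis using True by simp
  next
    case False
    then have "x \<le> a \<or> cdf \<mu> a = 1" using cdf_1[of a] a by auto
    then show ?thesis using False cdf_nondecreasing[of x a] cdf_bounded_prob[of x] by auto
  qed
qed

lemma prior_inverse_cdf:
  assumes "0 \<le> l" "l \<le> 1"
  shows "prior_inverse \<mu> (cdf \<mu> l) = l"
proof (cases "l = 1")
  case True
  then show ?thesis using cdf_1[of 1] by (simp add: prior_inverse_def)
next
  case False
  then have "cdf \<mu> l < 1" using cdf_strict[of l 1] cdf_1[of 1] assms by simp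
  moreover have "{x. cdf \<mu> l < cdf \<mu> x} = {l<..}"
    using cdf_less_iff[of l] assms False by auto
  ultimately show ?thesis by (simp add: prior_inverse_def right_inverse_def)
qed

lemma cdf_image: "cdf \<mu> ` {0..1} = {0..1}"
proof
  show "cdf \<mu> ` {0..1} \<subseteq> {0..1}" using cdf_nonneg cdf_bounded_prob by auto
  show "{0..1} \<subseteq> cdf \<mu> ` {0..1}"
  proof
    fix y :: real assume "y \<in> {0..1}"
    then obtain x where "0 \<le> x" "x \<le> 1" "cdf \<mu> x = y"
      using IVT'[of "cdf \<mu>" 0 y 1] cdf_0[of 0] cdf_1[of 1] continuous_cdf by auto
    then show "y \<in> cdf \<mu> ` {0..1}" by auto
  qed
qed

lemma continuous_prior_inverse: "continuous_on {0..1} (prior_inverse \<mu>)"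
  using continuous_on_inv[OF continuous_cdf, of "{0..1}" "prior_inverse \<mu>"]
  by (simp add: prior_inverse_cdf cdf_image)

lemma assumes "y \<in> {0..1}"
  shows cdf_prior_inverse: "cdf \<mu> (prior_inverse \<mu> y) = y"
    and prior_inverse_range: "prior_inverse \<mu> y \<in> {0..1}"
proof -
  from assms obtain l where "l \<in> {0..1}" "y = cdf \<mu> l" using cdf_image by blast
  then show "cdf \<mu> (prior_inverse \<mu> y) = y" "prior_inverse \<mu> y \<in> {0..1}"
    by (simp_all add: prior_inverse_cdf)
qed

end

section \<open>Monotone couplings with the prior\<close>

locale prior_coupling = prior \<mu> for \<mu> +
  fixes \<nu> :: "real measure"
  assumes \<nu>: "real_distribution \<nu>"
begin

sublocale \<nu>: real_distribution \<nu> by (rule \<nu>)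

lemma cdf_unit: "cdf \<nu> s \<in> {0..1}"
  using \<nu>.cdf_nonneg \<nu>.cdf_bounded_prob by auto

lemma gam_range: "gam \<mu> \<nu> s \<in> {0..1}" and cdf_gam: "cdf \<mu> (gam \<mu> \<nu> s) = cdf \<nu> s"
  using prior_inverse_range[OF cdf_unit] cdf_prior_inverse[OF cdf_unit] by (auto simp: gam_def)

lemma gam_mono: "s \<le> t \<Longrightarrow> gam \<mu> \<nu> s \<le> gam \<mu> \<nu> t"
  using cdf_less_iff[of "gam \<mu> \<nu> t" "gam \<mu> \<nu> s"] gam_range[of s] gam_range[of t] \<nu>.cdf_nondecreasing[of s t]
  by (auto simp: cdf_gam not_less)

lemma measurable_gam [measurable]: "gam \<mu> \<nu> \<in> borel_measurable borel"
  by (rule borel_measurable_mono) (simp add: mono_def gam_mono)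

lemma measurable_prior_eq: "measurable \<mu> N = measurable borel N"
  by (rule measurable_cong_sets) auto

text \<open>The maps \<open>gam \<mu> \<nu>\<close> and \<open>phi \<mu> \<nu>\<close> are inverse to each other up to jumps and flat pieces, which is
  why one implication needs a strict inequality.\<close>

lemma phi_galois:
  assumes l: "0 < l" "l < 1"
  shows "l < gam \<mu> \<nu> s \<Longrightarrow> phi \<mu> \<nu> l \<le> s" and "phi \<mu> \<nu> l \<le> s \<Longrightarrow> l \<le> gam \<mu> \<nu> s"
proof -
  define y where "y = cdf \<mu> l"
  have y: "0 < y" "y < 1"
    using cdf_strict[of 0 l] cdf_strict[of l 1] cdf_0[of 0] cdf_1[of 1] l by (auto simp: y_def)
  have ge: "bdd_below {x. y < cdf \<nu> x}"
  proof -
    obtain b where "\<And>x. x \<le> b \<Longrightarrow> cdf \<nu> x < y"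
      using order_tendstoD(2)[OF \<nu>.cdf_lim_at_bot y(1)] by (auto simp: eventually_at_bot_linorder)
    then show ?thesis by (intro bdd_belowI[of _ b]) (metis less_imp_le not_le mem_Collect_eq)
  qed
  have ne: "{x. y < cdf \<nu> x} \<noteq> {}"
    using order_tendstoD(1)[OF \<nu>.cdf_lim_at_top_prob y(2)]
    by (auto simp: eventually_at_top_linorder)
  show "phi \<mu> \<nu> l \<le> s" if "l < gam \<mu> \<nu> s"
  proof -
    have "y < cdf \<nu> s" using that l cdf_less_iff[of l "gam \<mu> \<nu> s"] by (simp add: y_def cdf_gam)
    then show ?thesis
      unfolding phi_def right_inverse_def y_def[symmetric] by (intro cInf_lower ge) simp
  qed
  show "l \<le> gam \<mu> \<nu> s" if "phi \<mu> \<nu> l \<le> s"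
  proof -
    have above: "y < cdf \<nu> x" if "s < x" for x
    proof -
      have "Inf {x. y < cdf \<nu> x} < x"
        using \<open>phi \<mu> \<nu> l \<le> s\<close> that by (simp add: phi_def right_inverse_def y_def)
      then obtain x' where "y < cdf \<nu> x'" "x' < x"
        using cInf_less_iff[OF ne ge] by auto
      then show ?thesis using \<nu>.cdf_nondecreasing[of x' x] by simp
    qed
    have "(cdf \<nu> \<longlongrightarrow> cdf \<nu> s) (at_right s)"
      using \<nu>.cdf_is_right_cont[of s] by (simp add: continuous_within)
    then have "y \<le> cdf \<nu> s"
    proof (rule tendsto_lowerbound)
      show "\<forall>\<^sub>F x in at_right s. y \<le> cdf \<nu> x"
        using eventually_at_right_less[of s] by eventually_elim (simp add: above less_imp_le)
    qed simp
    then show ?thesis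
      using cdf_less_iff[of "gam \<mu> \<nu> s" l] gam_range[of s] l
      by (auto simp: y_def cdf_gam not_less)
  qed
qed

lemma measurable_phi [measurable]: "phi \<mu> \<nu> \<in> borel_measurable borel"
proof -
  define A where "A = {0<..<1::real}"
  have "mono_on A (phi \<mu> \<nu>)"
  proof (rule mono_onI)
    fix r s :: real assume "r \<in> A" "s \<in> A" and rs: "r \<le> s"
    then have rs: "r \<in> {0<..<1}" "s \<in> {0<..<1}" "r \<le> s" by (auto simp: A_def)
    show "phi \<mu> \<nu> r \<le> phi \<mu> \<nu> s"
    proof (cases "r = s")
      case False
      then have "r < gam \<mu> \<nu> (phi \<mu> \<nu> s)"
        using phi_galois(2)[of s "phi \<mu> \<nu> s"] rs by auto
      then show ?thesis using phi_galois(1)[of r] rs by auto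
    qed simp
  qed
  then have m: "phi \<mu> \<nu> \<in> borel_measurable (restrict_space borel A)"
    by (rule borel_measurable_mono_on_fnc)
  have "(\<lambda>l. if l \<in> A then phi \<mu> \<nu> l else
      if l \<le> 0 then right_inverse (cdf \<nu>) 0 else right_inverse (cdf \<nu>) 1) \<in> borel_measurable borel"
    by (subst measurable_If_restrict_space_iff) (auto simp: A_def[symmetric] intro: m measurable_restrict_space1, simp add: A_def)
  also have "(\<lambda>l. if l \<in> A then phi \<mu> \<nu> l else
      if l \<le> 0 then right_inverse (cdf \<nu>) 0 else right_inverse (cdf \<nu>) 1) = phi \<mu> \<nu>"
    using cdf_0 cdf_1 by (auto simp: phi_def fun_eq_iff A_def)
  finally show ?thesis .
qed

lemma distr_phi: "distr \<mu> borel (phi \<mu> \<nu>) = \<nu>"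
proof (rule cdf_unique)
  show "real_distribution (distr \<mu> borel (phi \<mu> \<nu>))"
    by (intro real_distribution.intro real_distribution_axioms.intro prob_space_distr) auto
  show "cdf (distr \<mu> borel (phi \<mu> \<nu>)) = cdf \<nu>"
  proof
    fix s
    have "AE l in \<mu>. l \<noteq> gam \<mu> \<nu> s"
      by (subst AE_iff_measurable[of "{gam \<mu> \<nu> s}"]) (auto simp: emeasure_eq_measure null_singleton)
    with AE_interior have "AE l in \<mu>. l \<in> phi \<mu> \<nu> -` {..s} \<longleftrightarrow> l \<in> {..gam \<mu> \<nu> s}"
    proof eventually_elim
      fix l assume l: "0 < l \<and> l < 1" "l \<noteq> gam \<mu> \<nu> s"
      then show "l \<in> phi \<mu> \<nu> -` {..s} \<longleftrightarrow> l \<in> {..gam \<mu> \<nu> s}"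
        using phi_galois[of l s] by (auto simp: le_less)
    qed
    then have "measure \<mu> (phi \<mu> \<nu> -` {..s}) = measure \<mu> {..gam \<mu> \<nu> s}"
      by (intro finite_measure_eq_AE) (auto intro: measurable_sets_borel[OF measurable_phi])
    then show "cdf (distr \<mu> borel (phi \<mu> \<nu>)) s = cdf \<nu> s"
      using cdf_gam[of s] by (simp add: cdf_def measure_distr)
  qed
qed (rule \<nu>)

lemma integral_phi:
  assumes "f \<in> borel_measurable borel"
  shows "(\<integral>l. f (phi \<mu> \<nu> l) \<partial>\<mu>) = integral\<^sup>L \<nu> (f :: real \<Rightarrow> real)"
    and "integrable \<mu> (\<lambda>l. f (phi \<mu> \<nu> l)) \<longleftrightarrow> integrable \<nu> f"
proof -
  show "(\<integral>l. f (phi \<mu> \<nu> l) \<partial>\<mu>) = integral\<^sup>L \<nu> f"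
    by (subst distr_phi[symmetric], subst integral_distr) (use assms in auto)
  show "integrable \<mu> (\<lambda>l. f (phi \<mu> \<nu> l)) \<longleftrightarrow> integrable \<nu> f"
    by (subst distr_phi[symmetric], subst integrable_distr_eq) (use assms in auto)
qed

lemma bounded_set_integrable:
  fixes g :: "real \<Rightarrow> real"
  assumes "g \<in> borel_measurable borel" "\<And>t. \<bar>g t\<bar> \<le> 1"
  shows "set_integrable lborel {a..b} g"
  unfolding set_integrable_def
proof (rule integrableI_bounded_set_indicator[where B = 1])
  show "emeasure lborel {a..b} < \<infinity>" by (cases "a \<le> b") auto
qed (use assms in auto)

lemma gam_integrable: "interval_lebesgue_integrable lborel (ereal a) (ereal b) (gam \<mu> \<nu>)"
proof -
  have "set_integrable lborel {min a b..max a b} (gam \<mu> \<nu>)"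
    using gam_range by (intro bounded_set_integrable) auto
  then show ?thesis
    unfolding interval_lebesgue_integrable_def
    by (auto intro: set_integrable_subset split: if_splits simp: min_def max_def)
qed

lemma Gam_diff: "Gam \<mu> \<nu> y - Gam \<mu> \<nu> x = (LBINT t=ereal x..ereal y. gam \<mu> \<nu> t)"
proof -
  have "min 0 (min (ereal x) (ereal y)) = ereal (min 0 (min x y))"
    "max 0 (max (ereal x) (ereal y)) = ereal (max 0 (max x y))"
    by (auto simp: min_def max_def zero_ereal_def)
  then have "interval_lebesgue_integrable lborel (min 0 (min (ereal x) (ereal y)))
      (max 0 (max (ereal x) (ereal y))) (gam \<mu> \<nu>)"
    by (simp only: gam_integrable)
  from interval_integral_sum[OF this] show ?thesis by (simp add: Gam_def)
qed

lemma Gam_lipschitz: "\<bar>Gam \<mu> \<nu> x - Gam \<mu> \<nu> y\<bar> \<le> \<bar>x - y\<bar>"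
proof (rule linorder_wlog[of "\<lambda>x y. \<bar>Gam \<mu> \<nu> x - Gam \<mu> \<nu> y\<bar> \<le> \<bar>x - y\<bar>"])
  fix x y :: real assume "x \<le> y"
  have "\<bar>Gam \<mu> \<nu> y - Gam \<mu> \<nu> x\<bar> = \<bar>LBINT t:{x..y}. gam \<mu> \<nu> t\<bar>"
    using \<open>x \<le> y\<close> by (simp add: Gam_diff interval_integral_Icc)
  also have "\<dots> \<le> (LBINT t:{x..y}. \<bar>gam \<mu> \<nu> t\<bar>)"
    unfolding set_lebesgue_integral_def
    using integral_abs_bound[of lborel "\<lambda>t. indicator {x..y} t *\<^sub>R gam \<mu> \<nu> t"] by (simp add: abs_mult)
  also have "\<dots> \<le> (LBINT t:{x..y}. 1)"
    using gam_range by (intro set_integral_mono bounded_set_integrable) auto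
  also have "\<dots> = y - x" using \<open>x \<le> y\<close> by (simp add: set_lebesgue_integral_def)
  finally show "\<bar>Gam \<mu> \<nu> x - Gam \<mu> \<nu> y\<bar> \<le> \<bar>x - y\<bar>" using \<open>x \<le> y\<close> by (simp add: abs_minus_commute)
qed (simp add: abs_minus_commute)

lemma Psi_lipschitz: "\<bar>Psi \<mu> \<rho> \<nu> x - Psi \<mu> \<rho> \<nu> y\<bar> \<le> \<bar>x - y\<bar>"
  using Gam_lipschitz[of x y] by (simp add: Psi_def)

lemma measurable_Psi [measurable]: "Psi \<mu> \<rho> \<nu> \<in> borel_measurable borel"
  by (rule normal_integrable_lipschitz(1)) (rule Psi_lipschitz)

lemma Psi_normal_centered: "integral\<^sup>L std_normal_distribution (Psi \<mu> std_normal_distribution \<nu>) = 0"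
proof -
  interpret N: real_distribution std_normal_distribution by (rule real_dist_normal_dist)
  have "integrable std_normal_distribution (Gam \<mu> \<nu>)"
    by (rule normal_integrable_lipschitz(2)) (rule Gam_lipschitz)
  then show ?thesis using N.prob_space by (simp add: Psi_def[abs_def])
qed

context
  assumes atomless: "\<And>x. measure \<nu> {x} = 0"
begin

lemma continuous_gam: "continuous_on UNIV (gam \<mu> \<nu>)"
proof -
  have "continuous_on UNIV (cdf \<nu>)"
    by (intro continuous_at_imp_continuous_on ballI) (simp add: \<nu>.isCont_cdf atomless)
  from continuous_on_compose2[OF continuous_prior_inverse this] cdf_unit
  show ?thesis by (auto simp: gam_def[abs_def] image_subset_iff)
qed

lemma Psi_deriv: "(Psi \<mu> \<rho> \<nu> has_real_derivative gam \<mu> \<nu> x) (at x)"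
proof -
  define a b where "a = min 0 x - 1" and "b = max 0 x + 1"
  have "((\<lambda>u. LBINT y=ereal 0..ereal u. gam \<mu> \<nu> y) has_vector_derivative gam \<mu> \<nu> x) (at x within {a..b})"
    by (rule interval_integral_FTC2) (auto simp: a_def b_def intro: continuous_on_subset[OF continuous_gam])
  then have "(Gam \<mu> \<nu> has_vector_derivative gam \<mu> \<nu> x) (at x within {a..b})"
    by (simp add: Gam_def[abs_def] zero_ereal_def)
  moreover have "at x within {a..b} = at x"
    by (rule at_within_interior) (auto simp: a_def b_def)
  ultimately have "(Gam \<mu> \<nu> has_real_derivative gam \<mu> \<nu> x) (at x)"
    by (simp add: has_real_derivative_iff_has_vector_derivative)
  then show ?thesis unfolding Psi_def[abs_def] by (auto intro!: derivative_eq_intros)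
qed

text \<open>The derivative \<open>gam \<mu> \<nu>\<close> of the potential is at most \<open>l\<close> to the left of \<open>phi \<mu> \<nu> l\<close> and at least
  \<open>l\<close> to the right of it.\<close>

lemma phi_subgradient:
  assumes l: "0 < l" "l < 1"
  shows "l * x - Psi \<mu> \<rho> \<nu> x \<le> l * phi \<mu> \<nu> l - Psi \<mu> \<rho> \<nu> (phi \<mu> \<nu> l)"
proof -
  let ?s = "phi \<mu> \<nu> l" and ?\<psi> = "Psi \<mu> \<rho> \<nu>"
  consider "x < ?s" | "x = ?s" | "?s < x" by linarith
  then show ?thesis
  proof cases
    case 1
    then obtain z where z: "x < z" "z < ?s" "?\<psi> ?s - ?\<psi> x = (?s - x) * gam \<mu> \<nu> z"
      using MVT2[of x ?s ?\<psi> "gam \<mu> \<nu>"] Psi_deriv by auto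
    then have "gam \<mu> \<nu> z \<le> l" using phi_galois(1)[OF l, of z] by linarith
    then have "(?s - x) * gam \<mu> \<nu> z \<le> (?s - x) * l" using 1 by (intro mult_left_mono) auto
    then show ?thesis using z(3) by (simp add: algebra_simps)
  next
    case 3
    then obtain z where z: "?s < z" "z < x" "?\<psi> x - ?\<psi> ?s = (x - ?s) * gam \<mu> \<nu> z"
      using MVT2[of ?s x ?\<psi> "gam \<mu> \<nu>"] Psi_deriv by auto
    then have "l \<le> gam \<mu> \<nu> z" using phi_galois(2)[OF l, of z] by linarith
    then have "(x - ?s) * l \<le> (x - ?s) * gam \<mu> \<nu> z" using 3 by (intro mult_left_mono) auto
    then show ?thesis using z(3) by (simp add: algebra_simps)
  qed simp
qed

end

end

section \<open>Fixed points of the operator\<close>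

lemma normal_interval_pos:
  assumes "a < b"
  shows "0 < measure std_normal_distribution {a<..<b}"
proof (rule ccontr)
  interpret N: real_distribution std_normal_distribution by (rule real_dist_normal_dist)
  assume "\<not> 0 < measure std_normal_distribution {a<..<b}"
  then have "measure std_normal_distribution {a<..<b} = 0"
    using measure_nonneg[of std_normal_distribution "{a<..<b}"] by linarith
  then have "AE x in std_normal_distribution. x \<notin> {a<..<b}"
    by (subst AE_iff_measurable[of "{a<..<b}"]) (auto simp: N.emeasure_eq_measure)
  then have "AE x in lborel. 0 < ennreal (std_normal_density x) \<longrightarrow> x \<notin> {a<..<b}"
    by (subst (asm) AE_density) auto
  then have "AE x in lborel. x \<notin> {a<..<b}"
    by (simp add: normal_density_pos)
  then have "emeasure lborel {a<..<b} = 0"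
    by (subst (asm) AE_iff_measurable[of "{a<..<b}"]) auto
  then show False using \<open>a < b\<close> by simp
qed

lemma normal_null_singleton: "measure std_normal_distribution {x} = 0"
proof -
  have "AE y in lborel. y \<noteq> x" by (rule AE_lborel_singleton)
  then have "AE y in std_normal_distribution. y \<noteq> x"
    by (subst AE_density) (auto elim: eventually_mono)
  then show ?thesis
    by (subst (asm) AE_iff_measurable[of "{x}"]) (auto simp: measure_def)
qed

lemma (in utility) deriv_eq: "deriv H = H'"
  using DERIV_imp_deriv[OF deriv] by (simp add: fun_eq_iff)

lemma (in utility) integrable_compose:
  assumes "finite_measure M" "integrable M f"
  shows "integrable M (\<lambda>x. H (f x))"
proof -
  interpret finite_measure M by fact
  have [measurable]: "f \<in> borel_measurable M" using assms(2) by auto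
  show ?thesis
  proof (rule Bochner_Integration.integrable_bound)
    show "integrable M (\<lambda>x. \<bar>H 0\<bar> + K * \<bar>f x\<bar>)" using assms(2) by simp
    have "\<bar>H y\<bar> \<le> \<bar>H 0\<bar> + K * \<bar>y\<bar>" for y using H_lipschitz[of y 0] by auto
    then have "norm (H y) \<le> norm (\<bar>H 0\<bar> + K * \<bar>y\<bar>)" for y
      by (smt (verit) real_norm_def)
    then show "AE x in M. norm (H (f x)) \<le> norm (\<bar>H 0\<bar> + K * \<bar>f x\<bar>)" by simp
  qed measurable
qed

locale fixed_point = utility H H' \<epsilon> K C + prior_coupling \<mu> \<nu>
  for H H' :: "real \<Rightarrow> real" and \<epsilon> K C :: real and \<mu> \<nu> :: "real measure" +
  assumes fixed: "T_op \<mu> H std_normal_distribution \<nu> = std_normal_distribution"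
begin

abbreviation \<psi> :: "real \<Rightarrow> real" where "\<psi> \<equiv> Psi \<mu> std_normal_distribution \<nu>"
abbreviation \<gamma> :: "real \<Rightarrow> real" where "\<gamma> \<equiv> gam \<mu> \<nu>"
abbreviation \<phi> :: "real \<Rightarrow> real" where "\<phi> \<equiv> phi \<mu> \<nu>"
abbreviation Y :: "real \<Rightarrow> real" where "Y \<equiv> Y_cond \<mu> H std_normal_distribution \<nu>"

lemma measurable_graph: "(\<lambda>l. (l, \<phi> l)) \<in> measurable \<mu> (borel :: (real \<times> real) measure)"
  unfolding measurable_prior_eq by (intro borel_measurable_Pair) auto

lemma Pi_bar_subalgebra:
  "finite_measure_subalgebra (Pi_bar \<mu> \<nu>) (vimage_algebra (space (Pi_bar \<mu> \<nu>)) snd borel)"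
proof -
  interpret M: prob_space "Pi_bar \<mu> \<nu>"
    unfolding Pi_bar_def by (rule prob_space_distr[OF measurable_graph])
  have "snd \<in> measurable (borel :: (real \<times> real) measure) (borel :: real measure)"
    by (simp add: borel_prod[symmetric])
  then have "subalgebra (Pi_bar \<mu> \<nu>) (vimage_algebra (space (Pi_bar \<mu> \<nu>)) snd borel)"
    unfolding subalgebra_def by (auto simp: Pi_bar_def sets_vimage_algebra2 intro: measurable_sets_borel)
  then show ?thesis
    by (intro finite_measure_subalgebra.intro finite_measure_subalgebra_axioms.intro) unfold_locales
qed

lemma measurable_marginal_slope [measurable]:
  "(\<lambda>(l, s). H' (l * s - \<psi> s)) \<in> borel_measurable (borel :: (real \<times> real) measure)"
  unfolding borel_prod[symmetric] by measurable

text \<open>As a function on the plane the conditional expectation depends on the second coordinate alone, so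
  \<open>Y\<close> evaluated at that coordinate is a version of it.\<close>

lemma Y_snd: "cond_exp_given (Pi_bar \<mu> \<nu>) snd (\<lambda>(l, s). deriv H (l * s - \<psi> s)) (l, s) = Y s"
  unfolding Y_cond_def by (rule cond_exp_given_snd) (simp add: Pi_bar_def)

lemma measurable_Y [measurable]: "Y \<in> borel_measurable borel"
proof -
  let ?F = "vimage_algebra (UNIV :: (real \<times> real) set) snd (borel :: real measure)"
  have "(\<lambda>s. (0 :: real, s)) \<in> measurable borel ?F"
    by (rule measurable_vimage_algebra2) auto
  moreover have "real_cond_exp (Pi_bar \<mu> \<nu>) ?F f \<in> borel_measurable ?F" for f
    by (rule borel_measurable_cond_exp)
  ultimately have "(\<lambda>s. real_cond_exp (Pi_bar \<mu> \<nu>) ?F f (0, s)) \<in> borel_measurable borel" for f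
    by (rule measurable_compose)
  moreover have "space (Pi_bar \<mu> \<nu>) = UNIV" by (simp add: Pi_bar_def)
  ultimately show ?thesis
    by (simp add: Y_cond_def[abs_def] cond_exp_given_def)
qed

lemma real_cond_exp_eq_Y:
  "real_cond_exp (Pi_bar \<mu> \<nu>) (vimage_algebra (space (Pi_bar \<mu> \<nu>)) snd borel)
    (\<lambda>(l, s). H' (l * s - \<psi> s)) = (\<lambda>z. Y (snd z))"
  using Y_snd by (auto simp: fun_eq_iff cond_exp_given_def deriv_eq)

lemma AE_Y_bounds: "AE s in \<nu>. \<epsilon> \<le> Y s \<and> Y s \<le> K"
proof -
  interpret finite_measure_subalgebra "Pi_bar \<mu> \<nu>" "vimage_algebra (space (Pi_bar \<mu> \<nu>)) snd borel"
    by (rule Pi_bar_subalgebra)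
  let ?G = "\<lambda>(l, s). H' (l * s - \<psi> s)"
  have int: "integrable (Pi_bar \<mu> \<nu>) ?G"
    by (rule integrable_const_bound[where B = K])
       (auto simp: Pi_bar_def upper abs_of_pos[OF deriv_pos])
  have "AE z in Pi_bar \<mu> \<nu>. \<epsilon> \<le> Y (snd z) \<and> Y (snd z) \<le> K"
    using real_cond_exp_ge_c[OF int, of \<epsilon>] real_cond_exp_le_c[OF int, of K]
    unfolding real_cond_exp_eq_Y by (simp add: lower upper case_prod_beta)
  then have "AE l in \<mu>. \<epsilon> \<le> Y (\<phi> l) \<and> Y (\<phi> l) \<le> K"
    unfolding Pi_bar_def by (drule_tac AE_distrD[OF measurable_graph]) simp
  then show ?thesis
    by (subst distr_phi[symmetric], subst AE_distr_iff) auto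
qed

lemma integral_Y:
  assumes [measurable]: "h \<in> borel_measurable borel" and h: "integrable \<nu> h"
  shows "integrable \<nu> (\<lambda>s. Y s * h s)"
    and "(\<integral>s. Y s * h s \<partial>\<nu>) = (\<integral>l. H' (l * \<phi> l - \<psi> (\<phi> l)) * h (\<phi> l) \<partial>\<mu>)"
    and "integrable \<mu> (\<lambda>l. H' (l * \<phi> l - \<psi> (\<phi> l)) * h (\<phi> l))"
proof -
  let ?M = "Pi_bar \<mu> \<nu>" and ?F = "vimage_algebra (space (Pi_bar \<mu> \<nu>)) snd borel"
  interpret finite_measure_subalgebra ?M ?F
    by (rule Pi_bar_subalgebra)
  let ?G = "\<lambda>(l, s). H' (l * s - \<psi> s)"
  have h\<phi>: "integrable \<mu> (\<lambda>l. h (\<phi> l))" using h integral_phi(2)[of h] by simp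
  show i\<mu>: "integrable \<mu> (\<lambda>l. H' (l * \<phi> l - \<psi> (\<phi> l)) * h (\<phi> l))"
    by (rule Bochner_Integration.integrable_bound[OF integrable_mult_right[OF h\<phi>, of K]])
       (auto simp: abs_mult abs_of_pos[OF deriv_pos] abs_of_pos[OF K_pos] intro!: mult_right_mono upper)
  have sndm: "(\<lambda>z. h (snd z)) \<in> borel_measurable (borel :: (real \<times> real) measure)"
    unfolding borel_prod[symmetric] by measurable
  have hG: "(\<lambda>z. h (snd z) * ?G z) \<in> borel_measurable (borel :: (real \<times> real) measure)"
    by (intro borel_measurable_times sndm measurable_marginal_slope)
  have hY: "(\<lambda>z. h (snd z) * Y (snd z)) \<in> borel_measurable (borel :: (real \<times> real) measure)"
    unfolding borel_prod[symmetric] by measurable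
  have iM: "integrable ?M (\<lambda>z. h (snd z) * ?G z)"
    unfolding Pi_bar_def by (subst integrable_distr_eq[OF measurable_graph hG]) (use i\<mu> in \<open>simp add: mult.commute\<close>)
  have hF: "(\<lambda>z. h (snd z)) \<in> borel_measurable ?F"
    by (rule measurable_compose[OF measurable_vimage_algebra1]) auto
  have Gm: "?G \<in> borel_measurable ?M" by (simp add: Pi_bar_def)
  note ci = real_cond_exp_intg[OF iM hF Gm, unfolded real_cond_exp_eq_Y]
  have "integrable \<mu> (\<lambda>l. h (\<phi> l) * Y (\<phi> l))"
    using ci(1) unfolding Pi_bar_def by (subst (asm) integrable_distr_eq[OF measurable_graph hY]) simp
  then show "integrable \<nu> (\<lambda>s. Y s * h s)"
    using integral_phi(2)[of "\<lambda>s. Y s * h s"] by (simp add: mult.commute)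
  have "(\<integral>s. Y s * h s \<partial>\<nu>) = (\<integral>l. h (\<phi> l) * Y (\<phi> l) \<partial>\<mu>)"
    using integral_phi(1)[of "\<lambda>s. Y s * h s"] by (simp add: mult.commute)
  also have "\<dots> = (\<integral>z. h (snd z) * Y (snd z) \<partial>?M)"
    unfolding Pi_bar_def by (subst integral_distr[OF measurable_graph hY]) simp
  also have "\<dots> = (\<integral>z. h (snd z) * ?G z \<partial>?M)" by (rule ci(2))
  also have "\<dots> = (\<integral>l. H' (l * \<phi> l - \<psi> (\<phi> l)) * h (\<phi> l) \<partial>\<mu>)"
    unfolding Pi_bar_def by (subst integral_distr[OF measurable_graph hG]) (simp add: mult.commute)
  finally show "(\<integral>s. Y s * h s \<partial>\<nu>) = (\<integral>l. H' (l * \<phi> l - \<psi> (\<phi> l)) * h (\<phi> l) \<partial>\<mu>)" .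
qed

definition Y_mean :: real where "Y_mean = (\<integral>s. Y s \<partial>\<nu>)"

lemma Y_mean_pos: "0 < Y_mean"
proof -
  have "integrable \<nu> Y" using integral_Y(1)[of "\<lambda>_. 1"] by simp
  then have "\<epsilon> \<le> Y_mean"
    unfolding Y_mean_def using AE_Y_bounds by (intro \<nu>.integral_ge_const) (auto elim: eventually_mono)
  then show ?thesis using eps_pos by linarith
qed

lemma normal_density_form: "std_normal_distribution = density \<nu> (\<lambda>s. ennreal (Y s / Y_mean))"
  using fixed by (simp add: T_op_def Y_mean_def)

lemma AE_density_nonneg: "AE s in \<nu>. 0 \<le> Y s / Y_mean"
  using AE_Y_bounds by eventually_elim (use eps_pos Y_mean_pos in auto)

lemma normal_integral:
  assumes [measurable]: "h \<in> borel_measurable borel"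
  shows "(\<integral>s. h s \<partial>std_normal_distribution) = (\<integral>s. Y s / Y_mean * h s \<partial>\<nu>)"
    and "integrable std_normal_distribution h \<longleftrightarrow> integrable \<nu> (\<lambda>s. Y s / Y_mean * h s)"
proof -
  note nn = AE_density_nonneg
  let ?N = "density \<nu> (\<lambda>s. ennreal (Y s / Y_mean))"
  have "integral\<^sup>L ?N h = (\<integral>s. Y s / Y_mean * h s \<partial>\<nu>)"
    by (subst integral_density) (use nn in auto)
  then show "integral\<^sup>L std_normal_distribution h = (\<integral>s. Y s / Y_mean * h s \<partial>\<nu>)"
    by (simp only: normal_density_form[symmetric])
  have "integrable ?N h \<longleftrightarrow> integrable \<nu> (\<lambda>s. Y s / Y_mean * h s)"
    by (subst integrable_density) (use nn in auto)
  then show "integrable std_normal_distribution h \<longleftrightarrow> integrable \<nu> (\<lambda>s. Y s / Y_mean * h s)"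
    by (simp only: normal_density_form[symmetric])
qed

lemma integrable_normal_imp:
  fixes h :: "real \<Rightarrow> real"
  assumes [measurable]: "h \<in> borel_measurable borel" and h: "integrable std_normal_distribution h"
  shows "integrable \<nu> h"
proof (rule Bochner_Integration.integrable_bound)
  show "integrable \<nu> (\<lambda>s. Y_mean / \<epsilon> * (Y s / Y_mean * h s))"
    using h normal_integral(2)[of h] by (intro integrable_mult_right) simp
  show "AE s in \<nu>. norm (h s) \<le> norm (Y_mean / \<epsilon> * (Y s / Y_mean * h s))"
    using AE_Y_bounds
  proof eventually_elim
    fix s assume "\<epsilon> \<le> Y s \<and> Y s \<le> K"
    then have "1 \<le> Y s / \<epsilon>" using eps_pos by simp
    then have "1 * \<bar>h s\<bar> \<le> Y s / \<epsilon> * \<bar>h s\<bar>" by (intro mult_right_mono) auto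
    then show "norm (h s) \<le> norm (Y_mean / \<epsilon> * (Y s / Y_mean * h s))"
      using Y_mean_pos eps_pos \<open>1 \<le> Y s / \<epsilon>\<close> by (simp add: abs_mult field_simps)
  qed
qed simp

text \<open>The density of the normal law with respect to \<open>\<nu>\<close> is the conditional marginal utility divided by
  its mean.  Undoing the conditioning gives the first order condition of the limit game, with the mean of \<open>Y\<close>
  as multiplier.\<close>

lemma limit_first_order:
  assumes [measurable]: "h \<in> borel_measurable borel" and h: "integrable std_normal_distribution h"
  shows "(\<integral>l. H' (l * \<phi> l - \<psi> (\<phi> l)) * h (\<phi> l) \<partial>\<mu>) = Y_mean * (\<integral>s. h s \<partial>std_normal_distribution)"
    and "integrable \<mu> (\<lambda>l. H' (l * \<phi> l - \<psi> (\<phi> l)) * h (\<phi> l))"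
    and "integrable \<mu> (\<lambda>l. h (\<phi> l))"
proof -
  note h\<nu> = integrable_normal_imp[OF assms]
  show "integrable \<mu> (\<lambda>l. H' (l * \<phi> l - \<psi> (\<phi> l)) * h (\<phi> l))"
    by (rule integral_Y(3)[OF _ h\<nu>]) simp
  show "integrable \<mu> (\<lambda>l. h (\<phi> l))" using h\<nu> integral_phi(2)[of h] by simp
  have "Y_mean * (\<integral>s. h s \<partial>std_normal_distribution) = (\<integral>s. Y_mean * (Y s / Y_mean * h s) \<partial>\<nu>)"
    by (simp add: normal_integral(1))
  also have "\<dots> = (\<integral>s. Y s * h s \<partial>\<nu>)" using Y_mean_pos by simp
  finally show "(\<integral>l. H' (l * \<phi> l - \<psi> (\<phi> l)) * h (\<phi> l) \<partial>\<mu>) = Y_mean * (\<integral>s. h s \<partial>std_normal_distribution)"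
    using integral_Y(2)[OF _ h\<nu>] by simp
qed

text \<open>Marginal utilities lie between \<open>\<epsilon>\<close> and \<open>K\<close>, so \<open>\<nu>\<close> and the normal law have mutually bounded densities.
  Hence \<open>\<nu>\<close> has no atoms, which makes the limit potential differentiable, and it charges every interval.\<close>

lemma measure_comparison:
  assumes [measurable]: "A \<in> sets borel"
  shows "\<epsilon> / Y_mean * measure \<nu> A \<le> measure std_normal_distribution A"
    and "measure std_normal_distribution A \<le> K / Y_mean * measure \<nu> A"
proof -
  interpret N: real_distribution std_normal_distribution by (rule real_dist_normal_dist)
  have A: "measure std_normal_distribution A = (\<integral>s. Y s / Y_mean * indicator A s \<partial>\<nu>)"
    using normal_integral(1)[of "indicator A"] by simp
  have i: "integrable \<nu> (\<lambda>s. Y s / Y_mean * indicator A s)"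
    using normal_integral(2)[of "indicator A"] by (simp add: N.emeasure_eq_measure)
  have i2: "integrable \<nu> (\<lambda>s. c * indicator A s)" for c :: real
    by (simp add: \<nu>.emeasure_eq_measure)
  have "(\<integral>s. \<epsilon> / Y_mean * indicator A s \<partial>\<nu>) \<le> measure std_normal_distribution A"
    unfolding A using AE_Y_bounds Y_mean_pos
    by (intro integral_mono_AE i i2) (erule eventually_mono, auto simp: divide_right_mono indicator_def)
  then show "\<epsilon> / Y_mean * measure \<nu> A \<le> measure std_normal_distribution A" by simp
  have "measure std_normal_distribution A \<le> (\<integral>s. K / Y_mean * indicator A s \<partial>\<nu>)"
    unfolding A using AE_Y_bounds Y_mean_pos
    by (intro integral_mono_AE i i2) (erule eventually_mono, auto simp: divide_right_mono indicator_def)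
  then show "measure std_normal_distribution A \<le> K / Y_mean * measure \<nu> A" by simp
qed

lemma \<nu>_atomless: "measure \<nu> {x} = 0"
proof -
  have "\<epsilon> / Y_mean * measure \<nu> {x} \<le> 0"
    using measure_comparison(1)[of "{x}"] normal_null_singleton[of x] by simp
  moreover have "0 < \<epsilon> / Y_mean" using eps_pos Y_mean_pos by simp
  ultimately show ?thesis
    using measure_nonneg[of \<nu> "{x}"] by (metis antisym mult_le_0_iff not_le)
qed

lemma phi_interval_pos:
  assumes "a < b"
  shows "0 < measure \<mu> {l. a < \<phi> l \<and> \<phi> l < b}"
proof -
  have "0 < K / Y_mean * measure \<nu> {a<..<b}"
    using normal_interval_pos[OF assms] measure_comparison(2)[of "{a<..<b}"] by simp
  then have "0 < measure \<nu> {a<..<b}"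
    using K_pos Y_mean_pos by (simp add: zero_less_mult_iff zero_less_divide_iff)
  also have "measure \<nu> {a<..<b} = measure \<mu> (\<phi> -` {a<..<b})"
    by (subst distr_phi[symmetric], subst measure_distr) auto
  also have "\<phi> -` {a<..<b} = {l. a < \<phi> l \<and> \<phi> l < b}" by auto
  finally show ?thesis .
qed

lemmas \<psi>_deriv = Psi_deriv[OF \<nu>_atomless, of std_normal_distribution]
lemmas \<gamma>_continuous = continuous_gam[OF \<nu>_atomless]
lemmas \<phi>_subgradient = phi_subgradient[OF \<nu>_atomless, of _ _ std_normal_distribution]

end

section \<open>Convergence of the equilibrium potentials\<close>

context utility
begin

definition tangent_gap :: "real \<Rightarrow> real \<Rightarrow> real" where
  "tangent_gap u d = H (u + d) - H u - H' u * d"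

lemma tangent_gap_nonneg: "0 \<le> tangent_gap u d"
  using above_tangent_le[of u "u + d"] by (simp add: tangent_gap_def)

lemma tangent_gap_pos: "d \<noteq> 0 \<Longrightarrow> 0 < tangent_gap u d"
  using above_tangent[of u "u + d"] by (simp add: tangent_gap_def)

lemma tangent_gap_mono:
  assumes "0 < \<eta>" "\<eta> \<le> \<bar>d\<bar>"
  shows "min (tangent_gap u \<eta>) (tangent_gap u (- \<eta>)) \<le> tangent_gap u d"
proof -
  define e where "e = (if 0 \<le> d then \<eta> else - \<eta>)"
  have "H (u + e) + H' (u + e) * (d - e) \<le> H (u + d)"
    using above_tangent_le[of "u + e" "u + d"] by simp
  moreover have "H' u * (d - e) \<le> H' (u + e) * (d - e)"
  proof -
    have "0 \<le> (H' (u + e) - H' u) * e"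
      using above_tangent_le[of u "u + e"] above_tangent_le[of "u + e" u] by (simp add: algebra_simps)
    then have "0 \<le> (H' (u + e) - H' u) * (d - e)"
      using assms by (auto simp: e_def zero_le_mult_iff split: if_splits)
    then show ?thesis by (simp add: algebra_simps)
  qed
  ultimately have "tangent_gap u e \<le> tangent_gap u d"
    by (simp add: tangent_gap_def algebra_simps)
  then show ?thesis by (auto simp: e_def min_def split: if_splits)
qed

text \<open>The gap grows with the distance from the point of tangency, so it suffices to minimise it over a compact
  set of base points at the two offsets \<open>\<eta>\<close> and \<open>- \<eta>\<close>.\<close>

lemma tangent_gap_lower_bound:
  assumes "0 < \<eta>"
  obtains \<kappa> where "0 < \<kappa>" "\<And>u d. \<bar>u\<bar> \<le> R \<Longrightarrow> \<eta> \<le> \<bar>d\<bar> \<Longrightarrow> \<kappa> \<le> tangent_gap u d"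
proof -
  let ?g = "\<lambda>u. min (tangent_gap u \<eta>) (tangent_gap u (- \<eta>))"
  have "continuous_on {- \<bar>R\<bar>..\<bar>R\<bar>} ?g"
    unfolding tangent_gap_def
    by (intro continuous_intros continuous_H' continuous_on_compose2[OF continuous_H[of UNIV]]) auto
  from continuous_attains_inf[OF compact_Icc _ this]
  obtain u0 where u0: "\<forall>u\<in>{- \<bar>R\<bar>..\<bar>R\<bar>}. ?g u0 \<le> ?g u" by fastforce
  show ?thesis
  proof (rule that[of "?g u0"])
    show "0 < ?g u0" using assms by (simp add: tangent_gap_pos)
    fix u d :: real assume "\<bar>u\<bar> \<le> R" "\<eta> \<le> \<bar>d\<bar>"
    then have "u \<in> {- \<bar>R\<bar>..\<bar>R\<bar>}" by auto
    then have "?g u0 \<le> ?g u" by (rule bspec[OF u0])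
    also have "\<dots> \<le> tangent_gap u d" by (rule tangent_gap_mono[OF assms]) fact
    finally show "?g u0 \<le> tangent_gap u d" .
  qed
qed

end

context fixed_point
begin

definition payoff_at :: "real \<Rightarrow> real" where
  "payoff_at l = l * \<phi> l - \<psi> (\<phi> l)"

lemma integrable_\<phi>_lipschitz:
  assumes "\<And>x y. \<bar>h x - h y\<bar> \<le> \<bar>x - y\<bar>"
  shows "integrable \<mu> (\<lambda>l. h (\<phi> l))"
  by (rule limit_first_order(3)) (rule normal_integrable_lipschitz, rule assms)+

lemma integrable_l_\<phi>: "integrable \<mu> (\<lambda>l. l * \<phi> l)"
proof (rule Bochner_Integration.integrable_bound)
  show "integrable \<mu> (\<lambda>l. \<phi> l)" using integrable_\<phi>_lipschitz[of "\<lambda>x. x"] by simp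
  show "AE l in \<mu>. norm (l * \<phi> l) \<le> norm (\<phi> l)"
    using AE_unit_interval by eventually_elim (auto simp: abs_mult mult_left_le_one_le)
qed simp

lemma integrable_payoff_at: "integrable \<mu> payoff_at"
  unfolding payoff_at_def[abs_def]
  by (intro Bochner_Integration.integrable_diff integrable_l_\<phi> integrable_\<phi>_lipschitz Psi_lipschitz)

text \<open>The cycle of inequalities described at the beginning.  The finite game enters through the law \<open>\<pi>\<close>;
  the limit game enters through \<open>\<phi> L\<close>, evaluated on the same information \<open>L\<close>.\<close>

lemma integral_gap_bound:
  assumes n: "n \<ge> 1" and \<pi>: "\<pi> \<in> strategies1 \<mu> n" and F: "potential_equilibrium n \<pi> F c"
  shows "(\<integral>l. tangent_gap (payoff_at l) (\<psi> (\<phi> l) - F (\<phi> l)) \<partial>\<mu>) \<le>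
      K * \<bar>cube_mean n (\<lambda>w. \<psi> (S_sum n w))\<bar> +
      Y_mean * integral\<^sup>L std_normal_distribution F" (is "?gap \<le> K * \<bar>?a\<bar> + Y_mean * ?b")
    and "integrable \<mu> (\<lambda>l. tangent_gap (payoff_at l) (\<psi> (\<phi> l) - F (\<phi> l)))"
proof -
  interpret \<pi>: prob_space \<pi> using \<pi> by (simp add: strategies1_def)
  from F have lip: "\<And>x y. \<bar>F x - F y\<bar> \<le> \<bar>x - y\<bar>"
    and F0: "cube_mean n (\<lambda>w. F (S_sum n w)) = 0"
    and sub: "AE z in \<pi>. \<forall>x. snd z * x - F x \<le> snd z * S_sum n (fst z) - F (S_sum n (fst z))"
    and foc: "\<And>h. (\<integral>z. H' (snd z * S_sum n (fst z) - F (S_sum n (fst z))) * h (fst z) \<partial>\<pi>) =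
        c * cube_mean n h"
    by (auto simp: potential_equilibrium_def)
  note Fm[measurable] = normal_integrable_lipschitz(1)[of F, OF lip]
  have fin: "finite_measure \<mu>" by (rule finite_measure_axioms)
  let ?u = payoff_at and ?d = "\<lambda>l. \<psi> (\<phi> l) - F (\<phi> l)"
  have um[measurable]: "?u \<in> borel_measurable borel"
    unfolding payoff_at_def[abs_def] by measurable
  have id: "integrable \<mu> ?d"
    by (intro Bochner_Integration.integrable_diff integrable_\<phi>_lipschitz Psi_lipschitz lip)
  have iHud: "integrable \<mu> (\<lambda>l. H (?u l + ?d l))"
    by (intro integrable_compose fin Bochner_Integration.integrable_add integrable_payoff_at id)
  have iHu: "integrable \<mu> (\<lambda>l. H (?u l))"
    by (intro integrable_compose fin integrable_payoff_at)
  have iHua: "integrable \<mu> (\<lambda>l. H (?u l + ?a))"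
    by (intro integrable_compose fin Bochner_Integration.integrable_add integrable_payoff_at) simp
  have \<psi>N: "integrable std_normal_distribution \<psi>" "integrable std_normal_distribution F"
    by (intro normal_integrable_lipschitz(2) Psi_lipschitz lip)+
  have H'd: "(\<integral>l. H' (?u l) * ?d l \<partial>\<mu>) = - Y_mean * ?b" "integrable \<mu> (\<lambda>l. H' (?u l) * ?d l)"
    using limit_first_order(1,2)[of "\<lambda>s. \<psi> s - F s"] \<psi>N Psi_normal_centered
    by (auto simp: payoff_at_def)
  show "integrable \<mu> (\<lambda>l. tangent_gap (?u l) (?d l))"
    unfolding tangent_gap_def using iHud iHu H'd(2) by (intro Bochner_Integration.integrable_diff)
  have gap: "?gap = (\<integral>l. H (?u l + ?d l) \<partial>\<mu>) - (\<integral>l. H (?u l) \<partial>\<mu>) + Y_mean * ?b"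
    unfolding tangent_gap_def using iHud iHu H'd by simp
  define v where "v z = snd z * S_sum n (fst z) - F (S_sum n (fst z))" for z :: "(nat \<Rightarrow> real) \<times> real"
  define h where "h w = F (S_sum n w) - \<psi> (S_sum n w) + ?a" for w
  have cont: "integrable \<pi> (\<lambda>z. g (fst z) (snd z))" if "\<And>w. continuous_on UNIV (g w)"
    for g :: "_ \<Rightarrow> _ \<Rightarrow> real"
    using strategies1_integrable[OF \<pi> AE_unit_interval that] .
  have iv: "integrable \<pi> (\<lambda>z. H (v z))"
    unfolding v_def by (rule cont[of "\<lambda>w l. H (l * S_sum n w - F (S_sum n w))"])
      (intro continuous_intros continuous_on_compose2[OF continuous_H[of UNIV]], auto)
  have ivh: "integrable \<pi> (\<lambda>z. H (v z + h (fst z)))"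
    unfolding v_def by (rule cont[of "\<lambda>w l. H (l * S_sum n w - F (S_sum n w) + h w)"])
      (intro continuous_intros continuous_on_compose2[OF continuous_H[of UNIV]], auto)
  have iv': "integrable \<pi> (\<lambda>z. H' (v z) * h (fst z))"
    unfolding v_def by (rule cont[of "\<lambda>w l. H' (l * S_sum n w - F (S_sum n w)) * h w"])
      (intro continuous_intros continuous_on_compose2[OF continuous_H'[of UNIV]], auto)
  \<comment> \<open>the equilibrium law is the first player's best reply to \<open>F\<close>\<close>
  have "(\<integral>l. H (?u l + ?d l) \<partial>\<mu>) = (\<integral>z. H (?u (snd z) + ?d (snd z)) \<partial>\<pi>)"
    by (subst strategies1_integral_snd(1)[OF \<pi>]) auto
  also have "\<dots> \<le> (\<integral>z. H (v z) \<partial>\<pi>)"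
  proof (rule integral_mono_AE)
    show "integrable \<pi> (\<lambda>z. H (?u (snd z) + ?d (snd z)))"
      using iHud by (subst strategies1_integral_snd(2)[OF \<pi>]) auto
    show "AE z in \<pi>. H (?u (snd z) + ?d (snd z)) \<le> H (v z)"
      using sub by eventually_elim (auto intro!: H_mono simp: payoff_at_def v_def algebra_simps)
  qed (rule iv)
  \<comment> \<open>\<open>F\<close> is the second player's best reply; the recentred \<open>\<psi>\<close> is a competitor\<close>
  also have "(\<integral>z. H (v z) \<partial>\<pi>) \<le> (\<integral>z. H (v z + h (fst z)) \<partial>\<pi>)"
  proof -
    have "cube_mean n h = 0"
      by (simp add: h_def[abs_def] F0)
    then have "(\<integral>z. H' (v z) * h (fst z) \<partial>\<pi>) = 0"
      unfolding v_def foc by simp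
    then have "(\<integral>z. H (v z) \<partial>\<pi>) = (\<integral>z. H (v z) + H' (v z) * h (fst z) \<partial>\<pi>)"
      using iv iv' by simp
    also have "\<dots> \<le> (\<integral>z. H (v z + h (fst z)) \<partial>\<pi>)"
    proof (rule integral_mono[OF Bochner_Integration.integrable_add[OF iv iv'] ivh])
      show "H (v z) + H' (v z) * h (fst z) \<le> H (v z + h (fst z))" for z
        using above_tangent_le[of "v z" "v z + h (fst z)"] by simp
    qed
    finally show ?thesis .
  qed
  \<comment> \<open>\<open>\<phi> L\<close> is the first player's best reply to \<open>\<psi>\<close>\<close>
  also have "\<dots> \<le> (\<integral>z. H (?u (snd z) + ?a) \<partial>\<pi>)"
  proof (rule integral_mono_AE)
    show "integrable \<pi> (\<lambda>z. H (?u (snd z) + ?a))"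
      using iHua by (subst strategies1_integral_snd(2)[OF \<pi>]) auto
    show "AE z in \<pi>. H (v z + h (fst z)) \<le> H (?u (snd z) + ?a)"
      using strategies1_AE_snd[OF \<pi> AE_interior]
    proof eventually_elim
      fix z :: "(nat \<Rightarrow> real) \<times> real" assume "0 < snd z \<and> snd z < 1"
      then have "snd z * S_sum n (fst z) - \<psi> (S_sum n (fst z)) \<le> ?u (snd z)"
        using \<phi>_subgradient[of "snd z"] by (simp add: payoff_at_def)
      then show "H (v z + h (fst z)) \<le> H (?u (snd z) + ?a)"
        by (intro H_mono) (simp add: v_def h_def)
    qed
  qed (rule ivh)
  also have "\<dots> = (\<integral>l. H (?u l + ?a) \<partial>\<mu>)"
    by (subst strategies1_integral_snd(1)[OF \<pi>]) auto
  also have "\<dots> \<le> (\<integral>l. H (?u l) + K * \<bar>?a\<bar> \<partial>\<mu>)"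
  proof (rule integral_mono[OF iHua])
    show "integrable \<mu> (\<lambda>l. H (?u l) + K * \<bar>?a\<bar>)" using iHu by simp
    show "H (?u l + ?a) \<le> H (?u l) + K * \<bar>?a\<bar>" for l
      using H_lipschitz[of "?u l + ?a" "?u l"] by simp
  qed
  also have "\<dots> = (\<integral>l. H (?u l) \<partial>\<mu>) + K * \<bar>?a\<bar>"
    using iHu prob_space by simp
  finally show "?gap \<le> K * \<bar>?a\<bar> + Y_mean * ?b" by (simp add: gap)
qed

text \<open>Both potentials are 1-Lipschitz, so a discrepancy at \<open>x\<close> persists on an interval around \<open>x\<close>.  There the gap
  would be bounded below on a set of positive probability, whereas its mean tends to zero.\<close>

lemma potentials_converge:
  assumes lip: "\<And>n x y. \<bar>F n x - F n y\<bar> \<le> \<bar>x - y\<bar>"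
    and \<pi>: "\<And>n. n \<ge> 1 \<Longrightarrow> \<pi> n \<in> strategies1 \<mu> n"
    and F: "\<And>n. n \<ge> 1 \<Longrightarrow> potential_equilibrium n (\<pi> n) (F n) (c n)"
  shows "(\<lambda>n. F n x) \<longlonglongrightarrow> \<psi> x"
proof (rule LIMSEQ_I)
  fix e :: real assume "0 < e"
  define \<eta> where "\<eta> = e / 3"
  have "0 < \<eta>" using \<open>0 < e\<close> by (simp add: \<eta>_def)
  \<comment> \<open>bounds \<open>payoff_at l\<close> as long as \<open>\<phi> l\<close> is within \<open>\<eta>\<close> of \<open>x\<close>\<close>
  define R where "R = 2 * (\<bar>x\<bar> + \<eta>) + \<bar>\<psi> 0\<bar>"
  obtain \<kappa> where \<kappa>: "0 < \<kappa>" "\<And>u d. \<bar>u\<bar> \<le> R \<Longrightarrow> \<eta> \<le> \<bar>d\<bar> \<Longrightarrow> \<kappa> \<le> tangent_gap u d"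
    using tangent_gap_lower_bound[OF \<open>0 < \<eta>\<close>] by metis
  define A where "A = {l. x - \<eta> < \<phi> l \<and> \<phi> l < x + \<eta>}"
  have A[measurable]: "A \<in> sets borel" unfolding A_def by measurable
  have A_pos: "0 < measure \<mu> A" unfolding A_def by (rule phi_interval_pos) (use \<open>0 < \<eta>\<close> in simp)
  let ?a = "\<lambda>n. cube_mean n (\<lambda>w. \<psi> (S_sum n w))"
  let ?b = "\<lambda>n. integral\<^sup>L std_normal_distribution (F n)"
  have a: "?a \<longlonglongrightarrow> 0"
    using cube_normal_lipschitz[of "\<lambda>_. \<psi>", OF Psi_lipschitz] by (simp add: Psi_normal_centered)
  have "(\<lambda>n. - (cube_mean n (\<lambda>w. F n (S_sum n w)) - ?b n)) \<longlonglongrightarrow> - 0"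
    by (intro tendsto_minus cube_normal_lipschitz lip)
  moreover have "\<forall>\<^sub>F n in sequentially.
      - (cube_mean n (\<lambda>w. F n (S_sum n w)) - ?b n) = ?b n"
    using F by (auto simp: potential_equilibrium_def intro!: eventually_sequentiallyI[of 1])
  ultimately have "?b \<longlonglongrightarrow> - 0"
    by (rule Lim_transform_eventually)
  then have b: "?b \<longlonglongrightarrow> 0" by simp
  have "(\<lambda>n. K * \<bar>?a n\<bar> + Y_mean * ?b n) \<longlonglongrightarrow> K * \<bar>0\<bar> + Y_mean * 0"
    by (intro tendsto_intros a b)
  then have "\<forall>\<^sub>F n in sequentially. K * \<bar>?a n\<bar> + Y_mean * ?b n < \<kappa> * measure \<mu> A"
    by (rule order_tendstoD(2)) (use \<kappa> A_pos in simp)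
  then have "\<forall>\<^sub>F n in sequentially. norm (F n x - \<psi> x) < e"
    using eventually_ge_at_top[of 1]
  proof eventually_elim
    fix n :: nat assume small: "K * \<bar>?a n\<bar> + Y_mean * ?b n < \<kappa> * measure \<mu> A" and n: "1 \<le> n"
    let ?g = "\<lambda>l. tangent_gap (payoff_at l) (\<psi> (\<phi> l) - F n (\<phi> l))"
    note gap = integral_gap_bound[OF n \<pi>[OF n] F[OF n]]
    show "norm (F n x - \<psi> x) < e"
    proof (rule ccontr)
      assume "\<not> norm (F n x - \<psi> x) < e"
      then have far: "3 * \<eta> \<le> \<bar>\<psi> x - F n x\<bar>" by (simp add: \<eta>_def abs_minus_commute)
      have "\<kappa> * measure \<mu> A = (\<integral>l. \<kappa> * indicator A l \<partial>\<mu>)" by simp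
      also have "\<dots> \<le> (\<integral>l. ?g l \<partial>\<mu>)"
      proof (rule integral_mono_AE[OF _ gap(2)])
        show "integrable \<mu> (\<lambda>l. \<kappa> * indicator A l)" by (simp add: emeasure_eq_measure)
        show "AE l in \<mu>. \<kappa> * indicator A l \<le> ?g l"
          using AE_unit_interval
        proof eventually_elim
          fix l :: real assume l: "0 \<le> l \<and> l \<le> 1"
          show "\<kappa> * indicator A l \<le> ?g l"
          proof (cases "l \<in> A")
            case True
            then have near: "\<bar>\<phi> l - x\<bar> < \<eta>" by (auto simp: A_def)
            have "\<eta> \<le> \<bar>\<psi> (\<phi> l) - F n (\<phi> l)\<bar>"
              using far near lip[of n "\<phi> l" x] Psi_lipschitz[of std_normal_distribution "\<phi> l" x] by linarith
            moreover have "\<bar>payoff_at l\<bar> \<le> R"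
            proof -
              have "\<bar>payoff_at l\<bar> \<le> \<bar>l * \<phi> l\<bar> + \<bar>\<psi> (\<phi> l)\<bar>"
                unfolding payoff_at_def by (rule abs_triangle_ineq4)
              also have "\<bar>l * \<phi> l\<bar> \<le> \<bar>\<phi> l\<bar>" using l by (simp add: abs_mult mult_left_le_one_le)
              also have "\<bar>\<psi> (\<phi> l)\<bar> \<le> \<bar>\<psi> 0\<bar> + \<bar>\<phi> l\<bar>"
                using Psi_lipschitz[of std_normal_distribution "\<phi> l" 0] by linarith
              also have "\<bar>\<phi> l\<bar> \<le> \<bar>x\<bar> + \<eta>" using near by linarith
              finally show ?thesis unfolding R_def by simp
            qed
            ultimately show ?thesis using \<kappa>(2) True by simp
          qed (simp add: tangent_gap_nonneg)
        qed
      qed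
      also have "\<dots> \<le> K * \<bar>?a n\<bar> + Y_mean * ?b n" by (rule gap(1))
      finally show False using small by linarith
    qed
  qed
  then show "\<exists>no. \<forall>n\<ge>no. norm (F n x - \<psi> x) < e" by (simp add: eventually_sequentially)
qed

end

section \<open>Asymptotics of prices and of the historical law\<close>

text \<open>Half the spacing of the values of \<open>S_sum n\<close>; the maximum only keeps it positive at \<open>n = 0\<close>.\<close>

definition step :: "nat \<Rightarrow> real" where
  "step n = 1 / sqrt (real (max n 1))"

lemma step_pos: "0 < step n"
  by (simp add: step_def)

lemma step_tendsto: "step \<longlonglongrightarrow> 0"
proof -
  have "(\<lambda>n. 1 / sqrt (real n)) \<longlonglongrightarrow> 0" by real_asymp
  moreover have "\<forall>\<^sub>F n in sequentially. 1 / sqrt (real n) = step n"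
    by (intro eventually_sequentiallyI[of 1]) (simp add: step_def max_def)
  ultimately show ?thesis by (rule Lim_transform_eventually)
qed

definition left_slope :: "nat \<Rightarrow> (real \<Rightarrow> real) \<Rightarrow> real \<Rightarrow> real" where
  "left_slope n F x = (F x - F (x - step n)) / step n"

definition right_slope :: "nat \<Rightarrow> (real \<Rightarrow> real) \<Rightarrow> real \<Rightarrow> real" where
  "right_slope n F x = (F (x + step n) - F x) / step n"

definition mid_slope :: "nat \<Rightarrow> (real \<Rightarrow> real) \<Rightarrow> real \<Rightarrow> real" where
  "mid_slope n F x = (left_slope n F x + right_slope n F x) / 2"

lemma mid_slope_eq: "mid_slope n F x = (F (x + step n) - F (x - step n)) / (2 * step n)"
  using step_pos[of n] by (simp add: mid_slope_def left_slope_def right_slope_def field_simps)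

lemma mid_slope_bounded:
  assumes "\<And>x y. \<bar>F x - F y\<bar> \<le> \<bar>x - y\<bar>"
  shows "\<bar>mid_slope n F x\<bar> \<le> 1"
  using assms[of "x + step n" "x - step n"] step_pos[of n]
  by (simp add: mid_slope_eq abs_div field_simps)

lemma measurable_slopes [measurable]:
  assumes [measurable]: "F \<in> borel_measurable borel"
  shows "left_slope n F \<in> borel_measurable borel" "right_slope n F \<in> borel_measurable borel"
    "mid_slope n F \<in> borel_measurable borel"
proof -
  show [measurable]: "left_slope n F \<in> borel_measurable borel" "right_slope n F \<in> borel_measurable borel"
    unfolding left_slope_def right_slope_def by measurable
  show "mid_slope n F \<in> borel_measurable borel"
    unfolding mid_slope_def by measurable
qed

lemma subgradient_between_slopes:
  assumes sub: "\<And>y. l * y - F y \<le> l * x - F x"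
  shows "left_slope n F x \<le> l" "l \<le> right_slope n F x"
  using sub[of "x - step n"] sub[of "x + step n"] step_pos[of n]
  by (auto simp: left_slope_def right_slope_def field_simps)

text \<open>Switching the sign at time \<open>q\<close> moves the terminal sum by \<open>1 / sqrt n\<close> to either side of the sum of
  all other steps, so a price is the average of a centred difference quotient of the potential.\<close>

lemma price_eq_mean_slope:
  assumes rep: "represents n p X" and X: "\<And>w. w \<in> Omega n \<Longrightarrow> X w = F (S_sum n w)"
    and w: "w \<in> Omega n" and q: "q \<in> {1..n}"
  shows "price p q w = cube_mean n
    (\<lambda>w'. mid_slope n F (block_sum n {0<..q - 1} w + block_sum n {q<..n} w'))"
proof -
  have n: "n \<ge> 1" using q by simp
  then have st: "step n = 1 / sqrt n" by (simp add: step_def max_def)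
  let ?E = "cube_mean n"
  let ?r = "\<lambda>w'. fun_upd w' q (- w' q)"
  let ?a = "\<lambda>w'. block_sum n {0<..q - 1} w + block_sum n {q<..n} w'"
  have S: "S_sum n (splice_at q w w') = ?a w' + w' q * step n" for w'
  proof -
    have "{1..n} = {0<..q - 1} \<union> insert q {q<..n}" using q by auto
    then have "(\<Sum>i = 1..n. splice_at q w w' i) =
        (\<Sum>i\<in>{0<..q - 1} \<union> insert q {q<..n}. splice_at q w w' i)" by simp
    also have "\<dots> = (\<Sum>i\<in>{0<..q - 1}. splice_at q w w' i) + (\<Sum>i\<in>insert q {q<..n}. splice_at q w w' i)"
      using q by (intro sum.union_disjoint) auto
    also have "(\<Sum>i\<in>insert q {q<..n}. splice_at q w w' i) =
        splice_at q w w' q + (\<Sum>i\<in>{q<..n}. splice_at q w w' i)" by simp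
    also have "(\<Sum>i\<in>{0<..q - 1}. splice_at q w w' i) = (\<Sum>i\<in>{0<..q - 1}. w i)"
      using q by (intro sum.cong) (auto simp: splice_at_def)
    also have "(\<Sum>i\<in>{q<..n}. splice_at q w w' i) = (\<Sum>i\<in>{q<..n}. w' i)"
      by (intro sum.cong) (auto simp: splice_at_def)
    finally show ?thesis
      by (simp add: S_sum_def block_sum_def splice_at_def st add_divide_distrib)
  qed
  let ?u = "\<lambda>w'. w' q * F (?a w' + w' q * step n)"
  have "price p q w = sqrt n * ?E (\<lambda>w'. w' q * X (splice_at q w w'))"
    by (rule represents_imp_price_eq[OF rep w q])
  also have "?E (\<lambda>w'. w' q * X (splice_at q w w')) = ?E ?u"
    by (rule cube_expectation_cong) (simp add: X splice_at_Omega[OF w] S)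
  also have "?E ?u = (?E ?u + ?E (\<lambda>w'. ?u (?r w'))) / 2"
    using cube_expectation_flip[OF q, of ?u] by simp
  also have "\<dots> = ?E (\<lambda>w'. (?u w' + ?u (?r w')) / 2)" by simp
  also have "\<dots> = ?E (\<lambda>w'. step n * mid_slope n F (?a w'))"
  proof (rule cube_expectation_cong)
    fix w' assume "w' \<in> Omega n"
    from Omega_values[OF this q] have v: "w' q = 1 \<or> w' q = -1" .
    have "block_sum n {q<..n} (?r w') = block_sum n {q<..n} w'"
      by (auto simp: block_sum_def intro!: sum.cong arg_cong2[where f = "(/)"])
    then have "?u w' + ?u (?r w') = F (?a w' + step n) - F (?a w' - step n)"
      using v by auto
    then show "(?u w' + ?u (?r w')) / 2 = step n * mid_slope n F (?a w')"
      using step_pos[of n] by (simp add: mid_slope_eq)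
  qed
  finally show ?thesis using n by (simp add: st)
qed

lemma continuously_converges_compose:
  fixes f :: "nat \<Rightarrow> real \<Rightarrow> real" and g h :: "real \<Rightarrow> real"
  assumes "continuously_converges f g" "continuous_on UNIV h"
  shows "continuously_converges (\<lambda>n x. h (f n x)) (\<lambda>x. h (g x))"
  unfolding continuously_converges_def
proof (intro allI impI)
  fix x and l :: real assume "x \<longlonglongrightarrow> l"
  from continuous_on_tendsto_compose[OF assms(2) continuously_convergesD[OF assms(1) this]]
  show "(\<lambda>n. h (f n (x n))) \<longlonglongrightarrow> h (g l)" by simp
qed

locale equilibrium_sequence = fixed_point H H' \<epsilon> K C \<mu> \<nu>
  for H H' :: "real \<Rightarrow> real" and \<epsilon> K C :: real and \<mu> \<nu> :: "real measure" +
  fixes \<pi> :: "nat \<Rightarrow> ((nat \<Rightarrow> real) \<times> real) measure"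
    and F :: "nat \<Rightarrow> real \<Rightarrow> real" and c :: "nat \<Rightarrow> real"
  assumes strategy: "\<And>n. n \<ge> 1 \<Longrightarrow> \<pi> n \<in> strategies1 \<mu> n"
    and potential: "\<And>n. n \<ge> 1 \<Longrightarrow> potential_equilibrium n (\<pi> n) (F n) (c n)"
    and F_convex: "\<And>n. convex_on UNIV (F n)"
    and F_lipschitz: "\<And>n x y. \<bar>F n x - F n y\<bar> \<le> \<bar>x - y\<bar>"
begin

lemma F_converges: "(\<lambda>n. F n x) \<longlonglongrightarrow> \<psi> x"
  by (rule potentials_converge[OF F_lipschitz strategy potential])

lemma F_continuously_converges: "continuously_converges F \<psi>"
  by (rule lipschitz_pointwise_imp_continuously_converges[OF F_lipschitz F_converges])

lemma measurable_F [measurable]: "F n \<in> borel_measurable borel"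
  by (rule normal_integrable_lipschitz(1)[OF F_lipschitz])

lemma isCont_\<gamma>: "isCont \<gamma> x"
  using \<gamma>_continuous by (simp add: continuous_on_eq_continuous_at)

lemma slopes_continuously_converge:
  "continuously_converges (\<lambda>n. right_slope n (F n)) \<gamma>"
  "continuously_converges (\<lambda>n. left_slope n (F n)) \<gamma>"
  "continuously_converges (\<lambda>n. mid_slope n (F n)) \<gamma>"
proof -
  have r: "(\<lambda>n. right_slope n (F n) (x n)) \<longlonglongrightarrow> \<gamma> l" if "x \<longlonglongrightarrow> l" for x l
    unfolding right_slope_def
    by (rule convex_slopes_converge[OF F_convex F_converges \<psi>_deriv isCont_\<gamma> that step_tendsto step_pos])
  have l: "(\<lambda>n. left_slope n (F n) (x n)) \<longlonglongrightarrow> \<gamma> l" if "x \<longlonglongrightarrow> l" for x l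
  proof -
    have "(\<lambda>n. x n - step n) \<longlonglongrightarrow> l"
      using tendsto_diff[OF that step_tendsto] by simp
    from r[OF this] show ?thesis by (simp add: right_slope_def left_slope_def)
  qed
  have m: "(\<lambda>n. mid_slope n (F n) (x n)) \<longlonglongrightarrow> \<gamma> l" if "x \<longlonglongrightarrow> l" for x l
    unfolding mid_slope_def using tendsto_divide[OF tendsto_add[OF l[OF that] r[OF that]] tendsto_const[of 2]]
    by simp
  show "continuously_converges (\<lambda>n. right_slope n (F n)) \<gamma>"
  "continuously_converges (\<lambda>n. left_slope n (F n)) \<gamma>"
  "continuously_converges (\<lambda>n. mid_slope n (F n)) \<gamma>"
    using r l m by (auto simp: continuously_converges_def)
qed

definition marginal :: "nat \<Rightarrow> real \<Rightarrow> real" where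
  "marginal n x = H' (mid_slope n (F n) x * x - F n x)"

definition limit_marginal :: "real \<Rightarrow> real" where
  "limit_marginal x = H' (\<gamma> x * x - \<psi> x)"

lemma measurable_marginal [measurable]:
  "marginal n \<in> borel_measurable borel" "limit_marginal \<in> borel_measurable borel"
  unfolding marginal_def[abs_def] limit_marginal_def[abs_def] by measurable

lemma marginal_continuously_converges: "continuously_converges marginal limit_marginal"
  unfolding marginal_def[abs_def] limit_marginal_def[abs_def]
proof (rule continuously_converges_compose[OF _ continuous_H'])
  show "continuously_converges (\<lambda>n x. mid_slope n (F n) x * x - F n x) (\<lambda>x. \<gamma> x * x - \<psi> x)"
    unfolding continuously_converges_def
    by (intro allI impI tendsto_diff tendsto_mult continuously_convergesD[OF slopes_continuously_converge(3)]
        continuously_convergesD[OF F_continuously_converges])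
qed

lemma marginal_bounds: "\<epsilon> \<le> marginal n x" "0 < marginal n x" "\<bar>1 / marginal n x\<bar> \<le> 1 / \<epsilon>"
  using lower deriv_pos eps_pos by (auto simp: marginal_def abs_of_pos frac_le)

lemma limit_marginal_bounds: "\<epsilon> \<le> limit_marginal x" "0 < limit_marginal x" "limit_marginal x \<le> K"
  using lower upper deriv_pos by (auto simp: limit_marginal_def)

text \<open>Marginal utilities lie between \<open>0\<close> and \<open>K\<close>, so truncating at \<open>K\<close> loses nothing, and it keeps
  the error bounded although \<open>x\<close> is not.\<close>

definition marginal_error :: "nat \<Rightarrow> real \<Rightarrow> real" where
  "marginal_error n x = min K (C * ((right_slope n (F n) x - left_slope n (F n) x) * \<bar>x\<bar>))"

lemma marginal_error_tendsto:
  "(\<lambda>n. cube_mean n (\<lambda>w. \<bar>marginal_error n (S_sum n w)\<bar>)) \<longlonglongrightarrow> 0"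
proof -
  have cc: "continuously_converges marginal_error (\<lambda>x. min K (C * ((\<gamma> x - \<gamma> x) * \<bar>x\<bar>)))"
    unfolding continuously_converges_def marginal_error_def
    by (intro allI impI tendsto_intros continuously_convergesD[OF slopes_continuously_converge(1)]
      continuously_convergesD[OF slopes_continuously_converge(2)])
  then have "continuously_converges (\<lambda>n x. \<bar>marginal_error n x\<bar>) (\<lambda>x. \<bar>min K 0\<bar>)"
    by (drule_tac continuously_converges_compose[where h = abs]) (auto intro: continuous_intros)
  then have cc: "continuously_converges (\<lambda>n x. \<bar>marginal_error n x\<bar>) (\<lambda>x. 0)"
    using K_pos by simp
  have m: "(\<lambda>x. \<bar>marginal_error n x\<bar>) \<in> borel_measurable borel" for n
    unfolding marginal_error_def by measurable
  have "\<bar>\<bar>marginal_error n x\<bar>\<bar> \<le> K" for n x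
  proof -
    have "left_slope n (F n) x \<le> right_slope n (F n) x"
      using convex_chord_slope_mono[OF F_convex, of "x - step n" x x "x + step n" n] step_pos[of n]
      by (simp add: left_slope_def right_slope_def)
    then have "0 \<le> C * ((right_slope n (F n) x - left_slope n (F n) x) * \<bar>x\<bar>)"
      using C_nonneg by simp
    then show ?thesis using K_pos by (simp add: marginal_error_def)
  qed
  from weak_conv_integral_continuously_converges[OF real_distribution_cube real_dist_normal_dist
      S_sum_central_limit m this cc]
  have "(\<lambda>n. integral\<^sup>L (cube_law n (S_sum n)) (\<lambda>x. \<bar>marginal_error n x\<bar>)) \<longlonglongrightarrow> 0"
    by simp
  moreover have "integral\<^sup>L (cube_law n (S_sum n)) (\<lambda>x. \<bar>marginal_error n x\<bar>) =
      cube_mean n (\<lambda>w. \<bar>marginal_error n (S_sum n w)\<bar>)" for n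
    by (subst integral_distr) (auto intro: m)
  ultimately show ?thesis by simp
qed

text \<open>Given the path, the first player's information is confined between the two slopes at the
  terminal sum.  The gap between these shrinks, hence the marginal utility is asymptotically a function of
  the terminal sum alone, and the first order condition turns the equilibrium law into a density with respect
  to the uniform law.\<close>

lemma equilibrium_law_approx:
  assumes G: "\<And>n w. \<bar>G n w\<bar> \<le> (b :: real)"
  shows "(\<lambda>n. (\<integral>z. G n (fst z) \<partial>\<pi> n) -
    c n * cube_mean n (\<lambda>w. G n w / marginal n (S_sum n w))) \<longlonglongrightarrow> 0"
proof -
  let ?err = "\<lambda>n. cube_mean n (\<lambda>w. \<bar>marginal_error n (S_sum n w)\<bar>)"
  have b0: "0 \<le> b" using G[of 0 undefined] by linarith
  have "norm ((\<integral>z. G n (fst z) \<partial>\<pi> n) -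
      c n * cube_mean n (\<lambda>w. G n w / marginal n (S_sum n w)))
    \<le> b / \<epsilon> / \<epsilon> * K * ?err n" if n: "n \<ge> 1" for n
  proof -
    note \<pi> = strategy[OF n]
    interpret \<pi>: prob_space "\<pi> n" using \<pi> by (simp add: strategies1_def)
    have sub: "AE z in \<pi> n. \<forall>x. snd z * x - F n x \<le> snd z * S_sum n (fst z) - F n (S_sum n (fst z))"
      and foc: "\<And>h. (\<integral>z. H' (snd z * S_sum n (fst z) - F n (S_sum n (fst z))) * h (fst z) \<partial>\<pi> n) =
        c n * cube_mean n h"
      using potential[OF n] by (auto simp: potential_equilibrium_def)
    let ?v = "\<lambda>z. H' (snd z * S_sum n (fst z) - F n (S_sum n (fst z)))"
    let ?m = "\<lambda>w. marginal n (S_sum n w)"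
    let ?e = "\<lambda>w. \<bar>marginal_error n (S_sum n w)\<bar>"
    have int: "integrable (\<pi> n) (\<lambda>z. ?v z * h (fst z))" "integrable (\<pi> n) (\<lambda>z. h (fst z))"
      for h :: "_ \<Rightarrow> real"
    proof -
      show "integrable (\<pi> n) (\<lambda>z. ?v z * h (fst z))"
        by (rule strategies1_integrable[OF \<pi> AE_unit_interval,
            of "\<lambda>w l. H' (l * S_sum n w - F n (S_sum n w)) * h w"])
          (intro continuous_intros continuous_on_compose2[OF continuous_H'[of UNIV]], auto)
      show "integrable (\<pi> n) (\<lambda>z. h (fst z))"
        by (rule strategies1_integrable[OF \<pi> AE_unit_interval, of "\<lambda>w l. h w"]) auto
    qed
    have close: "AE z in \<pi> n. \<bar>?m (fst z) - ?v z\<bar> \<le> ?e (fst z)"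
      using sub
    proof eventually_elim
      fix z assume s: "\<forall>x. snd z * x - F n x \<le> snd z * S_sum n (fst z) - F n (S_sum n (fst z))"
      let ?s = "S_sum n (fst z)"
      have ls: "left_slope n (F n) ?s \<le> snd z" "snd z \<le> right_slope n (F n) ?s"
        by (rule subgradient_between_slopes, use s in blast)+
      then have "\<bar>mid_slope n (F n) ?s - snd z\<bar> \<le> right_slope n (F n) ?s - left_slope n (F n) ?s"
        by (simp add: abs_le_iff mid_slope_def field_simps)
      then have "\<bar>(mid_slope n (F n) ?s - snd z) * ?s\<bar> \<le> (right_slope n (F n) ?s - left_slope n (F n) ?s) * \<bar>?s\<bar>"
        unfolding abs_mult by (rule mult_right_mono) simp
      moreover have "\<bar>?m (fst z) - ?v z\<bar> \<le> C * \<bar>(mid_slope n (F n) ?s - snd z) * ?s\<bar>"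
        using deriv_lipschitz[of "mid_slope n (F n) ?s * ?s - F n ?s" "snd z * ?s - F n ?s"]
        by (simp add: marginal_def algebra_simps)
      ultimately have "\<bar>?m (fst z) - ?v z\<bar> \<le> C * ((right_slope n (F n) ?s - left_slope n (F n) ?s) * \<bar>?s\<bar>)"
        using C_nonneg by (meson mult_left_mono order_trans)
      moreover have "\<bar>?m (fst z) - ?v z\<bar> \<le> K"
        unfolding marginal_def
        using upper[of "mid_slope n (F n) ?s * ?s - F n ?s"] upper[of "snd z * ?s - F n ?s"]
          deriv_pos[of "mid_slope n (F n) ?s * ?s - F n ?s"] deriv_pos[of "snd z * ?s - F n ?s"]
        by linarith
      ultimately show "\<bar>?m (fst z) - ?v z\<bar> \<le> ?e (fst z)" unfolding marginal_error_def by linarith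
    qed
    have quotient: "g - v * (g / m) = g * (1 / m) * (m - v)" if "m \<noteq> 0" for g v m :: real
      using that by (simp add: field_simps)
    have cK: "c n \<le> K"
    proof -
      have "c n = (\<integral>z. ?v z * 1 \<partial>\<pi> n)" using foc[of "\<lambda>_. 1"] by simp
      also have "\<dots> \<le> K"
        by (rule \<pi>.integral_le_const[OF int(1)]) (simp add: upper)
      finally show ?thesis .
    qed
    have "(\<integral>z. G n (fst z) - ?v z * (G n (fst z) / ?m (fst z)) \<partial>\<pi> n) =
        (\<integral>z. G n (fst z) \<partial>\<pi> n) - c n * cube_mean n (\<lambda>w. G n w / ?m w)"
      unfolding foc[of "\<lambda>w. G n w / ?m w", symmetric]
      by (rule Bochner_Integration.integral_diff[OF int(2)[of "G n"] int(1)[of "\<lambda>w. G n w / ?m w"]])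
    then have "norm ((\<integral>z. G n (fst z) \<partial>\<pi> n) - c n * cube_mean n (\<lambda>w. G n w / ?m w))
        \<le> (\<integral>z. norm (G n (fst z) - ?v z * (G n (fst z) / ?m (fst z))) \<partial>\<pi> n)"
      using integral_norm_bound[of "\<pi> n" "\<lambda>z. G n (fst z) - ?v z * (G n (fst z) / ?m (fst z))"]
      by (simp only:)
    also have "\<dots> \<le> (\<integral>z. ?v z * (b / \<epsilon> / \<epsilon> * ?e (fst z)) \<partial>\<pi> n)"
    proof (rule integral_mono_AE)
      show "integrable (\<pi> n) (\<lambda>z. norm (G n (fst z) - ?v z * (G n (fst z) / ?m (fst z))))"
        by (rule integrable_norm[OF Bochner_Integration.integrable_diff[OF int(2)[of "G n"] int(1)[of "\<lambda>w. G n w / ?m w"]]])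
      show "integrable (\<pi> n) (\<lambda>z. ?v z * (b / \<epsilon> / \<epsilon> * ?e (fst z)))"
        by (rule int(1)[of "\<lambda>w. b / \<epsilon> / \<epsilon> * ?e w"])
      show "AE z in \<pi> n. norm (G n (fst z) - ?v z * (G n (fst z) / ?m (fst z))) \<le> ?v z * (b / \<epsilon> / \<epsilon> * ?e (fst z))"
        using close
      proof eventually_elim
        fix z assume cl: "\<bar>?m (fst z) - ?v z\<bar> \<le> ?e (fst z)"
        let ?g = "G n (fst z)"
        have "?g - ?v z * (?g / ?m (fst z)) = ?g * (1 / ?m (fst z)) * (?m (fst z) - ?v z)"
          using marginal_bounds(2)[of n "S_sum n (fst z)"] by (intro quotient) simp
        then have "norm (?g - ?v z * (?g / ?m (fst z))) = \<bar>?g\<bar> * \<bar>1 / ?m (fst z)\<bar> * \<bar>?m (fst z) - ?v z\<bar>"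
          by (simp only: abs_mult real_norm_def)
        also have "\<dots> \<le> b * (1 / \<epsilon>) * ?e (fst z)"
          using cl marginal_bounds(3) G b0 eps_pos by (intro mult_mono mult_nonneg_nonneg) auto
        also have "\<dots> \<le> ?v z / \<epsilon> * (b * (1 / \<epsilon>) * ?e (fst z))"
        proof -
          have "1 \<le> ?v z / \<epsilon>" using lower eps_pos by simp
          then have "1 * (b * (1 / \<epsilon>) * ?e (fst z)) \<le> ?v z / \<epsilon> * (b * (1 / \<epsilon>) * ?e (fst z))"
            using b0 eps_pos by (intro mult_right_mono) auto
          then show ?thesis by simp
        qed
        also have "\<dots> = ?v z * (b / \<epsilon> / \<epsilon> * ?e (fst z))" by simp
        finally show "norm (?g - ?v z * (?g / ?m (fst z))) \<le> ?v z * (b / \<epsilon> / \<epsilon> * ?e (fst z))" .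
      qed
    qed
    also have "\<dots> = c n * (b / \<epsilon> / \<epsilon> * ?err n)"
      by (subst foc[of "\<lambda>w. b / \<epsilon> / \<epsilon> * ?e w"], subst integral_mult_right_zero, rule refl)
    also have "\<dots> \<le> K * (b / \<epsilon> / \<epsilon> * ?err n)"
      using cK b0 eps_pos by (intro mult_right_mono mult_nonneg_nonneg) (auto intro!: integral_nonneg_AE)
    finally show ?thesis by (simp add: mult_ac)
  qed
  then have "\<forall>\<^sub>F n in sequentially. norm ((\<integral>z. G n (fst z) \<partial>\<pi> n) -
      c n * cube_mean n (\<lambda>w. G n w / marginal n (S_sum n w)))
    \<le> b / \<epsilon> / \<epsilon> * K * ?err n" by (auto intro: eventually_sequentiallyI[of 1])
  moreover have "(\<lambda>n. b / \<epsilon> / \<epsilon> * K * ?err n) \<longlonglongrightarrow> 0"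
    by (intro tendsto_mult_right_zero marginal_error_tendsto)
  ultimately show ?thesis by (rule Lim_null_comparison)
qed

definition normalizer :: real where
  "normalizer = (\<integral>x. 1 / limit_marginal x \<partial>std_normal_distribution)"

lemma normalizer_pos: "0 < normalizer"
proof -
  interpret N: real_distribution std_normal_distribution by (rule real_dist_normal_dist)
  have "1 / K \<le> normalizer"
    unfolding normalizer_def
  proof (rule N.integral_ge_const)
    show "integrable std_normal_distribution (\<lambda>x. 1 / limit_marginal x)"
      using limit_marginal_bounds(1,2) eps_pos
      by (intro N.integrable_const_bound[where B = "1 / \<epsilon>"]) (auto simp: abs_of_pos frac_le)
    show "AE x in std_normal_distribution. 1 / K \<le> 1 / limit_marginal x"
      using limit_marginal_bounds K_pos by (intro AE_I2) (simp add: frac_le)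
  qed
  then show ?thesis using K_pos by (smt (verit) zero_less_divide_1_iff)
qed

text \<open>Total mass one of the equilibrium law determines the multipliers.\<close>

lemma c_tendsto: "c \<longlonglongrightarrow> 1 / normalizer"
proof -
  let ?E = "\<lambda>n. cube_mean n (\<lambda>w. 1 / marginal n (S_sum n w))"
  have nz: "limit_marginal x \<noteq> 0" for x using limit_marginal_bounds(2)[of x] by simp
  have cc: "continuously_converges (\<lambda>n x. 1 / marginal n x) (\<lambda>x. 1 / limit_marginal x)"
    unfolding continuously_converges_def
    using nz
    by (intro allI impI tendsto_divide tendsto_const continuously_convergesD[OF marginal_continuously_converges])
       simp
  have m: "(\<lambda>x. 1 / marginal n x) \<in> borel_measurable borel" for n by measurable
  from weak_conv_integral_continuously_converges[OF real_distribution_cube real_dist_normal_dist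
      S_sum_central_limit m marginal_bounds(3) cc]
  have "(\<lambda>n. integral\<^sup>L (cube_law n (S_sum n)) (\<lambda>x. 1 / marginal n x)) \<longlonglongrightarrow> normalizer"
    by (simp add: normalizer_def)
  moreover have "integral\<^sup>L (cube_law n (S_sum n)) (\<lambda>x. 1 / marginal n x) = ?E n" for n
    by (subst integral_distr) auto
  ultimately have E: "?E \<longlonglongrightarrow> normalizer" by simp
  have "(\<lambda>n. (\<integral>z. 1 \<partial>\<pi> n) - c n * ?E n) \<longlonglongrightarrow> 0"
    by (rule equilibrium_law_approx[of "\<lambda>_ _. 1" 1]) simp
  moreover have "\<forall>\<^sub>F n in sequentially. (\<integral>z. 1 \<partial>\<pi> n) - c n * ?E n = 1 - c n * ?E n"
    using strategy by (intro eventually_sequentiallyI[of 1])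
      (simp add: strategies1_def prob_space.prob_space)
  ultimately have "(\<lambda>n. 1 - c n * ?E n) \<longlonglongrightarrow> 0" by (rule Lim_transform_eventually)
  from tendsto_diff[OF tendsto_const[of 1] this] have "(\<lambda>n. c n * ?E n) \<longlonglongrightarrow> 1" by simp
  from tendsto_divide[OF this E] normalizer_pos have "(\<lambda>n. c n * ?E n / ?E n) \<longlonglongrightarrow> 1 / normalizer" by simp
  moreover have "\<forall>\<^sub>F n in sequentially. c n * ?E n / ?E n = c n"
    using order_tendstoD(1)[OF E normalizer_pos] by eventually_elim simp
  ultimately show ?thesis by (rule Lim_transform_eventually)
qed

lemma equilibrium_expectation_tendsto:
  assumes "\<And>n w. \<bar>G n w\<bar> \<le> (b :: real)"
    and "(\<lambda>n. cube_mean n (\<lambda>w. G n w / marginal n (S_sum n w))) \<longlonglongrightarrow> L"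
  shows "(\<lambda>n. \<integral>z. G n (fst z) \<partial>\<pi> n) \<longlonglongrightarrow> L / normalizer"
  using tendsto_add[OF equilibrium_law_approx[of G b, OF assms(1)] tendsto_mult[OF c_tendsto assms(2)]]
  by simp

definition price_kernel :: "real \<Rightarrow> real \<Rightarrow> real" where
  "price_kernel t x = (\<integral>y. \<gamma> (x + y) \<partial>gauss (1 - t))"

definition mean_slope :: "nat \<Rightarrow> nat \<Rightarrow> real \<Rightarrow> real" where
  "mean_slope n q x = cube_mean n (\<lambda>w. mid_slope n (F n) (x + block_sum n {q<..n} w))"

lemma measurable_mean_slope [measurable]: "mean_slope n q \<in> borel_measurable borel"
  unfolding mean_slope_def[abs_def] cube_expectation by measurable

lemma mean_slope_continuously_converges:
  assumes q: "(\<lambda>n. real (q n) / real n) \<longlonglongrightarrow> t" and qn: "\<And>n. q n \<le> n"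
  shows "continuously_converges (\<lambda>n. mean_slope n (q n)) (price_kernel t)"
  unfolding continuously_converges_def
proof (intro allI impI)
  fix x l assume x: "x \<longlonglongrightarrow> (l :: real)"
  have "(\<lambda>n. 1 - real (q n) / real n) \<longlonglongrightarrow> 1 - t" by (intro tendsto_intros q)
  moreover have "\<forall>\<^sub>F n in sequentially. 1 - real (q n) / real n = card {q n<..n} / n"
    using qn by (intro eventually_sequentiallyI[of 1]) (simp add: of_nat_diff diff_divide_distrib)
  ultimately have card: "(\<lambda>n. card {q n<..n} / n) \<longlonglongrightarrow> 1 - t" by (rule Lim_transform_eventually)
  have w: "weak_conv_m (\<lambda>n. cube_law n (block_sum n {q n<..n})) (gauss (1 - t))"
    by (rule block_sum_central_limit[OF _ card]) auto
  have cc: "continuously_converges (\<lambda>n y. mid_slope n (F n) (x n + y)) (\<lambda>y. \<gamma> (l + y))"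
    unfolding continuously_converges_def
    by (intro allI impI continuously_convergesD[OF slopes_continuously_converge(3)] tendsto_add x)
  have "(\<lambda>n. integral\<^sup>L (cube_law n (block_sum n {q n<..n}))
      (\<lambda>y. mid_slope n (F n) (x n + y))) \<longlonglongrightarrow> integral\<^sup>L (gauss (1 - t)) (\<lambda>y. \<gamma> (l + y))"
    by (rule weak_conv_integral_continuously_converges[OF real_distribution_cube real_distribution_gauss w _ _ cc, where C = 1])
       (auto intro: mid_slope_bounded F_lipschitz)
  moreover have "integral\<^sup>L (cube_law n (block_sum n {q n<..n}))
      (\<lambda>y. mid_slope n (F n) (x n + y)) = mean_slope n (q n) (x n)" for n
    by (subst integral_distr) (auto simp: mean_slope_def)
  ultimately show "(\<lambda>n. mean_slope n (q n) (x n)) \<longlonglongrightarrow> price_kernel t l"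
    by (simp add: price_kernel_def)
qed

end

section \<open>Continuous functions of finitely many coordinates\<close>

lemma continuous_powertop_sequentially:
  assumes g: "continuous_map (powertop_real J) euclideanreal g"
    and x: "\<And>n. x n \<in> extensional J" and l: "l \<in> extensional J"
    and lim: "\<And>t. t \<in> J \<Longrightarrow> (\<lambda>n. x n t) \<longlonglongrightarrow> l t"
  shows "(\<lambda>n. g (x n)) \<longlonglongrightarrow> g l"
proof -
  have "limitin (powertop_real J) x l sequentially"
    using x l lim by (auto simp: limitin_componentwise PiE_def)
  from continuous_map_limit[OF g this] show ?thesis by (simp add: o_def)
qed

text \<open>Rounding each coordinate to a grid leaves countably many arguments, on which every function is
  measurable; refining the grid recovers the function by continuity.\<close>

lemma continuous_powertop_measurable:
  assumes J: "finite J" and g: "continuous_map (powertop_real J) euclideanreal g"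
  shows "g \<in> borel_measurable (Pi\<^sub>M J (\<lambda>_. borel))"
proof (rule borel_measurable_LIMSEQ_real)
  define r where "r n x = (\<lambda>t\<in>J. real_of_int \<lfloor>real (Suc n) * x t\<rfloor> / real (Suc n))"
    for n and x :: "'a \<Rightarrow> real"
  show "(\<lambda>n. g (r n x)) \<longlonglongrightarrow> g x" if "x \<in> space (Pi\<^sub>M J (\<lambda>_. borel))" for x
  proof (rule continuous_powertop_sequentially[OF g])
    show "x \<in> extensional J" using that by (simp add: space_PiM PiE_def)
    fix t assume "t \<in> J"
    have "(\<lambda>n. real_of_int \<lfloor>real (Suc n) * x t\<rfloor> / real (Suc n)) \<longlonglongrightarrow> x t"
      by (rule LIMSEQ_Suc[where f = "\<lambda>n. real_of_int \<lfloor>real n * x t\<rfloor> / real n"]) real_asymp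
    then show "(\<lambda>n. r n x t) \<longlonglongrightarrow> x t" using \<open>t \<in> J\<close> by (simp add: r_def)
  qed (simp add: r_def)
  fix n
  have "(\<lambda>x. \<lambda>t\<in>J. \<lfloor>real (Suc n) * x t\<rfloor>) \<in> measurable (Pi\<^sub>M J (\<lambda>_. borel)) (Pi\<^sub>M J (\<lambda>_. count_space UNIV))"
    by measurable
  also have "Pi\<^sub>M J (\<lambda>_. count_space UNIV :: int measure) = count_space (Pi\<^sub>E J (\<lambda>_. UNIV))"
    using J by (rule count_space_PiM_finite) auto
  finally have "(\<lambda>x. (\<lambda>i. g (\<lambda>t\<in>J. real_of_int (i t) / real (Suc n))) (\<lambda>t\<in>J. \<lfloor>real (Suc n) * x t\<rfloor>))
      \<in> borel_measurable (Pi\<^sub>M J (\<lambda>_. borel))"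
    by (rule measurable_compose) simp
  moreover have "(\<lambda>t\<in>J. real_of_int ((\<lambda>t\<in>J. \<lfloor>real (Suc n) * x t\<rfloor>) t) / real (Suc n)) = r n x" for x
    by (auto simp: r_def restrict_def)
  ultimately show "(\<lambda>x. g (r n x)) \<in> borel_measurable (Pi\<^sub>M J (\<lambda>_. borel))" by simp
qed

section \<open>Increments of Brownian motion\<close>

lemma (in prob_space) distr_normal_eq_gauss:
  assumes "0 < \<sigma>" and X: "distributed M lborel X (normal_density 0 \<sigma>)"
  shows "distr M borel X = gauss (\<sigma>\<^sup>2)"
proof -
  have [measurable]: "X \<in> borel_measurable M" using X by (simp add: distributed_def)
  have "distributed M lborel (\<lambda>x. (X x - 0) / \<sigma>) std_normal_density"
    using X unfolding normal_standard_normal_convert[OF assms(1)] .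
  then have "distr M lborel (\<lambda>x. (X x - 0) / \<sigma>) = std_normal_distribution"
    by (simp add: distributed_def)
  then have "gauss (\<sigma>\<^sup>2) = distr (distr M lborel (\<lambda>x. (X x - 0) / \<sigma>)) borel (\<lambda>z. sqrt (\<sigma>\<^sup>2) * z)"
    by (simp add: gauss_def)
  also have "\<dots> = distr M borel X"
    using assms(1) by (subst distr_distr) (auto simp: comp_def)
  finally show ?thesis ..
qed

context standard_brownian_motion
begin

lemma increment_measurable:
  "s \<in> {0..1} \<Longrightarrow> t \<in> {0..1} \<Longrightarrow> (\<lambda>w. B t w - B s w) \<in> borel_measurable M"
  using random_variable[of s] random_variable[of t] by measurable

lemma increment_law:
  assumes "0 \<le> s" "s \<le> t" "t \<le> 1"
  shows "distr M borel (\<lambda>w. B t w - B s w) = gauss (t - s)"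
proof (cases "s = t")
  case True
  interpret N: real_distribution std_normal_distribution by (rule real_dist_normal_dist)
  have "distr M borel (\<lambda>_. 0 :: real) = distr std_normal_distribution borel (\<lambda>_. 0)"
    by (simp add: distr_const N.distr_const)
  then show ?thesis using True by (simp add: gauss_def)
next
  case False
  then have "distr M borel (\<lambda>w. B t w - B s w) = gauss ((sqrt (t - s))\<^sup>2)"
    using assms by (intro distr_normal_eq_gauss normal_increments) auto
  then show ?thesis using assms by simp
qed

lemma increments_joint_law:
  fixes \<tau> :: "nat \<Rightarrow> real"
  assumes k: "0 < k" and \<tau>: "mono_on {..k} \<tau>" "\<tau> ` {..k} \<subseteq> {0..1}"
  shows "distr M (Pi\<^sub>M {..<k} (\<lambda>_. borel)) (\<lambda>w. \<lambda>i\<in>{..<k}. B (\<tau> (Suc i)) w - B (\<tau> i) w) =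
    Pi\<^sub>M {..<k} (\<lambda>i. gauss (\<tau> (Suc i) - \<tau> i))"
proof -
  have range: "\<tau> i \<in> {0..1}" if "i \<le> k" for i using \<tau>(2) that by auto
  have "distr M (Pi\<^sub>M {..<k} (\<lambda>_. borel)) (\<lambda>w. \<lambda>i\<in>{..<k}. B (\<tau> (Suc i)) w - B (\<tau> i) w) =
      Pi\<^sub>M {..<k} (\<lambda>i. distr M borel (\<lambda>w. B (\<tau> (Suc i)) w - B (\<tau> i) w))"
    using indep_increments[OF \<tau>] k
    by (subst (asm) indep_vars_iff_distr_eq_PiM') (auto intro!: increment_measurable range)
  also have "\<dots> = Pi\<^sub>M {..<k} (\<lambda>i. gauss (\<tau> (Suc i) - \<tau> i))"
  proof (rule PiM_cong[OF refl])
    fix i assume "i \<in> {..<k}"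
    then show "distr M borel (\<lambda>w. B (\<tau> (Suc i)) w - B (\<tau> i) w) = gauss (\<tau> (Suc i) - \<tau> i)"
      using range[of i] range[of "Suc i"] mono_onD[OF \<tau>(1), of i "Suc i"] by (intro increment_law) auto
  qed
  finally show ?thesis .
qed

lemma terminal_law: "distr M borel (B 1) = std_normal_distribution"
proof -
  have "distr M borel (B 1) = distr M borel (\<lambda>w. B 1 w - B 0 w)"
    using random_variable[of 1] increment_measurable[of 0 1] start
    by (intro distr_cong_AE) (auto elim: eventually_mono)
  then show ?thesis using increment_law[of 0 1] by (simp add: gauss_1)
qed

lemma subalgebra_at:
  assumes "t \<in> {0..1}"
  shows "finite_measure_subalgebra M (vimage_algebra (space M) (B t) borel)"
proof -
  have "subalgebra M (vimage_algebra (space M) (B t) borel)"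
    using random_variable[OF assms]
    unfolding subalgebra_def by (auto simp: sets_vimage_algebra2 intro: measurable_sets)
  then show ?thesis
    by (intro finite_measure_subalgebra.intro finite_measure_subalgebra_axioms.intro) unfold_locales
qed

text \<open>By independence of increments \<open>B 1\<close> is \<open>B t\<close> plus an independent normal variable of variance \<open>1 - t\<close>,
  which Fubini's theorem integrates out.\<close>

lemma markov_conditional_expectation:
  fixes f :: "real \<Rightarrow> real"
  assumes t: "t \<in> {0..1}" and f[measurable]: "f \<in> borel_measurable borel" and b: "\<And>x. \<bar>f x\<bar> \<le> b"
  shows "AE w in M. cond_exp_given M (B t) (\<lambda>w. f (B 1 w)) w = (\<integral>y. f (B t w + y) \<partial>gauss (1 - t))"
proof -
  interpret S: finite_measure_subalgebra M "vimage_algebra (space M) (B t) borel"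
    by (rule subalgebra_at[OF t])
  interpret G: real_distribution "gauss v" for v by (rule real_distribution_gauss)
  interpret P: product_prob_space "\<lambda>i. gauss (v i)" for v :: "nat \<Rightarrow> real" ..
  define h where "h x = (\<integral>y. f (x + y) \<partial>gauss (1 - t))" for x
  have h[measurable]: "h \<in> borel_measurable borel" unfolding h_def[abs_def] by measurable
  have b0: "0 \<le> b" using b[of 0] by linarith
  have hb: "\<bar>h x\<bar> \<le> b" for x
  proof -
    have "\<bar>h x\<bar> \<le> (\<integral>y. \<bar>f (x + y)\<bar> \<partial>gauss (1 - t))" unfolding h_def by (rule integral_abs_bound)
    also have "\<dots> \<le> b"
      by (intro G.integral_le_const G.integrable_const_bound[where B = b]) (auto simp: b)
    finally show ?thesis .
  qed
  have Bt[measurable]: "B t \<in> borel_measurable M" "B 1 \<in> borel_measurable M" "B 0 \<in> borel_measurable M"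
    using t by (auto intro: random_variable)
  define \<tau> where "\<tau> i = (if i = 0 then 0 else if i = 1 then t else 1)" for i :: nat
  have \<tau>: "mono_on {..2} \<tau>" "\<tau> ` {..2} \<subseteq> {0..1}"
    using t by (auto simp: \<tau>_def mono_on_def)
  let ?PM = "Pi\<^sub>M {..<2::nat} (\<lambda>i. gauss (\<tau> (Suc i) - \<tau> i))"
  let ?D = "\<lambda>w. \<lambda>i\<in>{..<2::nat}. B (\<tau> (Suc i)) w - B (\<tau> i) w"
  have law: "distr M (Pi\<^sub>M {..<2} (\<lambda>_. borel)) ?D = ?PM"
    using increments_joint_law[OF _ \<tau>] by simp
  have sets[measurable_cong]: "sets (Pi\<^sub>M I (\<lambda>i. gauss (v i))) = sets (Pi\<^sub>M I (\<lambda>_. borel))"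
    for I :: "nat set" and v by (intro sets_PiM_cong) auto
  interpret PI: prob_space "Pi\<^sub>M I (\<lambda>i. gauss (v i))" for I :: "nat set" and v
    by (rule prob_space_PiM) unfold_locales
  have transfer: "(\<integral>w. u (B t w) (B 1 w) \<partial>M) = integral\<^sup>L ?PM (\<lambda>x. u (x 0) (x 0 + x 1))"
    if [measurable]: "case_prod u \<in> borel_measurable (borel \<Otimes>\<^sub>M borel)" for u :: "real \<Rightarrow> real \<Rightarrow> real"
  proof -
    have m: "(\<lambda>x. u (x 0) (x 0 + x 1)) \<in> borel_measurable (Pi\<^sub>M {..<2::nat} (\<lambda>_. borel))"
      by measurable
    have D: "?D \<in> measurable M (Pi\<^sub>M {..<2} (\<lambda>_. borel))"
      using \<tau>(2) by (intro measurable_restrict increment_measurable) (auto simp: image_subset_iff)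
    have "integral\<^sup>L ?PM (\<lambda>x. u (x 0) (x 0 + x 1)) =
        (\<integral>w. u (B t w - B 0 w) (B t w - B 0 w + (B 1 w - B t w)) \<partial>M)"
      unfolding law[symmetric] by (subst integral_distr[OF D m]) (simp add: \<tau>_def)
    also have "\<dots> = (\<integral>w. u (B t w) (B 1 w) \<partial>M)"
      using start by (intro integral_cong_AE) (auto elim: eventually_mono)
    finally show ?thesis ..
  qed
  have "AE w in M. real_cond_exp M (vimage_algebra (space M) (B t) borel) (\<lambda>w. f (B 1 w)) w = h (B t w)"
  proof (rule S.real_cond_exp_charact)
    show "integrable M (\<lambda>w. f (B 1 w))" by (intro integrable_const_bound[where B = b]) (auto simp: b)
    show "integrable M (\<lambda>w. h (B t w))" by (intro integrable_const_bound[where B = b]) (auto simp: hb)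
    show "(\<lambda>w. h (B t w)) \<in> borel_measurable (vimage_algebra (space M) (B t) borel)"
      by (rule measurable_compose[OF measurable_vimage_algebra1 h]) auto
    fix A assume "A \<in> sets (vimage_algebra (space M) (B t) borel)"
    then obtain U where U[measurable]: "U \<in> sets borel" and A: "A = B t -` U \<inter> space M"
      by (auto simp: sets_vimage_algebra2)
    have set: "(\<integral>w\<in>A. k w \<partial>M) = (\<integral>w. indicator U (B t w) * k w \<partial>M)" for k :: "'a \<Rightarrow> real"
      unfolding set_lebesgue_integral_def
      by (intro Bochner_Integration.integral_cong) (auto simp: A indicator_def)
    have i2: "{..<2} = insert 1 {0::nat}" by auto
    have fold: "integral\<^sup>L ?PM k = (\<integral>x. (\<integral>y. k (x(1 := y)) \<partial>gauss (1 - t)) \<partial>Pi\<^sub>M {0} (\<lambda>i. gauss (\<tau> (Suc i) - \<tau> i)))"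
      if [measurable]: "k \<in> borel_measurable (Pi\<^sub>M {..<2} (\<lambda>_. borel))" and kb: "\<And>x. \<bar>k x\<bar> \<le> b"
      for k :: "(nat \<Rightarrow> real) \<Rightarrow> real"
    proof -
      have "integrable ?PM k"
        by (rule PI.integrable_const_bound[where B = b]) (auto simp: kb)
      then show ?thesis
        unfolding i2 by (subst P.product_integral_insert) (auto simp: \<tau>_def)
    qed
    have "(\<integral>w\<in>A. f (B 1 w) \<partial>M) = integral\<^sup>L ?PM (\<lambda>x. indicator U (x 0) * f (x 0 + x 1))"
      unfolding set by (rule transfer) measurable
    also have "\<dots> = (\<integral>x. indicator U (x 0) * h (x 0) \<partial>Pi\<^sub>M {0} (\<lambda>i. gauss (\<tau> (Suc i) - \<tau> i)))"
      by (subst fold) (auto simp: h_def indicator_def b b0)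
    also have "\<dots> = integral\<^sup>L ?PM (\<lambda>x. indicator U (x 0) * h (x 0))"
      using G.prob_space[of "1 - t"] by (subst fold) (auto simp: indicator_def hb b0)
    also have "\<dots> = (\<integral>w\<in>A. h (B t w) \<partial>M)"
      unfolding set by (rule transfer[symmetric]) measurable
    finally show "(\<integral>w\<in>A. f (B 1 w) \<partial>M) = (\<integral>w\<in>A. h (B t w) \<partial>M)" .
  qed
  then show ?thesis by (simp add: cond_exp_given_def h_def)
qed

end

section \<open>Convergence of the price process\<close>

text \<open>The times of \<open>J\<close> in increasing order, with \<open>0\<close> prepended and \<open>1\<close> appended.  If \<open>1\<close> belongs to \<open>J\<close> the last two
  grid points coincide; this keeps the terminal value available for the density in all cases.\<close>

lemma finite_time_grid:
  fixes J :: "real set"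
  assumes J: "finite J" "J \<subseteq> {0<..1}"
  obtains k :: nat and \<tau> :: "nat \<Rightarrow> real" and pos :: "real \<Rightarrow> nat" where
    "mono_on {..Suc k} \<tau>" "\<tau> ` {..Suc k} \<subseteq> {0..1}" "\<tau> 0 = 0" "\<tau> (Suc k) = 1"
    "\<And>t. t \<in> J \<Longrightarrow> pos t \<le> k \<and> \<tau> (pos t) = t"
proof -
  define e where "e = sorted_list_of_set J"
  define k where "k = length e"
  have e: "sorted e" "set e = J" using J by (auto simp: e_def)
  define \<tau> where "\<tau> i = (if i = 0 then 0 else if i \<le> k then e ! (i - 1) else 1)" for i
  have in_J: "e ! (i - 1) \<in> J" if "i \<noteq> 0" "i \<le> k" for i
    using that e(2) unfolding k_def by (metis One_nat_def diff_less le_neq_implies_less less_imp_diff_less nth_mem zero_less_one not_gr_zero order_less_le_trans)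
  have rng: "\<tau> i \<in> {0..1}" for i using in_J[of i] J(2) by (auto simp: \<tau>_def)
  have "\<tau> i \<le> \<tau> j" if "i \<le> j" for i j
  proof -
    consider "i = 0" | "k < j" | "i \<noteq> 0" "j \<le> k" using not_le by blast
    then show ?thesis
    proof cases
      case 1 then show ?thesis using rng[of j] by (simp add: \<tau>_def)
    next
      case 2 then show ?thesis using rng[of i] by (simp add: \<tau>_def)
    next
      case 3
      then have "e ! (i - 1) \<le> e ! (j - 1)"
        using that by (intro sorted_nth_mono[OF e(1)]) (auto simp: k_def)
      then show ?thesis using 3 that by (simp add: \<tau>_def)
    qed
  qed
  then have mono: "mono_on {..Suc k} \<tau>" by (simp add: mono_on_def)
  have "\<exists>i\<le>k. \<tau> i = t" if "t \<in> J" for t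
  proof -
    have "t \<in> set e" using that e(2) by simp
    then obtain i where "i < k" "e ! i = t" unfolding in_set_conv_nth k_def by blast
    then show ?thesis by (intro exI[of _ "Suc i"]) (auto simp: \<tau>_def)
  qed
  then obtain pos where pos: "\<And>t. t \<in> J \<Longrightarrow> pos t \<le> k \<and> \<tau> (pos t) = t" by metis
  show ?thesis
  proof (rule that[OF mono _ _ _ pos])
    show "\<tau> ` {..Suc k} \<subseteq> {0..1}" using rng by blast
  qed (simp_all add: \<tau>_def)
qed

lemma floor_index_ratio: "(\<lambda>n. real (nat \<lfloor>real n * t\<rfloor>) / real n) \<longlonglongrightarrow> t" if "0 \<le> t" for t :: real
proof -
  have "(\<lambda>n. real_of_int \<lfloor>real n * t\<rfloor> / real n) \<longlonglongrightarrow> t" by real_asymp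
  then show ?thesis using that by simp
qed

lemma floor_index_le: "t \<le> 1 \<Longrightarrow> nat \<lfloor>real n * t\<rfloor> \<le> n" for t :: real
proof -
  assume "t \<le> 1"
  then have "real n * t \<le> real n" by (simp add: mult_left_le)
  then have "\<lfloor>real n * t\<rfloor> \<le> int n" by (metis floor_mono floor_of_nat)
  then show ?thesis by linarith
qed

lemma telescoping_block_sums:
  fixes cut :: "nat \<Rightarrow> nat"
  assumes "\<And>i. i < j \<Longrightarrow> cut i \<le> cut (Suc i)" and "cut 0 = 0"
  shows "(\<Sum>i<j. block_sum n {cut i<..cut (Suc i)} w) = block_sum n {0<..cut j} w"
  using assms(1)
proof (induction j)
  case 0
  then show ?case using assms(2) by (simp add: block_sum_def)
next
  case (Suc j)
  have "{0<..cut (Suc j)} = {0<..cut j} \<union> {cut j<..cut (Suc j)}" using Suc.prems[of j] by auto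
  then have "block_sum n {0<..cut (Suc j)} w = block_sum n {0<..cut j} w + block_sum n {cut j<..cut (Suc j)} w"
    by (simp add: block_sum_def sum.union_disjoint add_divide_distrib)
  then show ?case using Suc by simp
qed

lemma disjoint_family_blocks:
  fixes cut :: "nat \<Rightarrow> nat"
  assumes "mono_on {..k} cut"
  shows "disjoint_family_on (\<lambda>i. {cut i<..cut (Suc i)}) {..<k}"
proof -
  have *: "{cut i<..cut (Suc i)} \<inter> {cut j<..cut (Suc j)} = {}" if "i < j" "j < k" for i j
    using mono_onD[OF assms, of "Suc i" j] that by auto
  show ?thesis
    unfolding disjoint_family_on_def
  proof (intro ballI impI)
    fix i j assume "i \<in> {..<k}" "j \<in> {..<k}" "i \<noteq> j"
    then show "{cut i<..cut (Suc i)} \<inter> {cut j<..cut (Suc j)} = {}"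
      using *[of i j] *[of j i] by (cases "i < j") auto
  qed
qed

context equilibrium_sequence
begin

lemma measurable_price_kernel [measurable]: "price_kernel t \<in> borel_measurable borel"
proof -
  interpret G: real_distribution "gauss v" for v by (rule real_distribution_gauss)
  show ?thesis unfolding price_kernel_def[abs_def] by measurable
qed

text \<open>Prices and density are functions of the sums over successive blocks of steps.  The blocks are
  independent and each satisfies a central limit theorem, so the joint limit law is that of the
  corresponding Brownian increments.\<close>

lemma joint_price_expectation_tendsto:
  fixes g :: "(real \<Rightarrow> real) \<Rightarrow> real" and P :: "'a measure"
  assumes B: "standard_brownian_motion P B"
    and rep: "\<And>n. n \<ge> 1 \<Longrightarrow> represents n (p n) (X n)"
    and X: "\<And>n w. n \<ge> 1 \<Longrightarrow> w \<in> Omega n \<Longrightarrow> X n w = F n (S_sum n w)"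
    and J: "finite J" "J \<subseteq> {0<..1}"
    and g: "continuous_map (powertop_real J) euclideanreal g"
    and b: "\<And>x. x \<in> extensional J \<Longrightarrow> \<bar>g x\<bar> \<le> b"
  shows "(\<lambda>n. cube_mean n
      (\<lambda>w. g (\<lambda>t\<in>J. price_at n (p n) t w) / marginal n (S_sum n w))) \<longlonglongrightarrow>
    (\<integral>w. g (\<lambda>t\<in>J. price_kernel t (B t w)) / limit_marginal (B 1 w) \<partial>P)"
proof -
  interpret B: standard_brownian_motion P B by (rule B)
  obtain k \<tau> pos where \<tau>: "mono_on {..Suc k} \<tau>" "\<tau> ` {..Suc k} \<subseteq> {0..1}" "\<tau> 0 = 0" "\<tau> (Suc k) = 1"
    and pos: "\<And>t. t \<in> J \<Longrightarrow> pos t \<le> k \<and> \<tau> (pos t) = t"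
    using finite_time_grid[OF J] by metis
  let ?I = "{..<Suc k}"
  have \<tau>_range: "0 \<le> \<tau> i" "\<tau> i \<le> 1" if "i \<le> Suc k" for i
    using \<tau>(2) that by (auto simp: image_subset_iff)
  have \<tau>_mono: "\<tau> i \<le> \<tau> j" if "i \<le> j" "j \<le> Suc k" for i j
    using mono_onD[OF \<tau>(1), of i j] that by simp
  define q where "q n t = nat \<lfloor>real n * t\<rfloor>" for n and t :: real
  \<comment> \<open>a price depends on the steps strictly before its index, but the density on all \<open>n\<close> steps\<close>
  define cut where "cut n i = (if i \<le> k then q n (\<tau> i) - 1 else n)" for n i
  have q_le: "q n t \<le> n" if "t \<le> 1" for n t using floor_index_le[OF that] by (simp add: q_def)
  have cut_le: "cut n i \<le> n" if "i \<le> Suc k" for n i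
    using q_le[OF \<tau>_range(2)[OF that], of n] by (auto simp: cut_def)
  have cut_0: "cut n 0 = 0" for n by (simp add: cut_def q_def \<tau>)
  have cut_mono: "cut n i \<le> cut n j" if "i \<le> j" "j \<le> Suc k" for n i j
  proof (cases "j \<le> k")
    case True
    have "real n * \<tau> i \<le> real n * \<tau> j" using \<tau>_mono[OF that] by (intro mult_left_mono) auto
    then have "q n (\<tau> i) \<le> q n (\<tau> j)" unfolding q_def by (intro nat_mono floor_mono)
    then show ?thesis using True that by (simp add: cut_def)
  next
    case False
    then show ?thesis using cut_le[of i n] that by (simp add: cut_def)
  qed
  have cut_ratio: "(\<lambda>n. real (cut n i) / real n) \<longlonglongrightarrow> \<tau> i" if "i \<le> Suc k" for i
  proof (cases "i \<le> k")
    case True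
    have r: "(\<lambda>n. real (q n (\<tau> i)) / real n) \<longlonglongrightarrow> \<tau> i"
      unfolding q_def by (rule floor_index_ratio[OF \<tau>_range(1)[OF that]])
    have "(\<lambda>n. 1 / real n) \<longlonglongrightarrow> 0" by real_asymp
    from tendsto_diff[OF r this]
    have l: "(\<lambda>n. real (q n (\<tau> i)) / real n - 1 / real n) \<longlonglongrightarrow> \<tau> i" by simp
    show ?thesis
    proof (rule tendsto_sandwich[OF _ _ l r])
      show "\<forall>\<^sub>F n in sequentially. real (q n (\<tau> i)) / real n - 1 / real n \<le> real (cut n i) / real n"
        using True by (intro always_eventually allI)
          (simp add: cut_def diff_divide_distrib[symmetric] divide_right_mono)
      show "\<forall>\<^sub>F n in sequentially. real (cut n i) / real n \<le> real (q n (\<tau> i)) / real n"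
        using True by (intro always_eventually allI) (simp add: cut_def divide_right_mono)
    qed
  next
    case False
    then have "\<tau> i = 1" using that \<tau>(4) by (metis le_SucE)
    moreover have "\<forall>\<^sub>F n in sequentially. real (cut n i) / real n = 1"
      using False by (intro eventually_sequentiallyI[of 1]) (simp add: cut_def)
    ultimately show ?thesis by (simp add: tendsto_eventually)
  qed
  define blk where "blk n i = {cut n i<..cut n (Suc i)}" for n i
  have blk_sub: "blk n i \<subseteq> {1..n}" if "i \<in> ?I" for n i
    using cut_le[of "Suc i" n] that by (auto simp: blk_def)
  have blk_clt: "weak_conv_m (\<lambda>n. cube_law n (block_sum n (blk n i)))
      (gauss (\<tau> (Suc i) - \<tau> i))" if i: "i \<in> ?I" for i
  proof (rule block_sum_central_limit[OF blk_sub[OF i]])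
    have "(\<lambda>n. real (cut n (Suc i)) / real n - real (cut n i) / real n) \<longlonglongrightarrow> \<tau> (Suc i) - \<tau> i"
      using i by (intro tendsto_diff cut_ratio) auto
    moreover have "real (cut n (Suc i)) / real n - real (cut n i) / real n = real (card (blk n i)) / real n" for n
      using cut_mono[of i "Suc i" n] i by (simp add: blk_def of_nat_diff diff_divide_distrib)
    ultimately show "(\<lambda>n. real (card (blk n i)) / real n) \<longlonglongrightarrow> \<tau> (Suc i) - \<tau> i" by simp
  qed
  define f where "f n x = g (\<lambda>t\<in>J. mean_slope n (q n t) (\<Sum>i<pos t. x i)) / marginal n (\<Sum>i\<in>?I. x i)"
    for n and x :: "nat \<Rightarrow> real"
  define f' where "f' x = g (\<lambda>t\<in>J. price_kernel t (\<Sum>i<pos t. x i)) / limit_marginal (\<Sum>i\<in>?I. x i)"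
    for x :: "nat \<Rightarrow> real"
  have gm[measurable]: "g \<in> borel_measurable (Pi\<^sub>M J (\<lambda>_. borel))"
    by (rule continuous_powertop_measurable[OF J(1) g])
  have partial_sum: "(\<lambda>x. \<Sum>i<pos t. x i) \<in> borel_measurable (Pi\<^sub>M ?I (\<lambda>_. borel :: real measure))" if "t \<in> J" for t
    using pos[OF that] by (intro borel_measurable_sum measurable_component_singleton) auto
  have fm: "f n \<in> borel_measurable (Pi\<^sub>M ?I (\<lambda>_. borel))" for n
    unfolding f_def
    by (intro borel_measurable_divide measurable_compose[OF measurable_restrict gm]
        measurable_compose[OF _ measurable_marginal(1)] measurable_compose[OF partial_sum measurable_mean_slope]
        borel_measurable_sum measurable_component_singleton)
  have f'm: "f' \<in> borel_measurable (Pi\<^sub>M ?I (\<lambda>_. borel))"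
    unfolding f'_def
    by (intro borel_measurable_divide measurable_compose[OF measurable_restrict gm]
        measurable_compose[OF _ measurable_marginal(2)] measurable_compose[OF partial_sum measurable_price_kernel]
        borel_measurable_sum measurable_component_singleton)
  have b0: "0 \<le> b" using b[of "\<lambda>_. undefined"] by (simp add: extensional_def)
  have fb: "\<bar>f n x\<bar> \<le> b * (1 / \<epsilon>)" for n x
  proof -
    have "\<bar>f n x\<bar> = \<bar>g (\<lambda>t\<in>J. mean_slope n (q n t) (\<Sum>i<pos t. x i))\<bar> * \<bar>1 / marginal n (\<Sum>i\<in>?I. x i)\<bar>"
      by (simp add: f_def abs_mult)
    also have "\<dots> \<le> b * (1 / \<epsilon>)"
      by (intro mult_mono b marginal_bounds(3)) (auto simp: b0)
    finally show ?thesis .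
  qed
  have conv: "(\<lambda>n. f n (x n)) \<longlonglongrightarrow> f' l"
    if "\<And>i. i \<in> ?I \<Longrightarrow> (\<lambda>n. x n i) \<longlonglongrightarrow> l i" for x :: "nat \<Rightarrow> nat \<Rightarrow> real" and l
    unfolding f_def f'_def
  proof (intro tendsto_divide continuous_powertop_sequentially[OF g])
    fix t assume t: "t \<in> J"
    have "0 \<le> t" "t \<le> 1" using t J(2) by auto
    have "(\<lambda>n. \<Sum>i<pos t. x n i) \<longlonglongrightarrow> (\<Sum>i<pos t. l i)"
      using pos[OF t] by (intro tendsto_sum that) auto
    from continuously_convergesD[OF mean_slope_continuously_converges[of "\<lambda>n. q n t" t] this]
    show "(\<lambda>n. (\<lambda>t\<in>J. mean_slope n (q n t) (\<Sum>i<pos t. x n i)) t) \<longlonglongrightarrow>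
        (\<lambda>t\<in>J. price_kernel t (\<Sum>i<pos t. l i)) t"
      using t floor_index_ratio[OF \<open>0 \<le> t\<close>] q_le[OF \<open>t \<le> 1\<close>] by (simp add: q_def)
  next
    show "(\<lambda>n. marginal n (\<Sum>i\<in>?I. x n i)) \<longlonglongrightarrow> limit_marginal (\<Sum>i\<in>?I. l i)"
      by (intro continuously_convergesD[OF marginal_continuously_converges] tendsto_sum that)
    show "limit_marginal (\<Sum>i\<in>?I. l i) \<noteq> 0"
      using limit_marginal_bounds(2)[of "\<Sum>i\<in>?I. l i"] by simp
  qed auto
  have "(\<lambda>n. integral\<^sup>L (Pi\<^sub>M ?I (\<lambda>i. cube_law n (block_sum n (blk n i)))) (f n)) \<longlonglongrightarrow>
      integral\<^sup>L (Pi\<^sub>M ?I (\<lambda>i. gauss (\<tau> (Suc i) - \<tau> i))) f'"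
    by (rule PiM_integral_continuously_converges[OF finite_lessThan real_distribution_cube real_distribution_gauss
          blk_clt fm fb conv]) auto
  also have "integral\<^sup>L (Pi\<^sub>M ?I (\<lambda>i. gauss (\<tau> (Suc i) - \<tau> i))) f' =
      (\<integral>w. g (\<lambda>t\<in>J. price_kernel t (B t w)) / limit_marginal (B 1 w) \<partial>P)"
  proof -
    let ?D = "\<lambda>w. \<lambda>i\<in>?I. B (\<tau> (Suc i)) w - B (\<tau> i) w"
    have D: "?D \<in> measurable P (Pi\<^sub>M ?I (\<lambda>_. borel))"
      using \<tau>_range by (intro measurable_restrict B.increment_measurable) auto
    have law: "distr P (Pi\<^sub>M ?I (\<lambda>_. borel)) ?D = Pi\<^sub>M ?I (\<lambda>i. gauss (\<tau> (Suc i) - \<tau> i))"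
      by (rule B.increments_joint_law[OF _ \<tau>(1,2)]) simp
    have Bm: "B t \<in> borel_measurable P" if "t \<in> insert 1 J" for t
      using that J(2) by (intro B.random_variable) auto
    have sum: "(\<Sum>i<j. ?D w i) = B (\<tau> j) w - B 0 w" if "j \<le> Suc k" for j w
    proof -
      have "(\<Sum>i<j. ?D w i) = (\<Sum>i<j. B (\<tau> (Suc i)) w - B (\<tau> i) w)"
        using that by (intro sum.cong) auto
      also have "\<dots> = B (\<tau> j) w - B (\<tau> 0) w" by (rule sum_lessThan_telescope)
      finally show ?thesis by (simp add: \<tau>(3))
    qed
    have "integral\<^sup>L (Pi\<^sub>M ?I (\<lambda>i. gauss (\<tau> (Suc i) - \<tau> i))) f' = (\<integral>w. f' (?D w) \<partial>P)"
      unfolding law[symmetric] by (rule integral_distr[OF D f'm])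
    also have "\<dots> = (\<integral>w. g (\<lambda>t\<in>J. price_kernel t (B t w)) / limit_marginal (B 1 w) \<partial>P)"
    proof (rule integral_cong_AE)
      show "(\<lambda>w. f' (?D w)) \<in> borel_measurable P" by (rule measurable_compose[OF D f'm])
      show "(\<lambda>w. g (\<lambda>t\<in>J. price_kernel t (B t w)) / limit_marginal (B 1 w)) \<in> borel_measurable P"
        by (intro borel_measurable_divide measurable_compose[OF measurable_restrict gm]
            measurable_compose[OF _ measurable_price_kernel] measurable_compose[OF _ measurable_marginal(2)] Bm) auto
      show "AE w in P. f' (?D w) = g (\<lambda>t\<in>J. price_kernel t (B t w)) / limit_marginal (B 1 w)"
        using B.start
      proof eventually_elim
        fix w assume "B 0 w = 0"
        then have s: "(\<Sum>i<j. ?D w i) = B (\<tau> j) w" if "j \<le> Suc k" for j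
          using sum[OF that] by simp
        have "(\<lambda>t\<in>J. price_kernel t (\<Sum>i<pos t. ?D w i)) = (\<lambda>t\<in>J. price_kernel t (B t w))"
        proof (rule restrict_ext)
          fix t assume "t \<in> J"
          then show "price_kernel t (\<Sum>i<pos t. ?D w i) = price_kernel t (B t w)"
            using pos[of t] by (subst s) auto
        qed
        then show "f' (?D w) = g (\<lambda>t\<in>J. price_kernel t (B t w)) / limit_marginal (B 1 w)"
          unfolding f'_def by (simp only: s[OF order_refl] \<tau>(4))
      qed
    qed
    finally show ?thesis .
  qed
  finally have lim: "(\<lambda>n. integral\<^sup>L (Pi\<^sub>M ?I (\<lambda>i. cube_law n (block_sum n (blk n i)))) (f n)) \<longlonglongrightarrow>
      (\<integral>w. g (\<lambda>t\<in>J. price_kernel t (B t w)) / limit_marginal (B 1 w) \<partial>P)" .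
  have "\<forall>\<^sub>F n in sequentially. \<forall>t\<in>J. 1 \<le> real n * t"
    unfolding eventually_ball_finite_distrib[OF J(1)]
  proof
    fix t assume "t \<in> J"
    then have "0 < t" using J(2) by auto
    then show "\<forall>\<^sub>F n in sequentially. 1 \<le> real n * t" by real_asymp
  qed
  then have "\<forall>\<^sub>F n in sequentially.
      integral\<^sup>L (Pi\<^sub>M ?I (\<lambda>i. cube_law n (block_sum n (blk n i)))) (f n) =
      cube_mean n (\<lambda>w. g (\<lambda>t\<in>J. price_at n (p n) t w) / marginal n (S_sum n w))"
    using eventually_ge_at_top[of 1]
  proof eventually_elim
    fix n :: nat assume nJ: "\<forall>t\<in>J. 1 \<le> real n * t" and n: "1 \<le> n"
    let ?D = "\<lambda>w. \<lambda>i\<in>?I. block_sum n (blk n i) w"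
    have D: "?D \<in> measurable (measure_pmf (cube n)) (Pi\<^sub>M ?I (\<lambda>_. borel))"
      by (intro measurable_restrict) simp
    have "mono_on {..Suc k} (cut n)" using cut_mono by (auto simp: mono_on_def)
    then have "prob_space.indep_vars (measure_pmf (cube n)) (\<lambda>_. borel) (\<lambda>i. block_sum n (blk n i)) ?I"
      using blk_sub unfolding blk_def by (intro cube_indep_block_sums disjoint_family_blocks) auto
    then have law: "distr (measure_pmf (cube n)) (Pi\<^sub>M ?I (\<lambda>_. borel)) ?D =
        Pi\<^sub>M ?I (\<lambda>i. cube_law n (block_sum n (blk n i)))"
      by (subst (asm) prob_space.indep_vars_iff_distr_eq_PiM'[OF measure_pmf.prob_space_axioms]) auto
    have "integral\<^sup>L (Pi\<^sub>M ?I (\<lambda>i. cube_law n (block_sum n (blk n i)))) (f n) =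
        cube_mean n (\<lambda>w. f n (?D w))"
      unfolding law[symmetric] by (rule integral_distr[OF D fm])
    also have "\<dots> = cube_mean n
        (\<lambda>w. g (\<lambda>t\<in>J. price_at n (p n) t w) / marginal n (S_sum n w))"
    proof (rule cube_expectation_cong)
      fix w assume w: "w \<in> Omega n"
      have s: "(\<Sum>i<j. ?D w i) = block_sum n {0<..cut n j} w" if "j \<le> Suc k" for j
      proof -
        have "(\<Sum>i<j. ?D w i) = (\<Sum>i<j. block_sum n {cut n i<..cut n (Suc i)} w)"
          using that by (intro sum.cong) (auto simp: blk_def)
        also have "\<dots> = block_sum n {0<..cut n j} w"
          using that by (intro telescoping_block_sums cut_mono cut_0) auto
        finally show ?thesis .
      qed
      have "(\<lambda>t\<in>J. mean_slope n (q n t) (\<Sum>i<pos t. ?D w i)) = (\<lambda>t\<in>J. price_at n (p n) t w)"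
      proof (rule restrict_ext)
        fix t assume t: "t \<in> J"
        then have "1 \<le> real n * t" "t \<le> 1" using nJ J(2) by auto
        then have "1 \<le> \<lfloor>real n * t\<rfloor>" by simp
        then have "1 \<le> q n t" unfolding q_def by linarith
        then have q: "q n t \<in> {1..n}" using q_le[OF \<open>t \<le> 1\<close>, of n] by simp
        have "price_at n (p n) t w = mean_slope n (q n t) (block_sum n {0<..q n t - 1} w)"
          unfolding price_at_def mean_slope_def q_def[symmetric]
          by (rule price_eq_mean_slope[OF rep[OF n] X[OF n] w q])
        moreover have "(\<Sum>i<pos t. ?D w i) = block_sum n {0<..cut n (pos t)} w"
          by (rule s) (use pos[OF t] in simp)
        moreover have "cut n (pos t) = q n t - 1" using pos[OF t] by (simp add: cut_def)
        ultimately show "mean_slope n (q n t) (\<Sum>i<pos t. ?D w i) = price_at n (p n) t w"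
          by (simp only:)
      qed
      moreover have "(\<Sum>i\<in>?I. ?D w i) = S_sum n w"
      proof -
        have "{0<..n} = {1..n}" by auto
        moreover have "cut n (Suc k) = n" by (simp add: cut_def)
        ultimately show ?thesis using s[OF order_refl] by (simp only: S_sum_eq_block_sum)
      qed
      ultimately show "f n (?D w) = g (\<lambda>t\<in>J. price_at n (p n) t w) / marginal n (S_sum n w)"
        unfolding f_def by (simp only:)
    qed
    finally show "integral\<^sup>L (Pi\<^sub>M ?I (\<lambda>i. cube_law n (block_sum n (blk n i)))) (f n) =
      cube_mean n (\<lambda>w. g (\<lambda>t\<in>J. price_at n (p n) t w) / marginal n (S_sum n w))" .
  qed
  from Lim_transform_eventually[OF lim this] show ?thesis .
qed

lemma Y_tilde_eq: "Y_tilde B H \<psi> w = limit_marginal (B 1 w)"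
  by (simp add: Y_tilde_def limit_marginal_def deriv_eq DERIV_imp_deriv[OF \<psi>_deriv])

lemma y_tilde_eq:
  assumes "standard_brownian_motion P B"
  shows "y_tilde P B H \<psi> w = 1 / (normalizer * limit_marginal (B 1 w))"
proof -
  interpret B: standard_brownian_motion P B by fact
  have "(\<integral>w. 1 / limit_marginal (B 1 w) \<partial>P) = integral\<^sup>L (distr P borel (B 1)) (\<lambda>x. 1 / limit_marginal x)"
    using B.random_variable[of 1] by (subst integral_distr) auto
  then show ?thesis
    by (simp add: y_tilde_def Y_tilde_eq B.terminal_law normalizer_def)
qed

lemma y_tilde_pos: "standard_brownian_motion P B \<Longrightarrow> 0 < y_tilde P B H \<psi> w"
  using normalizer_pos limit_marginal_bounds(2) by (simp add: y_tilde_eq)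

lemma limit_price_eq:
  assumes "standard_brownian_motion P B" "t \<in> {0..1}"
  shows "AE w in P. limit_price P B \<psi> t w = price_kernel t (B t w)"
proof -
  interpret B: standard_brownian_motion P B by fact
  have "deriv \<psi> = \<gamma>" using DERIV_imp_deriv[OF \<psi>_deriv] by (simp add: fun_eq_iff)
  moreover have "\<bar>\<gamma> x\<bar> \<le> 1" for x using gam_range[of x] by auto
  ultimately show ?thesis
    using B.markov_conditional_expectation[OF assms(2), of \<gamma> 1]
    by (simp add: limit_price_def price_kernel_def)
qed

lemma price_process_fdd_convergence:
  assumes B: "standard_brownian_motion P B"
    and rep: "\<And>n. n \<ge> 1 \<Longrightarrow> represents n (p n) (X n)"
    and X: "\<And>n w. n \<ge> 1 \<Longrightarrow> w \<in> Omega n \<Longrightarrow> X n w = F n (S_sum n w)"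
  shows "fdd_convergence {0<..1} \<pi> (\<lambda>n t z. price_at n (p n) t (fst z))
      (density P (\<lambda>w. ennreal (y_tilde P B H \<psi> w))) (limit_price P B \<psi>)"
  unfolding fdd_convergence_def weak_conv_on_def
proof (intro allI impI)
  fix J :: "real set" and g :: "(real \<Rightarrow> real) \<Rightarrow> real"
  assume J: "finite J" "J \<subseteq> {0<..1}" and g: "continuous_map (powertop_real J) euclideanreal g"
    and "bounded (g ` (J \<rightarrow>\<^sub>E UNIV))"
  interpret B: standard_brownian_motion P B by fact
  obtain b where b: "\<And>x. x \<in> extensional J \<Longrightarrow> \<bar>g x\<bar> \<le> b"
    using \<open>bounded (g ` (J \<rightarrow>\<^sub>E UNIV))\<close> by (auto simp: bounded_iff PiE_def)
  have gm: "g \<in> borel_measurable (Pi\<^sub>M J (\<lambda>_. borel))"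
    by (rule continuous_powertop_measurable[OF J(1) g])
  have J01: "t \<in> {0..1}" if "t \<in> J" for t using that J(2) by auto
  let ?G = "\<lambda>n w. g (\<lambda>t\<in>J. price_at n (p n) t w)"
  let ?L = "\<integral>w. g (\<lambda>t\<in>J. price_kernel t (B t w)) / limit_marginal (B 1 w) \<partial>P"
  have lim: "(\<lambda>n. \<integral>z. ?G n (fst z) \<partial>\<pi> n) \<longlonglongrightarrow> ?L / normalizer"
  proof (rule equilibrium_expectation_tendsto[where b = b])
    show "\<bar>?G n w\<bar> \<le> b" for n w by (rule b) (rule restrict_extensional)
    show "(\<lambda>n. cube_mean n (\<lambda>w. ?G n w / marginal n (S_sum n w))) \<longlonglongrightarrow> ?L"
      by (rule joint_price_expectation_tendsto[OF B rep X J g b])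
  qed
  have ev: "\<forall>\<^sub>F n in sequentially. (\<integral>z. ?G n (fst z) \<partial>\<pi> n) =
      (\<integral>x. g x \<partial>law_on J (\<pi> n) (\<lambda>t z. price_at n (p n) t (fst z)))"
  proof (intro eventually_sequentiallyI[of 1])
    fix n :: nat assume "1 \<le> n"
    have "(\<lambda>z. \<lambda>t\<in>J. price_at n (p n) t (fst z)) \<in> measurable (\<pi> n) (Pi\<^sub>M J (\<lambda>_. borel))"
    proof (rule measurable_restrict)
      fix t show "(\<lambda>z. price_at n (p n) t (fst z)) \<in> borel_measurable (\<pi> n)"
        by (rule strategies1_measurable[OF strategy[OF \<open>1 \<le> n\<close>], of "\<lambda>w l. price_at n (p n) t w"]) simp
    qed
    then show "(\<integral>z. ?G n (fst z) \<partial>\<pi> n) = (\<integral>x. g x \<partial>law_on J (\<pi> n) (\<lambda>t z. price_at n (p n) t (fst z)))"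
      unfolding law_on_def using gm by (subst integral_distr) auto
  qed
  have limit_law: "?L / normalizer = (\<integral>x. g x \<partial>law_on J (density P (\<lambda>w. ennreal (y_tilde P B H \<psi> w))) (limit_price P B \<psi>))"
  proof -
    let ?W = "\<lambda>w. \<lambda>t\<in>J. limit_price P B \<psi> t w"
    have B1[measurable]: "B 1 \<in> borel_measurable P" by (rule B.random_variable) simp
    have Wt: "limit_price P B \<psi> t \<in> borel_measurable P" if "t \<in> J" for t
    proof -
      interpret S: finite_measure_subalgebra P "vimage_algebra (space P) (B t) borel"
        by (rule B.subalgebra_at[OF J01[OF that]])
      show ?thesis
        unfolding limit_price_def cond_exp_given_def
        by (rule measurable_from_subalg[OF S.subalg borel_measurable_cond_exp])
    qed
    then have W: "?W \<in> measurable P (Pi\<^sub>M J (\<lambda>_. borel))" by (rule measurable_restrict)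
    have y: "y_tilde P B H \<psi> = (\<lambda>w. 1 / (normalizer * limit_marginal (B 1 w)))"
      using y_tilde_eq[OF B] by (simp add: fun_eq_iff)
    have ym: "y_tilde P B H \<psi> \<in> borel_measurable P" unfolding y by measurable
    have "(\<integral>x. g x \<partial>law_on J (density P (\<lambda>w. ennreal (y_tilde P B H \<psi> w))) (limit_price P B \<psi>)) =
        (\<integral>w. g (?W w) \<partial>density P (\<lambda>w. ennreal (y_tilde P B H \<psi> w)))"
      unfolding law_on_def using W gm by (subst integral_distr) auto
    also have "\<dots> = (\<integral>w. y_tilde P B H \<psi> w *\<^sub>R g (?W w) \<partial>P)"
      using y_tilde_pos[OF B] ym measurable_compose[OF W gm]
      by (intro integral_density) (auto simp: less_imp_le)
    also have "\<dots> = (\<integral>w. g (\<lambda>t\<in>J. price_kernel t (B t w)) / limit_marginal (B 1 w) / normalizer \<partial>P)"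
    proof (rule integral_cong_AE)
      show "(\<lambda>w. y_tilde P B H \<psi> w *\<^sub>R g (?W w)) \<in> borel_measurable P"
        using ym measurable_compose[OF W gm] by measurable
      have "(\<lambda>w. g (\<lambda>t\<in>J. price_kernel t (B t w))) \<in> borel_measurable P"
        using J01 by (intro measurable_compose[OF measurable_restrict gm]
          measurable_compose[OF _ measurable_price_kernel] B.random_variable)
      then show "(\<lambda>w. g (\<lambda>t\<in>J. price_kernel t (B t w)) / limit_marginal (B 1 w) / normalizer) \<in> borel_measurable P"
        by measurable
      have "AE w in P. \<forall>t\<in>J. limit_price P B \<psi> t w = price_kernel t (B t w)"
        using J01 limit_price_eq[OF B] by (intro AE_finite_allI J(1)) auto
      then show "AE w in P. y_tilde P B H \<psi> w *\<^sub>R g (?W w) =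
          g (\<lambda>t\<in>J. price_kernel t (B t w)) / limit_marginal (B 1 w) / normalizer"
      proof eventually_elim
        fix w assume "\<forall>t\<in>J. limit_price P B \<psi> t w = price_kernel t (B t w)"
        then have "?W w = (\<lambda>t\<in>J. price_kernel t (B t w))" by (intro restrict_ext) simp
        then show "y_tilde P B H \<psi> w *\<^sub>R g (?W w) =
          g (\<lambda>t\<in>J. price_kernel t (B t w)) / limit_marginal (B 1 w) / normalizer"
          by (simp add: y)
      qed
    qed
    also have "\<dots> = ?L / normalizer" by (rule integral_divide_zero)
    finally show ?thesis ..
  qed
  from Lim_transform_eventually[OF lim ev]
  show "(\<lambda>n. \<integral>x. g x \<partial>law_on J (\<pi> n) (\<lambda>t z. price_at n (p n) t (fst z))) \<longlonglongrightarrow>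
      (\<integral>x. g x \<partial>law_on J (density P (\<lambda>w. ennreal (y_tilde P B H \<psi> w))) (limit_price P B \<psi>))"
    by (simp only: limit_law)
qed

end

theorem theorem39:
  fixes \<mu> \<nu> :: "real measure"
    and H :: "real \<Rightarrow> real"
    and \<pi> :: "nat \<Rightarrow> ((nat \<Rightarrow> real) \<times> real) measure"
    and X :: "nat \<Rightarrow> (nat \<Rightarrow> real) \<Rightarrow> real"
    and p :: "nat \<Rightarrow> nat \<Rightarrow> (nat \<Rightarrow> real) \<Rightarrow> real"
    and P :: "'a measure"
    and B :: "real \<Rightarrow> 'a \<Rightarrow> real"
  assumes "admissible_prior \<mu>"
    and "admissible_utility H"
    and "\<And>n. n \<ge> 1 \<Longrightarrow> nash_equilibrium \<mu> H n (\<pi> n) (X n)"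
    and "\<And>n. n \<ge> 1 \<Longrightarrow> represents n (p n) (X n)"
    and "real_distribution \<nu>"
    and "T_op \<mu> H std_normal_distribution \<nu> = std_normal_distribution"
    and "standard_brownian_motion P B"
  defines "\<psi> \<equiv> Psi \<mu> std_normal_distribution \<nu>"
  shows "(\<forall>\<omega>\<in>space P. y_tilde P B H \<psi> \<omega> > 0) \<and>
    fdd_convergence {0<..1}
      \<pi> (\<lambda>n t z. price_at n (p n) t (fst z))
      (density P (\<lambda>\<omega>. ennreal (y_tilde P B H \<psi> \<omega>))) (limit_price P B \<psi>)"
proof -
  obtain \<epsilon> K C where u: "utility H (deriv H) \<epsilon> K C"
    by (rule admissible_utility_imp_utility[OF assms(2)])
  interpret prior \<mu> by unfold_locales (rule assms(1))
  have "prior_coupling \<mu> \<nu>"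
    by (intro prior_coupling.intro prior_coupling_axioms.intro prior_axioms assms(5))
  with u have fp: "fixed_point H (deriv H) \<epsilon> K C \<mu> \<nu>"
    by (intro fixed_point.intro fixed_point_axioms.intro assms(6))
  interpret utility H "deriv H" \<epsilon> K C by (rule u)
  have "\<exists>F c. convex_on UNIV F \<and> (\<forall>x y. \<bar>F x - F y\<bar> \<le> \<bar>x - y\<bar>) \<and>
      (n \<ge> 1 \<longrightarrow> potential_equilibrium n (\<pi> n) F c \<and> (\<forall>\<omega>\<in>Omega n. X n \<omega> = F (S_sum n \<omega>)))" for n
  proof (cases "n \<ge> 1")
    case True
    then show ?thesis
      using nash_equilibrium_potential[OF assms(3)[OF True] AE_unit_interval True]
      unfolding potential_equilibrium_def by blast
  next
    case False
    \<comment> \<open>a filler value, so that the potentials form a sequence indexed by all natural numbers\<close>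
    then show ?thesis by (intro exI[of _ "\<lambda>_. 0"]) (auto simp: convex_on_def)
  qed
  then obtain F c where F: "\<And>n. convex_on UNIV (F n)" "\<And>n x y. \<bar>F n x - F n y\<bar> \<le> \<bar>x - y\<bar>"
      "\<And>n. n \<ge> 1 \<Longrightarrow> potential_equilibrium n (\<pi> n) (F n) (c n)"
      "\<And>n \<omega>. n \<ge> 1 \<Longrightarrow> \<omega> \<in> Omega n \<Longrightarrow> X n \<omega> = F n (S_sum n \<omega>)"
    by metis
  have "equilibrium_sequence H (deriv H) \<epsilon> K C \<mu> \<nu> \<pi> F c"
    using F assms(3)
    by (intro equilibrium_sequence.intro equilibrium_sequence_axioms.intro fp) (auto simp: nash_equilibrium_def)
  then interpret equilibrium_sequence H "deriv H" \<epsilon> K C \<mu> \<nu> \<pi> F c .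
  show ?thesis
    unfolding \<psi>_def
    using y_tilde_pos[OF assms(7)] price_process_fdd_convergence[OF assms(7,4) F(4)] by blast
qed

end
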